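(* Let $n\ge2$ and let $\Omega\subsetneq\mathbb{R}^n$ be a domain with boundary of class $\mathcal{C}^2$ satisfying a uniform interior sphere condition. Then $\Omega$ is mean convex, i.e. $\mathcal{H}(y)\ge0$ for all $y\in\partial\Omega$, if and only if $-\Delta d\ge 0$ in $\Omega$ in the sense of distributions.
   Context: A domain is an open connected subset of $\mathbb{R}^n$. $d(x):=\operatorname{dist}(x,\mathbb{R}^n\setminus\Omega)$ for $x\in\Omega$. $-\Delta d\ge0$ in the sense of distributions means $-\int_\Omega d\,\Delta\phi\,dx\ge0$ for all $0\le\phi\in C_c^\infty(\Omega)$. Mean curvature: $\mathcal{H}(y):=\frac{1}{n-1}\sum_{i=1}^{n-1}\kappa_i(y)$, where $\kappa_i(y)$ are the principal curvatures of $\partial\Omega$ at $y$, with the sign convention that they equal $1/R$ when $\Omega$ is a ball of radius $R$. $\Omega$ satisfies a uniform interior sphere condition if there is $r_0>0$ such that for every $y\in\partial\Omega$ there is an open ball $B\subset\Omega$ of radius at least $r_0$ with $\overline{B}\cap(\mathbb{R}^n\setminus\Omega)=\{y\}$. *)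

theory Defs
  imports "HOL-Analysis.Analysis" "HOL-Library.Multiset"
begin

definition partial_deriv :: "'a::euclidean_space \<Rightarrow> ('a \<Rightarrow> real) \<Rightarrow> 'a \<Rightarrow> real" where
  "partial_deriv b f x = frechet_derivative f (at x) b"

(* Meant for open S.  Total differentiability at each level, together with the continuity
   demanded at level 0, makes this the usual class C^k. *)
primrec Ck_on :: "nat \<Rightarrow> 'a::euclidean_space set \<Rightarrow> ('a \<Rightarrow> real) \<Rightarrow> bool" where
  "Ck_on 0 S f \<longleftrightarrow> continuous_on S f"
| "Ck_on (Suc k) S f \<longleftrightarrow>
     (\<forall>x\<in>S. f differentiable (at x)) \<and> (\<forall>b\<in>Basis. Ck_on k S (partial_deriv b f))"

definition gradient :: "('a::euclidean_space \<Rightarrow> real) \<Rightarrow> 'a \<Rightarrow> 'a" where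
  "gradient f x = (\<Sum>b\<in>Basis. partial_deriv b f x *\<^sub>R b)"

definition laplacian :: "('a::euclidean_space \<Rightarrow> real) \<Rightarrow> 'a \<Rightarrow> real" where
  "laplacian f x = (\<Sum>b\<in>Basis. partial_deriv b (partial_deriv b f) x)"

definition bdist :: "'a::euclidean_space set \<Rightarrow> 'a \<Rightarrow> real" where
  "bdist \<Omega> x = infdist x (- \<Omega>)"

(* Elements of C_c^\<infinity>(\<Omega>), extended by zero to the whole space. *)
definition test_function :: "'a::euclidean_space set \<Rightarrow> ('a \<Rightarrow> real) \<Rightarrow> bool" where
  "test_function \<Omega> \<phi> \<longleftrightarrow>
     (\<forall>k. Ck_on k UNIV \<phi>) \<and> compact (closure {x. \<phi> x \<noteq> 0}) \<and> closure {x. \<phi> x \<noteq> 0} \<subseteq> \<Omega>"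

definition neg_laplacian_nonneg_distr :: "'a::euclidean_space set \<Rightarrow> ('a \<Rightarrow> real) \<Rightarrow> bool" where
  "neg_laplacian_nonneg_distr \<Omega> u \<longleftrightarrow>
     (\<forall>\<phi>. test_function \<Omega> \<phi> \<longrightarrow> (\<forall>x. 0 \<le> \<phi> x) \<longrightarrow>
        - (LINT x:\<Omega>|lborel. u x * laplacian \<phi> x) \<ge> 0)"

(* \<rho> is positive exactly inside \<Omega> near y.  As the gradient does not vanish on U, this
   forces the boundary to be the zero set of \<rho> in U, with \<Omega> on one side of it only.
   Local graph charts and boundary-straightening diffeomorphisms of class C^2 yield such
   \<rho> directly, and conversely by the implicit function theorem. *)
definition local_defining_function ::
    "'a::euclidean_space set \<Rightarrow> 'a \<Rightarrow> ('a \<Rightarrow> real) \<Rightarrow> bool" where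
  "local_defining_function \<Omega> y \<rho> \<longleftrightarrow>
     (\<exists>U. open U \<and> y \<in> U \<and> Ck_on 2 U \<rho> \<and> (\<forall>x\<in>U. gradient \<rho> x \<noteq> 0) \<and>
          \<Omega> \<inter> U = {x\<in>U. \<rho> x > 0})"

definition C2_boundary :: "'a::euclidean_space set \<Rightarrow> bool" where
  "C2_boundary \<Omega> \<longleftrightarrow> (\<forall>y\<in>frontier \<Omega>. \<exists>\<rho>. local_defining_function \<Omega> y \<rho>)"

definition inner_normal :: "('a::euclidean_space \<Rightarrow> real) \<Rightarrow> 'a \<Rightarrow> 'a" where
  "inner_normal \<rho> x = gradient \<rho> x /\<^sub>R norm (gradient \<rho> x)"

definition tangent_space :: "('a::euclidean_space \<Rightarrow> real) \<Rightarrow> 'a \<Rightarrow> 'a set" where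
  "tangent_space \<rho> y = {v. v \<bullet> inner_normal \<rho> y = 0}"

(* The Weingarten map -dN, used on the tangent space only.  For the ball of radius R centred
   at 0, N x = - x / norm x on the boundary, so that it is v / R for tangent v. *)
definition shape_operator :: "('a::euclidean_space \<Rightarrow> real) \<Rightarrow> 'a \<Rightarrow> 'a \<Rightarrow> 'a" where
  "shape_operator \<rho> y v = - frechet_derivative (inner_normal \<rho>) (at y) v"

definition curvature_eigenspace :: "('a::euclidean_space \<Rightarrow> real) \<Rightarrow> 'a \<Rightarrow> real \<Rightarrow> 'a set" where
  "curvature_eigenspace \<rho> y \<kappa> = {v \<in> tangent_space \<rho> y. shape_operator \<rho> y v = \<kappa> *\<^sub>R v}"

(* The eigenvalues of the shape operator, with multiplicity.  That operator is self-adjoint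
   on the tangent space, hence there are DIM('a) - 1 of them. *)
definition principal_curvatures_wrt ::
    "('a::euclidean_space \<Rightarrow> real) \<Rightarrow> 'a \<Rightarrow> real multiset" where
  "principal_curvatures_wrt \<rho> y =
     (\<Sum>\<kappa> | curvature_eigenspace \<rho> y \<kappa> \<noteq> {0}.
        replicate_mset (dim (curvature_eigenspace \<rho> y \<kappa>)) \<kappa>)"

(* The result does not depend on the \<rho> chosen. *)
definition principal_curvatures :: "'a::euclidean_space set \<Rightarrow> 'a \<Rightarrow> real multiset" where
  "principal_curvatures \<Omega> y =
     principal_curvatures_wrt (SOME \<rho>. local_defining_function \<Omega> y \<rho>) y"

definition mean_curvature :: "'a::euclidean_space set \<Rightarrow> 'a \<Rightarrow> real" where
  "mean_curvature \<Omega> y = 1 / (real DIM('a) - 1) * (\<Sum>\<^sub># (principal_curvatures \<Omega> y))"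

definition mean_convex :: "'a::euclidean_space set \<Rightarrow> bool" where
  "mean_convex \<Omega> \<longleftrightarrow> (\<forall>y\<in>frontier \<Omega>. mean_curvature \<Omega> y \<ge> 0)"

definition uniform_interior_sphere :: "'a::euclidean_space set \<Rightarrow> bool" where
  "uniform_interior_sphere \<Omega> \<longleftrightarrow>
     (\<exists>r0>0. \<forall>y\<in>frontier \<Omega>. \<exists>c r. r \<ge> r0 \<and> ball c r \<subseteq> \<Omega> \<and>
        closure (ball c r) \<inter> (- \<Omega>) = {y})"

end

theory Submission
  imports Defs "HOL-Computational_Algebra.Polynomial"
begin

text \<open>
  Write \<open>D\<^sub>r u\<close> for the sum over the coordinate directions of the symmetric second differences of \<open>u\<close>
  with step \<open>r\<close>. Translation invariance gives \<open>\<integral> (D\<^sub>r d) \<phi> = \<integral> d (D\<^sub>r \<phi>)\<close>, and after division by \<open>r\<^sup>2\<close> the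
  right-hand side tends to \<open>\<integral> d \<Delta>\<phi>\<close>. So the distributional inequality is decided by pointwise bounds
  for \<open>D\<^sub>r d\<close>, and no regularity of \<open>d\<close> is needed.

  Let \<open>y\<close> be a nearest boundary point of \<open>x\<close>. Moving \<open>y\<close> along the boundary while \<open>x\<close> moves parallel to the
  tangent space yields a quadratic polynomial touching \<open>d\<close> from above at \<open>x\<close> whose Laplacian is
  arbitrarily close to \<open>-(n - 1) H(y)\<close>. Hence \<open>H \<ge> 0\<close> gives \<open>D\<^sub>r d \<le> o(r\<^sup>2)\<close> everywhere in the domain.

  Conversely, if \<open>H < 0\<close> at some boundary point, then at all points of the domain near it there is
  a quadratic polynomial with Laplacian bounded below by a positive constant that touches \<open>d\<close> from
  below, and a bump function supported there violates the distributional inequality.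

  The sum of the principal curvatures is identified with the tangential trace of the Hessian of the
  defining function by diagonalising the shape operator.
\<close>

section \<open>Gradient, Hessian and Taylor expansion\<close>

text \<open>The two barriers differ in strength. An upper bound for \<open>bdist\<close> at
  \<open>x + h\<close> needs a single competitor outside the domain, so it is available at every
  distance from the boundary. A lower bound has to beat all exterior points and is available only
  near the boundary: where \<open>bdist\<close> is smooth, the tangential eigenvalues of its Hessian
  are -\<kappa>/(1 - \<kappa> d), which are at most -\<kappa> and approach it as d tends to 0.
  Moving a point and its foot point by the same tangential step replaces these eigenvalues by
  -\<kappa>, which is enough because only the sign of the trace matters. A lower touching quadratic
  at one point says nothing about an integral. In the converse all constants therefore have to be
  uniform over a ball: the Hessian of the defining function is frozen at one boundary point, while
  its gradient is taken at the varying nearest point. Signs: defining functions are positive inside,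
  so the tangential trace of the Hessian, divided by the length of the gradient, is -(n - 1)
  H.\<close>

definition hess :: "('a::euclidean_space \<Rightarrow> real) \<Rightarrow> 'a \<Rightarrow> 'a \<Rightarrow> 'a" where
  "hess f x v = (\<Sum>b\<in>Basis. frechet_derivative (partial_deriv b f) (at x) v *\<^sub>R b)"

lemma has_derivative_gradient:
  assumes "f differentiable (at x)"
  shows "(f has_derivative (\<lambda>h. gradient f x \<bullet> h)) (at x)"
proof -
  let ?D = "frechet_derivative f (at x)"
  have D: "(f has_derivative ?D) (at x)"
    using assms frechet_derivative_works by blast
  then have lin: "linear ?D" by (rule has_derivative_linear)
  have "?D h = gradient f x \<bullet> h" for h
  proof -
    have "?D h = ?D (\<Sum>b\<in>Basis. (h \<bullet> b) *\<^sub>R b)"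
      by (simp add: euclidean_representation)
    also have "\<dots> = (\<Sum>b\<in>Basis. (h \<bullet> b) * ?D b)"
      using lin by (simp add: linear_sum linear_scale)
    also have "\<dots> = gradient f x \<bullet> h"
      by (simp add: gradient_def partial_deriv_def inner_sum_left inner_commute[of h] mult.commute)
    finally show ?thesis .
  qed
  then have "?D = (\<lambda>h. gradient f x \<bullet> h)" by blast
  with D show ?thesis by simp
qed

lemma Ck_on_2D:
  assumes "Ck_on 2 S f"
  shows "x \<in> S \<Longrightarrow> f differentiable (at x)"
    and "x \<in> S \<Longrightarrow> b \<in> Basis \<Longrightarrow> partial_deriv b f differentiable (at x)"
    and "b \<in> Basis \<Longrightarrow> c \<in> Basis \<Longrightarrow> continuous_on S (partial_deriv c (partial_deriv b f))"
  using assms by (simp_all add: numeral_2_eq_2)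

lemma gradient_has_derivative_hess:
  assumes "\<And>b. b \<in> Basis \<Longrightarrow> partial_deriv b f differentiable (at x)"
  shows "(gradient f has_derivative hess f x) (at x)"
proof -
  have "((\<lambda>x. \<Sum>b\<in>Basis. partial_deriv b f x *\<^sub>R b) has_derivative
      (\<lambda>v. \<Sum>b\<in>Basis. frechet_derivative (partial_deriv b f) (at x) v *\<^sub>R b)) (at x)"
    by (intro has_derivative_sum has_derivative_scaleR_left) (use assms frechet_derivative_works in blast)
  then show ?thesis
    by (simp add: hess_def[abs_def] gradient_def[abs_def])
qed

lemma inner_hess:
  assumes "\<And>b. b \<in> Basis \<Longrightarrow> partial_deriv b f differentiable (at x)"
  shows "hess f x u \<bullet> v =
    (\<Sum>b\<in>Basis. \<Sum>c\<in>Basis. partial_deriv c (partial_deriv b f) x * ((u \<bullet> c) * (v \<bullet> b)))"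
proof -
  have "frechet_derivative (partial_deriv b f) (at x) u
      = (\<Sum>c\<in>Basis. partial_deriv c (partial_deriv b f) x * (u \<bullet> c))" if "b \<in> Basis" for b
  proof -
    have "frechet_derivative (partial_deriv b f) (at x) = (\<lambda>h. gradient (partial_deriv b f) x \<bullet> h)"
      using has_derivative_gradient[OF assms[OF that]] frechet_derivative_at by metis
    then show ?thesis
      by (simp add: gradient_def inner_sum_left inner_commute[of u])
  qed
  then show ?thesis
    by (simp add: hess_def inner_sum_right inner_commute[of _ v] sum_distrib_right sum_distrib_left mult_ac)
qed

lemma hess_Basis:
  assumes "\<And>b. b \<in> Basis \<Longrightarrow> partial_deriv b f differentiable (at x)" "i \<in> Basis"
  shows "hess f x i \<bullet> i = partial_deriv i (partial_deriv i f) x"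
proof -
  have "hess f x i \<bullet> i = frechet_derivative (partial_deriv i f) (at x) i"
    using assms(2) by (simp add: hess_def inner_sum_left inner_Basis if_distrib cong: if_cong)
  then show ?thesis by (simp add: partial_deriv_def)
qed

lemma taylor2:
  fixes f :: "'a::euclidean_space \<Rightarrow> real"
  assumes f: "Ck_on 2 S f" and seg: "closed_segment x (x + h) \<subseteq> S"
  obtains \<theta> where "0 < \<theta>" "\<theta> < 1"
    "f (x + h) = f x + gradient f x \<bullet> h + (hess f (x + \<theta> *\<^sub>R h) h \<bullet> h) / 2"
proof -
  \<comment> \<open>For \<open>m\<close> = 0, 1, 2 these are the successive derivatives of
    \<open>f\<close> along the segment, in the form in which the one-variable Taylor theorem with
    Lagrange remainder takes them.\<close>
  define D where "D m s = (if m = 0 then f (x + s *\<^sub>R h) else if m = 1 then gradient f (x + s *\<^sub>R h) \<bullet> h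
       else hess f (x + s *\<^sub>R h) h \<bullet> h)" for m :: nat and s
  have inS: "x + s *\<^sub>R h \<in> S" if "0 \<le> s" "s \<le> 1" for s
    using seg that by (auto simp: closed_segment_def algebra_simps)
  have der: "DERIV (D m) s :> D (Suc m) s" if "m < 2" "0 \<le> s" "s \<le> 1" for m s
  proof (cases "m = 0")
    case True
    have "((\<lambda>s. f (x + s *\<^sub>R h)) has_derivative (\<lambda>r. gradient f (x + s *\<^sub>R h) \<bullet> (r *\<^sub>R h))) (at s)"
      by (rule has_derivative_compose[where f="\<lambda>s. x + s *\<^sub>R h", OF _ has_derivative_gradient])
        (auto intro!: derivative_eq_intros Ck_on_2D(1)[OF f] inS that)
    then show ?thesis
      unfolding has_field_derivative_def using True
      by (auto simp: D_def[abs_def] elim!: has_derivative_eq_rhs)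
  next
    case False
    with that have m: "m = 1" by simp
    have "((\<lambda>s. gradient f (x + s *\<^sub>R h)) has_derivative (\<lambda>r. hess f (x + s *\<^sub>R h) (r *\<^sub>R h))) (at s)"
      by (rule has_derivative_compose[where f="\<lambda>s. x + s *\<^sub>R h", OF _ gradient_has_derivative_hess])
        (auto intro!: derivative_eq_intros Ck_on_2D(2)[OF f] inS that)
    then have "((\<lambda>s. gradient f (x + s *\<^sub>R h) \<bullet> h) has_derivative (\<lambda>r. hess f (x + s *\<^sub>R h) (r *\<^sub>R h) \<bullet> h)) (at s)"
      by (intro has_derivative_inner_left)
    moreover have "hess f (x + s *\<^sub>R h) (r *\<^sub>R h) = r *\<^sub>R hess f (x + s *\<^sub>R h) h" for r
    proof -
      have "linear (hess f (x + s *\<^sub>R h))"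
        by (rule has_derivative_linear[OF gradient_has_derivative_hess])
          (auto intro!: Ck_on_2D(2)[OF f] inS that)
      then show ?thesis by (rule linear_scale)
    qed
    ultimately show ?thesis
      unfolding has_field_derivative_def using m
      by (auto simp: D_def[abs_def] elim!: has_derivative_eq_rhs)
  qed
  have "\<exists>t>0. t < 1 \<and> D 0 1 = (\<Sum>m<2. D m 0 / fact m * (1 - 0) ^ m) + D 2 t / fact 2 * (1 - 0) ^ 2"
    using Taylor_up[of 2 D "D 0" 0 1 0] der by simp
  then obtain \<theta> where "0 < \<theta>" "\<theta> < 1"
    "D 0 1 = (\<Sum>m<2. D m 0 / fact m * (1 - 0) ^ m) + D 2 \<theta> / fact 2 * (1 - 0) ^ 2"
    by blast
  then show ?thesis
    by (intro that[of \<theta>]) (simp_all add: D_def numeral_2_eq_2)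
qed

text \<open>The quadratic form is a sum of n^2 second partials times products of coordinates of
  \<open>h\<close>, each product at most \<open>(norm h)\<^sup>2\<close>. Keeping every partial
  within \<open>e / n\<^sup>2\<close> of its value at \<open>y\<close> is thus enough.\<close>

lemma hess_tendsto_uniform:
  fixes f :: "'a::euclidean_space \<Rightarrow> real"
  assumes f: "Ck_on 2 S f" and S: "open S" "y \<in> S" and e: "e > 0"
  obtains d where "d > 0" "ball y d \<subseteq> S"
    "\<And>p h. p \<in> ball y d \<Longrightarrow> \<bar>hess f p h \<bullet> h - hess f y h \<bullet> h\<bar> \<le> e * (norm h)\<^sup>2"
proof -
  define n where "n = real DIM('a)"
  define e' where "e' = e / n\<^sup>2"
  have n: "n > 0" by (simp add: n_def)
  then have e': "e' > 0" using e by (simp add: e'_def)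
  have "\<forall>\<^sub>F p in at y. \<forall>b\<in>Basis. \<forall>c\<in>Basis.
      dist (partial_deriv c (partial_deriv b f) p) (partial_deriv c (partial_deriv b f) y) < e'"
    using Ck_on_2D(3)[OF f] S e'
    by (intro eventually_ball_finite ballI finite_Basis tendstoD)
      (auto simp: continuous_on_eq_continuous_at isCont_def)
  then obtain d1 where d1: "d1 > 0" "\<And>p b c. p \<noteq> y \<Longrightarrow> dist p y < d1 \<Longrightarrow> b \<in> Basis \<Longrightarrow> c \<in> Basis \<Longrightarrow>
      dist (partial_deriv c (partial_deriv b f) p) (partial_deriv c (partial_deriv b f) y) < e'"
    unfolding eventually_at by blast
  obtain d2 where d2: "d2 > 0" "ball y d2 \<subseteq> S" using S open_contains_ball by blast
  have "\<bar>hess f p h \<bullet> h - hess f y h \<bullet> h\<bar> \<le> e * (norm h)\<^sup>2" if p: "p \<in> ball y (min d1 d2)" for p h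
  proof -
    have pS: "p \<in> S" using p d2 by auto
    have le: "\<bar>partial_deriv c (partial_deriv b f) p - partial_deriv c (partial_deriv b f) y\<bar> \<le> e'"
      if "b \<in> Basis" "c \<in> Basis" for b c
      using d1(2)[of p b c] p that e' by (cases "p = y") (auto simp: dist_real_def dist_commute)
    have "hess f p h \<bullet> h - hess f y h \<bullet> h = (\<Sum>b\<in>Basis. \<Sum>c\<in>Basis.
       (partial_deriv c (partial_deriv b f) p - partial_deriv c (partial_deriv b f) y) * ((h \<bullet> c) * (h \<bullet> b)))"
      using inner_hess[OF Ck_on_2D(2)[OF f pS]] inner_hess[OF Ck_on_2D(2)[OF f S(2)]]
      by (simp add: sum_subtractf[symmetric] left_diff_distrib)
    also have "\<bar>\<dots>\<bar> \<le> (\<Sum>b\<in>(Basis::'a set). \<Sum>c\<in>(Basis::'a set). e' * (norm h)\<^sup>2)"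
    proof (rule order_trans[OF sum_abs], rule sum_mono, rule order_trans[OF sum_abs], rule sum_mono)
      fix b c :: 'a assume bc: "b \<in> Basis" "c \<in> Basis"
      have "\<bar>h \<bullet> c\<bar> * \<bar>h \<bullet> b\<bar> \<le> norm h * norm h"
        by (intro mult_mono Basis_le_norm bc) auto
      then show "\<bar>(partial_deriv c (partial_deriv b f) p - partial_deriv c (partial_deriv b f) y) * ((h \<bullet> c) * (h \<bullet> b))\<bar>
           \<le> e' * (norm h)\<^sup>2"
        unfolding abs_mult[of _ "(h \<bullet> c) * _"] abs_mult[of "h \<bullet> c"] power2_eq_square using le[OF bc] e'
        by (intro mult_mono[of _ e']) auto
    qed
    also have "\<dots> = e * (norm h)\<^sup>2" using n by (simp add: e'_def n_def power2_eq_square)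
    finally show ?thesis .
  qed
  then show ?thesis
    using d1(1) d2 by (intro that[of "min d1 d2"]) auto
qed

text \<open>The gradient sits at the moving base point \<open>x\<close> but the Hessian stays at
  \<open>y\<close>. This lets one quadratic form serve all boundary points near \<open>y\<close>
  with a common error constant.\<close>

lemma taylor2_uniform:
  fixes f :: "'a::euclidean_space \<Rightarrow> real"
  assumes f: "Ck_on 2 S f" and S: "open S" "y \<in> S" and e: "e > 0"
  obtains d where "d > 0" "ball y d \<subseteq> S"
    "\<And>x h. x \<in> ball y d \<Longrightarrow> x + h \<in> ball y d \<Longrightarrow>
       \<bar>f (x + h) - f x - gradient f x \<bullet> h - (hess f y h \<bullet> h) / 2\<bar> \<le> e * (norm h)\<^sup>2"
proof -
  obtain d where d: "d > 0" "ball y d \<subseteq> S"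
    "\<And>p h. p \<in> ball y d \<Longrightarrow> \<bar>hess f p h \<bullet> h - hess f y h \<bullet> h\<bar> \<le> e * (norm h)\<^sup>2"
    using hess_tendsto_uniform[OF f S e] by blast
  have "\<bar>f (x + h) - f x - gradient f x \<bullet> h - (hess f y h \<bullet> h) / 2\<bar> \<le> e * (norm h)\<^sup>2"
    if x: "x \<in> ball y d" "x + h \<in> ball y d" for x h
  proof -
    have seg: "closed_segment x (x + h) \<subseteq> ball y d"
      using x by (intro closed_segment_subset) auto
    then obtain \<theta> where \<theta>: "0 < \<theta>" "\<theta> < 1"
      "f (x + h) = f x + gradient f x \<bullet> h + (hess f (x + \<theta> *\<^sub>R h) h \<bullet> h) / 2"
      using taylor2[OF f, of x h] d(2) by blast
    have "x + \<theta> *\<^sub>R h \<in> closed_segment x (x + h)"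
      unfolding closed_segment_def using \<theta> by (auto intro!: exI[of _ \<theta>] simp: algebra_simps)
    then have "x + \<theta> *\<^sub>R h \<in> ball y d" using seg by blast
    from d(3)[OF this, of h] show ?thesis
      using \<theta>(3) e mult_nonneg_nonneg[of e "(norm h)\<^sup>2"] by (simp add: abs_if field_simps split: if_splits)
  qed
  then show ?thesis using that d by blast
qed

lemma hess_linear:
  assumes "Ck_on 2 S f" "y \<in> S"
  shows "bounded_linear (hess f y)"
  using has_derivative_bounded_linear[OF gradient_has_derivative_hess[OF Ck_on_2D(2)[OF assms]]] .

text \<open>Compare the expansions at \<open>y\<close> in direction \<open>r (u + v)\<close>, at \<open>y\<close> in direction \<open>r u\<close> and at
  \<open>y + r u\<close> in direction \<open>r v\<close>.\<close>
lemma hess_symmetric: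
  fixes f :: "'a::euclidean_space \<Rightarrow> real"
  assumes f: "Ck_on 2 S f" and S: "open S" "y \<in> S"
  shows "hess f y u \<bullet> v = hess f y v \<bullet> u"
proof -
  let ?A = "hess f y"
  interpret bounded_linear ?A by (rule hess_linear[OF f S(2)])
  \<comment> \<open>Collects the four errors: three second-order Taylor remainders, and the
    first-order error of the gradient in direction \<open>u\<close> paired with
    \<open>v\<close>.\<close>
  define K where "K = (norm v)\<^sup>2 + (norm (u + v))\<^sup>2 + (norm u)\<^sup>2 + norm u * norm v"
  have K: "K \<ge> 0" by (simp add: K_def)
  have bound: "\<bar>?A u \<bullet> v - ?A v \<bullet> u\<bar> \<le> 2 * (e * K)" if e: "e > 0" for e
  proof -
    obtain d where d: "d > 0" "ball y d \<subseteq> S"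
      and T: "\<And>x h. x \<in> ball y d \<Longrightarrow> x + h \<in> ball y d \<Longrightarrow>
       \<bar>f (x + h) - f x - gradient f x \<bullet> h - (?A h \<bullet> h) / 2\<bar> \<le> e * (norm h)\<^sup>2"
      using taylor2_uniform[OF f S e] by blast
    have "(gradient f has_derivative ?A) (at y)"
      by (rule gradient_has_derivative_hess[OF Ck_on_2D(2)[OF f S(2)]])
    then obtain d' where d': "d' > 0"
      and G: "\<And>z. norm (z - y) < d' \<Longrightarrow> norm (gradient f z - gradient f y - ?A (z - y)) \<le> e * norm (z - y)"
      unfolding has_derivative_at_alt using e by blast
    \<comment> \<open>Scaled so that all steps of length at most
      \<open>r * norm u + r * norm v\<close> stay in both neighbourhoods; the summand 1 keeps the
      denominator positive when \<open>u\<close> and \<open>v\<close> vanish.\<close>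
    define r where "r = min d d' / (1 + norm u + norm v)"
    have pos: "1 + norm u + norm v > 0" by (smt (verit) norm_ge_zero)
    have r: "r > 0" using d d' pos by (simp add: r_def)
    have "r * norm u + r * norm v < min d d'"
    proof -
      have "r * (1 + norm u + norm v) = min d d'" using pos by (simp add: r_def)
      moreover have "r * (1 + norm u + norm v) = r + (r * norm u + r * norm v)"
        by (simp add: algebra_simps)
      ultimately show ?thesis using r by linarith
    qed
    then have rr: "r * norm u + r * norm v < d" "r * norm u + r * norm v < d'" by simp_all
    have nn: "r * norm u \<ge> 0" "r * norm v \<ge> 0" using r by auto
    have nuv: "norm (r *\<^sub>R u + r *\<^sub>R v) < d"
      using rr(1) norm_triangle_ineq[of "r *\<^sub>R u" "r *\<^sub>R v"] r by simp
    have mem: "y + w \<in> ball y d \<longleftrightarrow> norm w < d" for w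
      by (simp add: dist_norm)
    have in1: "y \<in> ball y d" "y + r *\<^sub>R u \<in> ball y d" "y + (r *\<^sub>R u + r *\<^sub>R v) \<in> ball y d"
    proof -
      have "r * norm u < d" using rr(1) nn by linarith
      then have "norm (r *\<^sub>R u) < d" using r by simp
      then show "y + r *\<^sub>R u \<in> ball y d" unfolding mem .
    qed (use d(1) nuv mem in auto)
    have in2: "y + r *\<^sub>R u + r *\<^sub>R v \<in> ball y d"
      using in1(3) by (simp add: add.assoc)
    note T1 = T[OF in1(2) in2]
    note T2 = T[OF in1(1) in1(3)]
    note T3 = T[OF in1(1) in1(2)]
    have "norm (gradient f (y + r *\<^sub>R u) - gradient f y - ?A (r *\<^sub>R u)) \<le> e * (r * norm u)"
      using G[of "y + r *\<^sub>R u"] rr nn r by auto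
    then have "\<bar>(gradient f (y + r *\<^sub>R u) - gradient f y - ?A (r *\<^sub>R u)) \<bullet> (r *\<^sub>R v)\<bar> \<le> e * (r * norm u) * norm (r *\<^sub>R v)"
      by (intro order_trans[OF Cauchy_Schwarz_ineq2] mult_right_mono) auto
    then have T4: "\<bar>(gradient f (y + r *\<^sub>R u) - gradient f y) \<bullet> (r *\<^sub>R v) - r\<^sup>2 * (?A u \<bullet> v)\<bar> \<le> r\<^sup>2 * (e * (norm u * norm v))"
    proof -
      have "(gradient f (y + r *\<^sub>R u) - gradient f y - ?A (r *\<^sub>R u)) \<bullet> (r *\<^sub>R v)
          = (gradient f (y + r *\<^sub>R u) - gradient f y) \<bullet> (r *\<^sub>R v) - r\<^sup>2 * (?A u \<bullet> v)"
        by (simp add: scaleR inner_diff_left power2_eq_square right_diff_distrib)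
      moreover have "e * (r * norm u) * norm (r *\<^sub>R v) = r\<^sup>2 * (e * (norm u * norm v))"
        using r by (simp add: power2_eq_square)
      ultimately show ?thesis
        using \<open>\<bar>(gradient f (y + r *\<^sub>R u) - gradient f y - ?A (r *\<^sub>R u)) \<bullet> (r *\<^sub>R v)\<bar> \<le> _\<close> by metis
    qed
    have quad: "?A (r *\<^sub>R w) \<bullet> (r *\<^sub>R w) = r\<^sup>2 * (?A w \<bullet> w)" "(norm (r *\<^sub>R w))\<^sup>2 = r\<^sup>2 * (norm w)\<^sup>2" for w
      by (simp_all add: scaleR power2_eq_square)
    have uv: "r *\<^sub>R u + r *\<^sub>R v = r *\<^sub>R (u + v)" by (simp add: scaleR_right_distrib)
    have T2': "\<bar>f (y + (r *\<^sub>R u + r *\<^sub>R v)) - f y - gradient f y \<bullet> (r *\<^sub>R u + r *\<^sub>R v) - r\<^sup>2 * (?A (u+v) \<bullet> (u+v)) / 2\<bar>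
       \<le> e * (r\<^sup>2 * (norm (u+v))\<^sup>2)"
      using T2 unfolding uv quad .
    have T1': "\<bar>f (y + (r *\<^sub>R u + r *\<^sub>R v)) - f (y + r *\<^sub>R u) - gradient f (y + r *\<^sub>R u) \<bullet> (r *\<^sub>R v) - r\<^sup>2 * (?A v \<bullet> v) / 2\<bar>
       \<le> e * (r\<^sup>2 * (norm v)\<^sup>2)"
      using T1 unfolding quad add.assoc .
    have T3': "\<bar>f (y + r *\<^sub>R u) - f y - gradient f y \<bullet> (r *\<^sub>R u) - r\<^sup>2 * (?A u \<bullet> u) / 2\<bar>
       \<le> e * (r\<^sup>2 * (norm u)\<^sup>2)"
      using T3 unfolding quad .
    have exp: "r\<^sup>2 * (?A (u+v) \<bullet> (u+v)) = r\<^sup>2 * (?A u \<bullet> u) + r\<^sup>2 * (?A u \<bullet> v) + r\<^sup>2 * (?A v \<bullet> u) + r\<^sup>2 * (?A v \<bullet> v)"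
      by (simp add: add inner_add_left inner_add_right distrib_left)
    \<comment> \<open>The second expansion minus the first and the third leaves
      \<open>g1 - g3 - (a + b) / 2\<close>. The gradient estimate replaces \<open>g1 - g3\<close> by
      \<open>a\<close>, so \<open>(a - b) / 2\<close> remains.\<close>
    have combine: "\<bar>a - b\<bar> / 2 \<le> e1 + e2 + e3 + e4"
      if "\<bar>f2 - f1 - g1 - c / 2\<bar> \<le> e1" "\<bar>f2 - f0 - (g2 + g3) - (d + a + b + c) / 2\<bar> \<le> e2"
        "\<bar>f1 - f0 - g2 - d / 2\<bar> \<le> e3" "\<bar>g1 - g3 - a\<bar> \<le> e4"
      for a b c d e1 e2 e3 e4 f0 f1 f2 g1 g2 g3 :: real
      using that by (simp add: abs_le_iff field_simps)
    have "\<bar>r\<^sup>2 * (?A u \<bullet> v) - r\<^sup>2 * (?A v \<bullet> u)\<bar> / 2 \<le>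
      e * (r\<^sup>2 * (norm v)\<^sup>2) + e * (r\<^sup>2 * (norm (u+v))\<^sup>2) + e * (r\<^sup>2 * (norm u)\<^sup>2) + r\<^sup>2 * (e * (norm u * norm v))"
      by (rule combine[OF T1' T2'[unfolded exp inner_add_right[of "gradient f y"]] T3' T4[unfolded inner_diff_left]])
    also have "\<dots> = r\<^sup>2 * (e * K)" by (simp add: K_def algebra_simps)
    finally have "r\<^sup>2 * (\<bar>?A u \<bullet> v - ?A v \<bullet> u\<bar> / 2) \<le> r\<^sup>2 * (e * K)"
      unfolding right_diff_distrib[symmetric] by (simp add: abs_mult)
    then show ?thesis using r by simp
  qed
  have "\<bar>?A u \<bullet> v - ?A v \<bullet> u\<bar> \<le> 0 + e" if "e > 0" for e
  proof -
    have "2 * (e / (2 * (K + 1)) * K) \<le> e" using that K by (simp add: field_simps)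
    then show ?thesis using bound[of "e / (2 * (K + 1))"] that K by simp
  qed
  then have "\<bar>?A u \<bullet> v - ?A v \<bullet> u\<bar> \<le> 0" by (rule field_le_epsilon)
  then show ?thesis by simp
qed

section \<open>Second differences and the Laplacian\<close>

definition second_diff :: "('a::euclidean_space \<Rightarrow> real) \<Rightarrow> real \<Rightarrow> 'a \<Rightarrow> real" where
  "second_diff u r x = (\<Sum>b\<in>Basis. u (x + r *\<^sub>R b) + u (x - r *\<^sub>R b) - 2 * u x)"

lemma Ck_on_2_continuous:
  assumes "Ck_on 2 S f"
  shows "continuous_on S f"
  using Ck_on_2D(1)[OF assms]
  by (meson continuous_at_imp_continuous_on differentiable_imp_continuous_within)

text \<open>The first-order terms of the expansions at both sides cancel and two Lagrange remainders
  survive, hence two intermediate points instead of one. Their distance to \<open>x\<close> is all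
  that the limit requires.\<close>

lemma directional_second_diff:
  fixes \<phi> :: "'a::euclidean_space \<Rightarrow> real"
  assumes \<phi>: "Ck_on 2 UNIV \<phi>" and b: "b \<in> Basis" and r: "r \<ge> 0"
  obtains p q where "dist p x \<le> r" "dist q x \<le> r"
    "\<phi> (x + r *\<^sub>R b) + \<phi> (x - r *\<^sub>R b) - 2 * \<phi> x =
      r\<^sup>2 * ((partial_deriv b (partial_deriv b \<phi>) p + partial_deriv b (partial_deriv b \<phi>) q) / 2)"
proof -
  have quad: "hess \<phi> p (s *\<^sub>R b) \<bullet> (s *\<^sub>R b) = s\<^sup>2 * partial_deriv b (partial_deriv b \<phi>) p" for p s
  proof -
    interpret bounded_linear "hess \<phi> p" by (rule hess_linear[OF \<phi>]) simp
    show ?thesis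
      using hess_Basis[OF Ck_on_2D(2)[OF \<phi>] b, of p] by (simp add: scaleR power2_eq_square)
  qed
  obtain \<theta> where \<theta>: "0 < \<theta>" "\<theta> < 1" "\<phi> (x + r *\<^sub>R b) = \<phi> x + gradient \<phi> x \<bullet> (r *\<^sub>R b)
      + (hess \<phi> (x + \<theta> *\<^sub>R (r *\<^sub>R b)) (r *\<^sub>R b) \<bullet> (r *\<^sub>R b)) / 2"
    using taylor2[OF \<phi>, of x "r *\<^sub>R b"] by blast
  obtain \<theta>' where \<theta>': "0 < \<theta>'" "\<theta>' < 1" "\<phi> (x + (-r) *\<^sub>R b) = \<phi> x + gradient \<phi> x \<bullet> ((-r) *\<^sub>R b)
      + (hess \<phi> (x + \<theta>' *\<^sub>R ((-r) *\<^sub>R b)) ((-r) *\<^sub>R b) \<bullet> ((-r) *\<^sub>R b)) / 2"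
    using taylor2[OF \<phi>, of x "(-r) *\<^sub>R b"] by blast
  have le: "t * r \<le> r" if "0 < t" "t < 1" for t
    using that r by (simp add: mult_left_le_one_le)
  show ?thesis
  proof
    show "dist (x + \<theta> *\<^sub>R (r *\<^sub>R b)) x \<le> r" "dist (x + \<theta>' *\<^sub>R ((-r) *\<^sub>R b)) x \<le> r"
      using le[OF \<theta>(1,2)] le[OF \<theta>'(1,2)] b r \<theta> \<theta>' by (simp_all add: dist_norm)
    show "\<phi> (x + r *\<^sub>R b) + \<phi> (x - r *\<^sub>R b) - 2 * \<phi> x =
      r\<^sup>2 * ((partial_deriv b (partial_deriv b \<phi>) (x + \<theta> *\<^sub>R (r *\<^sub>R b))
        + partial_deriv b (partial_deriv b \<phi>) (x + \<theta>' *\<^sub>R ((-r) *\<^sub>R b))) / 2)"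
      using \<theta>(3) \<theta>'(3) unfolding quad by (simp add: field_simps)
  qed
qed

lemma second_diff_tendsto_laplacian:
  fixes \<phi> :: "'a::euclidean_space \<Rightarrow> real"
  assumes \<phi>: "Ck_on 2 UNIV \<phi>" and r: "r \<longlonglongrightarrow> 0" "\<And>n. r n > 0"
  shows "(\<lambda>n. second_diff \<phi> (r n) x / (r n)\<^sup>2) \<longlonglongrightarrow> laplacian \<phi> x"
proof -
  have "(\<lambda>n. (\<phi> (x + r n *\<^sub>R b) + \<phi> (x - r n *\<^sub>R b) - 2 * \<phi> x) / (r n)\<^sup>2)
      \<longlonglongrightarrow> partial_deriv b (partial_deriv b \<phi>) x" if b: "b \<in> Basis" for b
  proof (rule LIMSEQ_I)
    let ?P = "partial_deriv b (partial_deriv b \<phi>)"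
    fix e :: real assume e: "e > 0"
    have "continuous_on UNIV ?P"
      using Ck_on_2D(3)[OF \<phi> b b] .
    then obtain d where d: "d > 0" "\<And>p. dist p x < d \<Longrightarrow> dist (?P p) (?P x) < e"
      unfolding continuous_on_iff using e by (metis UNIV_I)
    obtain N where N: "\<And>n. n \<ge> N \<Longrightarrow> r n < d"
      using LIMSEQ_D[OF r(1) d(1)] r(2) by (metis abs_of_pos diff_zero real_norm_def)
    have "norm ((\<phi> (x + r n *\<^sub>R b) + \<phi> (x - r n *\<^sub>R b) - 2 * \<phi> x) / (r n)\<^sup>2 - ?P x) < e" if "n \<ge> N" for n
    proof -
      obtain p q where pq: "dist p x \<le> r n" "dist q x \<le> r n"
        "\<phi> (x + r n *\<^sub>R b) + \<phi> (x - r n *\<^sub>R b) - 2 * \<phi> x = (r n)\<^sup>2 * ((?P p + ?P q) / 2)"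
        using directional_second_diff[OF \<phi> b, of "r n" x] r(2)[of n] by (metis less_imp_le)
      have "dist (?P p) (?P x) < e" "dist (?P q) (?P x) < e"
        using pq(1,2) N[OF that] by (auto intro!: d(2))
      then have "\<bar>(?P p + ?P q) / 2 - ?P x\<bar> < e"
        unfolding dist_real_def by (simp add: abs_less_iff field_simps)
      then show ?thesis
        unfolding pq(3) using r(2)[of n] by simp
    qed
    then show "\<exists>N. \<forall>n\<ge>N. norm ((\<phi> (x + r n *\<^sub>R b) + \<phi> (x - r n *\<^sub>R b) - 2 * \<phi> x) / (r n)\<^sup>2 - ?P x) < e"
      by blast
  qed
  then show ?thesis
    unfolding second_diff_def laplacian_def sum_divide_distrib by (intro tendsto_sum)
qed

lemma partial_deriv_zero:
  assumes "open S" "\<And>x. x \<in> S \<Longrightarrow> f x = 0" "x \<in> S"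
  shows "partial_deriv b f x = 0"
proof -
  have "(f has_derivative (\<lambda>_. 0)) (at x)"
    by (rule has_derivative_transform_within_open[where f="\<lambda>_. 0"]) (use assms in auto)
  then show ?thesis
    unfolding partial_deriv_def using frechet_derivative_at by metis
qed

text \<open>Provides the constant for dominated convergence, independent of the step: the second
  partials are continuous and vanish off a ball, so they are bounded on the whole space.\<close>

lemma second_diff_bound:
  fixes \<phi> :: "'a::euclidean_space \<Rightarrow> real"
  assumes \<phi>: "Ck_on 2 UNIV \<phi>" and R: "\<And>x. x \<notin> cball 0 R \<Longrightarrow> \<phi> x = 0"
  obtains M where "M \<ge> 0" "\<And>r x. r \<ge> 0 \<Longrightarrow> \<bar>second_diff \<phi> r x\<bar> \<le> M * r\<^sup>2"
proof -
  let ?P = "\<lambda>b. partial_deriv b (partial_deriv b \<phi>)"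
  have "\<exists>B. \<forall>x. \<bar>?P b x\<bar> \<le> B" if b: "b \<in> Basis" for b
  proof -
    have "compact (?P b ` cball 0 R)"
      using Ck_on_2D(3)[OF \<phi> b b] by (intro compact_continuous_image compact_cball) (rule continuous_on_subset, auto)
    then obtain B where B: "\<And>x. x \<in> cball 0 R \<Longrightarrow> \<bar>?P b x\<bar> \<le> B"
      by (metis compact_imp_bounded bounded_iff image_eqI real_norm_def)
    have "?P b x = 0" if "x \<notin> cball 0 R" for x
    proof (rule partial_deriv_zero)
      show "open (- cball (0::'a) R)" by (simp add: open_Compl)
      show "partial_deriv b \<phi> x = 0" if "x \<in> - cball 0 R" for x
        by (rule partial_deriv_zero[of "- cball 0 R"]) (use that R in \<open>auto simp: open_Compl\<close>)
    qed (use that in simp)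
    then have "\<bar>?P b x\<bar> \<le> max B 0" for x
      using B[of x] by (cases "x \<in> cball 0 R") auto
    then show ?thesis by blast
  qed
  then obtain B where B: "\<And>b x. b \<in> Basis \<Longrightarrow> \<bar>?P b x\<bar> \<le> B b"
    by metis
  have B0: "B b \<ge> 0" if "b \<in> Basis" for b using B[OF that, of 0] by linarith
  have "\<bar>second_diff \<phi> r x\<bar> \<le> (\<Sum>b\<in>Basis. B b) * r\<^sup>2" if "r \<ge> 0" for r x
    unfolding second_diff_def sum_distrib_right
  proof (rule order_trans[OF sum_abs], rule sum_mono)
    fix b :: 'a assume b: "b \<in> Basis"
    obtain p q where pq: "\<phi> (x + r *\<^sub>R b) + \<phi> (x - r *\<^sub>R b) - 2 * \<phi> x = r\<^sup>2 * ((?P b p + ?P b q) / 2)"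
      using directional_second_diff[OF \<phi> b \<open>r \<ge> 0\<close>, of x] by metis
    have "\<bar>(?P b p + ?P b q) / 2\<bar> \<le> B b"
      using B[OF b, of p] B[OF b, of q] by (simp add: abs_le_iff field_simps)
    then show "\<bar>\<phi> (x + r *\<^sub>R b) + \<phi> (x - r *\<^sub>R b) - 2 * \<phi> x\<bar> \<le> B b * r\<^sup>2"
      unfolding pq abs_mult mult.commute[of "B b"] by (intro mult_mono) auto
  qed
  moreover have "(\<Sum>b\<in>Basis. B b) \<ge> 0" using B0 by (simp add: sum_nonneg)
  ultimately show ?thesis using that by blast
qed

lemma integrable_bounded_support:
  fixes f :: "'a::euclidean_space \<Rightarrow> real"
  assumes "continuous_on UNIV f" "\<And>x. x \<notin> cball 0 R \<Longrightarrow> f x = 0"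
  shows "integrable lborel f"
proof -
  have "integrable lborel (\<lambda>x. indicator (cball 0 R) x *\<^sub>R f x)"
    by (rule borel_integrable_compact) (use assms(1) continuous_on_subset in auto)
  also have "(\<lambda>x. indicator (cball 0 R) x *\<^sub>R f x) = f"
    using assms(2) by (auto simp: indicator_def fun_eq_iff)
  finally show ?thesis .
qed

lemma lborel_integral_shift:
  fixes f :: "'a::euclidean_space \<Rightarrow> real"
  assumes "continuous_on UNIV f"
  shows "(\<integral>x. f (c + x) \<partial>lborel) = (\<integral>x. f x \<partial>lborel)"
proof -
  have "(\<integral>x. f x \<partial>lborel) = (\<integral>x. f x \<partial>distr lborel borel ((+) c))"
    by (simp add: lborel_distr_plus)
  also have "\<dots> = (\<integral>x. f (c + x) \<partial>lborel)"
    by (rule integral_distr) (use assms borel_measurable_continuous_onI in auto)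
  finally show ?thesis by simp
qed

lemma integral_second_diff_swap:
  fixes u \<phi> :: "'a::euclidean_space \<Rightarrow> real"
  assumes u: "continuous_on UNIV u" and \<phi>: "continuous_on UNIV \<phi>"
    and R: "\<And>x. x \<notin> cball 0 R \<Longrightarrow> \<phi> x = 0"
  shows "(\<integral>x. second_diff u r x * \<phi> x \<partial>lborel) = (\<integral>x. u x * second_diff \<phi> r x \<partial>lborel)"
proof -
  have cont [continuous_intros]: "continuous_on UNIV (\<lambda>x. u (g x))" "continuous_on UNIV (\<lambda>x. \<phi> (g x))"
    if "continuous_on UNIV g" for g :: "'a \<Rightarrow> 'a"
    using that u \<phi> by (auto intro: continuous_on_compose2)
  have shift: "(\<integral>x. u (x + a) * \<phi> x \<partial>lborel) = (\<integral>x. u x * \<phi> (x - a) \<partial>lborel)" for a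
    using lborel_integral_shift[of "\<lambda>x. u x * \<phi> (x - a)" a]
    by (simp add: continuous_intros add.commute)
  have i1: "integrable lborel (\<lambda>x. u (x + a) * \<phi> x)" for a
    by (rule integrable_bounded_support[where R=R]) (use R in \<open>auto intro!: continuous_intros\<close>)
  have i2: "integrable lborel (\<lambda>x. u x * \<phi> (x + a))" for a
  proof (rule integrable_bounded_support[where R="R + norm a"])
    fix x :: 'a assume "x \<notin> cball 0 (R + norm a)"
    then have "x + a \<notin> cball 0 R"
      using norm_triangle_ineq4[of "x + a" a] by auto
    then show "u x * \<phi> (x + a) = 0" using R by simp
  qed (auto intro!: continuous_intros)
  note i1m = i1[of "- a" for a, simplified] and i10 = i1[of 0, simplified]
  note i2m = i2[of "- a" for a, simplified] and i20 = i2[of 0, simplified]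
  have "(\<integral>x. second_diff u r x * \<phi> x \<partial>lborel)
    = (\<integral>x. (\<Sum>b\<in>Basis. u (x + r *\<^sub>R b) * \<phi> x + u (x - r *\<^sub>R b) * \<phi> x - 2 * (u x * \<phi> x)) \<partial>lborel)"
    unfolding second_diff_def sum_distrib_right by (simp add: algebra_simps)
  also have "\<dots> = (\<Sum>b\<in>Basis. (\<integral>x. u (x + r *\<^sub>R b) * \<phi> x \<partial>lborel)
      + (\<integral>x. u (x - r *\<^sub>R b) * \<phi> x \<partial>lborel) - 2 * (\<integral>x. u x * \<phi> x \<partial>lborel))"
    using i1 i1m i10 by (simp add: Bochner_Integration.integral_sum)
  also have "\<dots> = (\<Sum>b\<in>Basis. (\<integral>x. u x * \<phi> (x + r *\<^sub>R b) \<partial>lborel)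
      + (\<integral>x. u x * \<phi> (x - r *\<^sub>R b) \<partial>lborel) - 2 * (\<integral>x. u x * \<phi> x \<partial>lborel))"
    using shift[of "r *\<^sub>R b" for b] shift[of "- (r *\<^sub>R b)" for b] by (simp add: add.commute)
  also have "\<dots> = (\<integral>x. (\<Sum>b\<in>Basis. u x * \<phi> (x + r *\<^sub>R b) + u x * \<phi> (x - r *\<^sub>R b) - 2 * (u x * \<phi> x)) \<partial>lborel)"
    using i2 i2m i20 by (simp add: Bochner_Integration.integral_sum)
  also have "\<dots> = (\<integral>x. u x * second_diff \<phi> r x \<partial>lborel)"
    unfolding second_diff_def sum_distrib_left by (simp add: algebra_simps)
  finally show ?thesis .
qed

text \<open>All differentiation is shifted to \<phi>, so \<open>u\<close> only has to be continuous.
  Steps of size at most 1 keep the supports of the difference quotients in the ball of radius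
  \<open>R + 1\<close>, where \<open>u\<close> is bounded; this gives the integrable
  majorant.\<close>

lemma integral_second_diff_tendsto:
  fixes u \<phi> :: "'a::euclidean_space \<Rightarrow> real"
  assumes u: "continuous_on UNIV u" and \<phi>: "Ck_on 2 UNIV \<phi>"
    and R: "\<And>x. x \<notin> cball 0 R \<Longrightarrow> \<phi> x = 0"
    and r: "r \<longlonglongrightarrow> 0" "\<And>n. 0 < r n" "\<And>n. r n \<le> 1"
  shows "(\<lambda>n. \<integral>x. second_diff u (r n) x / (r n)\<^sup>2 * \<phi> x \<partial>lborel) \<longlonglongrightarrow> (\<integral>x. u x * laplacian \<phi> x \<partial>lborel)"
proof -
  obtain M where M: "M \<ge> 0" "\<And>r x. r \<ge> 0 \<Longrightarrow> \<bar>second_diff \<phi> r x\<bar> \<le> M * r\<^sup>2"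
    using second_diff_bound[OF \<phi> R] by blast
  note \<phi>c = Ck_on_2_continuous[OF \<phi>]
  have cont: "continuous_on UNIV (\<lambda>x. second_diff \<phi> (r n) x)" for n
    unfolding second_diff_def by (intro continuous_intros continuous_on_compose2[OF \<phi>c]) auto
  have zero: "second_diff \<phi> (r n) x = 0" if "x \<notin> cball 0 (R + 1)" for n x
  proof -
    have "x \<notin> cball 0 R" "\<And>b. b \<in> Basis \<Longrightarrow> x + r n *\<^sub>R b \<notin> cball 0 R" "\<And>b. b \<in> Basis \<Longrightarrow> x - r n *\<^sub>R b \<notin> cball 0 R"
    proof -
      fix b :: 'a assume b: "b \<in> Basis"
      have "norm (r n *\<^sub>R b) \<le> 1" using r(2,3)[of n] b by simp
      then show "x + r n *\<^sub>R b \<notin> cball 0 R" "x - r n *\<^sub>R b \<notin> cball 0 R"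
        using that norm_triangle_ineq4[of "x + r n *\<^sub>R b" "r n *\<^sub>R b"] norm_triangle_ineq[of "x - r n *\<^sub>R b" "r n *\<^sub>R b"] by auto
    qed (use that in auto)
    then show ?thesis
      unfolding second_diff_def using R by simp
  qed
  have "(\<lambda>n. \<integral>x. u x * (second_diff \<phi> (r n) x / (r n)\<^sup>2) \<partial>lborel) \<longlonglongrightarrow> (\<integral>x. u x * laplacian \<phi> x \<partial>lborel)"
  proof (rule integral_dominated_convergence)
    show "integrable lborel (\<lambda>x. indicator (cball 0 (R + 1)) x *\<^sub>R (\<bar>u x\<bar> * M))"
      by (rule borel_integrable_compact) (auto intro!: continuous_intros continuous_on_subset[OF u])
    have cn: "continuous_on UNIV (\<lambda>x. u x * (second_diff \<phi> (r n) x / (r n)\<^sup>2))" for n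
      using r(2)[of n] by (intro continuous_intros u cont) auto
    show ms: "(\<lambda>x. u x * (second_diff \<phi> (r n) x / (r n)\<^sup>2)) \<in> borel_measurable lborel" for n
      using borel_measurable_continuous_onI[OF cn[of n]] by simp
    have lim: "(\<lambda>n. u x * (second_diff \<phi> (r n) x / (r n)\<^sup>2)) \<longlonglongrightarrow> u x * laplacian \<phi> x" for x
      by (intro tendsto_intros second_diff_tendsto_laplacian \<phi> r)
    show "(\<lambda>x. u x * laplacian \<phi> x) \<in> borel_measurable lborel"
      by (rule borel_measurable_LIMSEQ_real[OF lim ms])
    show "AE x in lborel. (\<lambda>n. u x * (second_diff \<phi> (r n) x / (r n)\<^sup>2)) \<longlonglongrightarrow> u x * laplacian \<phi> x"
      using lim by simp
    show "AE x in lborel. norm (u x * (second_diff \<phi> (r n) x / (r n)\<^sup>2))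
        \<le> indicator (cball 0 (R + 1)) x *\<^sub>R (\<bar>u x\<bar> * M)" for n
    proof (rule AE_I2)
      fix x :: 'a
      have "\<bar>second_diff \<phi> (r n) x / (r n)\<^sup>2\<bar> \<le> M"
        using M(2)[of "r n" x] r(2)[of n] by (simp add: abs_divide divide_le_eq)
      then show "norm (u x * (second_diff \<phi> (r n) x / (r n)\<^sup>2)) \<le> indicator (cball 0 (R + 1)) x *\<^sub>R (\<bar>u x\<bar> * M)"
        using zero[of x n] mult_left_mono[of "\<bar>second_diff \<phi> (r n) x / (r n)\<^sup>2\<bar>" M "\<bar>u x\<bar>"]
        by (cases "x \<in> cball 0 (R + 1)") (simp_all add: abs_mult)
    qed
  qed
  moreover have "(\<integral>x. u x * (second_diff \<phi> (r n) x / (r n)\<^sup>2) \<partial>lborel) = (\<integral>x. second_diff u (r n) x / (r n)\<^sup>2 * \<phi> x \<partial>lborel)" for n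
    using integral_second_diff_swap[OF u \<phi>c R, where r="r n"] by simp
  ultimately show ?thesis by (simp only:)
qed

section \<open>Principal curvatures and the trace of the Hessian\<close>

text \<open>A maximiser of \<open>f x \<bullet> x\<close> on the unit sphere of \<open>S\<close> is an eigenvector.\<close>
lemma self_adjoint_has_eigenvector:
  fixes f :: "'a::euclidean_space \<Rightarrow> 'a"
  assumes S: "subspace S" "S \<noteq> {0}" and f: "linear f" and fS: "\<And>x. x \<in> S \<Longrightarrow> f x \<in> S"
    and adj: "\<And>x y. x \<in> S \<Longrightarrow> y \<in> S \<Longrightarrow> f x \<bullet> y = x \<bullet> f y"
  obtains v c where "v \<in> S" "norm v = 1" "f v = c *\<^sub>R v"
proof -
  interpret linear f by (rule f)
  have "compact (S \<inter> sphere 0 1)"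
    using S(1) by (simp add: closed_Int_compact closed_subspace)
  moreover have "S \<inter> sphere 0 1 \<noteq> {}"
  proof -
    obtain w where w: "w \<in> S" "w \<noteq> 0" using S subspace_0 by blast
    then have "w /\<^sub>R norm w \<in> S \<inter> sphere 0 1" using S(1) by (simp add: subspace_scale)
    then show ?thesis by blast
  qed
  moreover have "continuous_on (S \<inter> sphere 0 1) (\<lambda>x. f x \<bullet> x)"
    by (intro continuous_intros linear_continuous_on linear_conv_bounded_linear[THEN iffD1] f)
  ultimately obtain v where "v \<in> S \<inter> sphere 0 1" and "\<forall>w\<in>S \<inter> sphere 0 1. f w \<bullet> w \<le> f v \<bullet> v"
    using continuous_attains_sup[of "S \<inter> sphere 0 1" "\<lambda>x. f x \<bullet> x"] by blast
  then have v: "v \<in> S" "norm v = 1"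
    and max: "\<And>w. w \<in> S \<Longrightarrow> norm w = 1 \<Longrightarrow> f w \<bullet> w \<le> f v \<bullet> v"
    by simp_all
  define c where "c = f v \<bullet> v"
  have le: "f w \<bullet> w \<le> c * (w \<bullet> w)" if w: "w \<in> S" for w
  proof (cases "w = 0")
    case False
    have "f (w /\<^sub>R norm w) \<bullet> (w /\<^sub>R norm w) \<le> c"
      unfolding c_def using w False S(1) by (intro max) (auto simp: subspace_scale)
    then show ?thesis
      using False by (simp add: scale field_simps dot_square_norm power2_eq_square)
  qed (simp add: zero)
  define w where "w = f v - c *\<^sub>R v"
  have w: "w \<in> S" using v(1) fS S(1) by (simp add: w_def subspace_diff subspace_scale)
  have vv: "v \<bullet> v = 1" using v(2) by (simp add: dot_square_norm)
  \<comment> \<open>Maximality is tested along \<open>v + t w\<close>, where \<open>w\<close> is the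
    residual of the eigenvector equation. The term linear in \<open>t\<close> is
    \<open>2 (w \<bullet> w)\<close>, and letting \<open>t\<close> tend to 0 forces the residual to
    vanish.\<close>
  have key: "2 * (w \<bullet> w) \<le> t * (c * (w \<bullet> w) - f w \<bullet> w)" if t: "t > 0" for t
  proof -
    have ineq: "f (v + t *\<^sub>R w) \<bullet> (v + t *\<^sub>R w) \<le> c * ((v + t *\<^sub>R w) \<bullet> (v + t *\<^sub>R w))"
      by (rule le) (use v(1) w S(1) in \<open>simp add: subspace_add subspace_scale\<close>)
    have e1: "f (v + t *\<^sub>R w) \<bullet> (v + t *\<^sub>R w) = c + 2 * t * (f v \<bullet> w) + t * (t * (f w \<bullet> w))"
      using adj[OF w v(1)] by (simp add: add scale inner_add_left inner_add_right c_def inner_commute[of w "f v"] distrib_left)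
    have e2: "(v + t *\<^sub>R w) \<bullet> (v + t *\<^sub>R w) = 1 + 2 * t * (v \<bullet> w) + t * (t * (w \<bullet> w))"
      using vv by (simp add: inner_add_left inner_add_right inner_commute[of w v] distrib_left)
    have e3: "f v \<bullet> w = w \<bullet> w + c * (v \<bullet> w)"
    proof -
      have "f v = w + c *\<^sub>R v" by (simp add: w_def)
      then show ?thesis by (metis inner_add_left inner_scaleR_left)
    qed
    have "t * (2 * (w \<bullet> w)) \<le> t * (t * (c * (w \<bullet> w) - f w \<bullet> w))"
      using ineq unfolding e1 e2 e3 by (simp add: algebra_simps)
    then show ?thesis using t by simp
  qed
  have "w \<bullet> w \<le> 0 + e" if "e > 0" for e
  proof -
    define K where "K = c * (w \<bullet> w) - f w \<bullet> w"
    have "e / (\<bar>K\<bar> + 1) * K \<le> e / (\<bar>K\<bar> + 1) * (\<bar>K\<bar> + 1)"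
      using that by (intro mult_left_mono) auto
    also have "\<dots> = e" by simp
    finally have "e / (\<bar>K\<bar> + 1) * K \<le> e" .
    moreover have "2 * (w \<bullet> w) \<le> e / (\<bar>K\<bar> + 1) * K"
      unfolding K_def using that by (intro key) simp
    ultimately show ?thesis using inner_ge_zero[of w] by linarith
  qed
  then have "w \<bullet> w \<le> 0" by (rule field_le_epsilon)
  then have "w = 0" by (metis inner_ge_zero inner_eq_zero_iff order_antisym)
  then have "f v = c *\<^sub>R v" by (simp add: w_def)
  with v that show ?thesis by blast
qed

text \<open>An eigenvector is split off, and self-adjointness keeps its orthogonal complement in
  \<open>S\<close> invariant, of smaller dimension. Symmetry is asked for on \<open>S\<close> alone:
  the formula for the shape operator projects the Hessian after applying it, which in general is
  symmetric on the tangent space only.\<close>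

lemma self_adjoint_eigenbasis:
  fixes f :: "'a::euclidean_space \<Rightarrow> 'a"
  assumes "subspace S" and f: "linear f" and "\<And>x. x \<in> S \<Longrightarrow> f x \<in> S"
    and "\<And>x y. x \<in> S \<Longrightarrow> y \<in> S \<Longrightarrow> f x \<bullet> y = x \<bullet> f y"
  shows "\<exists>B. pairwise orthogonal B \<and> (\<forall>b\<in>B. norm b = 1 \<and> (\<exists>c. f b = c *\<^sub>R b)) \<and> span B = S"
  using assms(1,3,4)
proof (induction "dim S" arbitrary: S rule: less_induct)
  case less
  show ?case
  proof (cases "S = {0}")
    case True
    then show ?thesis by (intro exI[of _ "{}"]) simp
  next
    case False
    obtain v c where v: "v \<in> S" "norm v = 1" "f v = c *\<^sub>R v"
      using self_adjoint_has_eigenvector[OF less.prems(1) False f less.prems(2,3)] by blast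
    have vv: "v \<bullet> v = 1" using v(2) by (simp add: dot_square_norm)
    define T where "T = {y \<in> S. v \<bullet> y = 0}"
    have T: "subspace T"
      using less.prems(1) by (auto simp: T_def subspace_def inner_add_right)
    have "v \<notin> T" using vv by (simp add: T_def)
    moreover have "T \<subseteq> S" by (auto simp: T_def)
    ultimately have "T \<subset> S" using v(1) by blast
    then have "dim T < dim S"
      using T less.prems(1) by (intro dim_psubset) (simp add: span_eq_iff[THEN iffD2])
    moreover have "f x \<in> T" if "x \<in> T" for x
      using that less.prems(2)[of x] less.prems(3)[OF v(1), of x] v(3) by (auto simp: T_def)
    ultimately obtain B where B: "pairwise orthogonal B" "\<forall>b\<in>B. norm b = 1 \<and> (\<exists>c. f b = c *\<^sub>R b)" "span B = T"
      using less.hyps[of T] T less.prems(3) by (auto simp: T_def)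
    have "B \<subseteq> T" using B(3) span_superset by blast
    then have ort: "v \<bullet> b = 0" if "b \<in> B" for b using that by (auto simp: T_def)
    have "span (insert v B) = S"
    proof
      show "span (insert v B) \<subseteq> S"
        using v(1) \<open>B \<subseteq> T\<close> \<open>T \<subset> S\<close> less.prems(1) by (intro span_minimal) auto
      show "S \<subseteq> span (insert v B)"
      proof
        fix x assume "x \<in> S"
        then have "x - (v \<bullet> x) *\<^sub>R v \<in> T"
          using v(1) vv less.prems(1) by (simp add: T_def subspace_diff subspace_scale inner_diff_right)
        then show "x \<in> span (insert v B)"
          using B(3) span_breakdown_eq by blast
      qed
    qed
    moreover have "pairwise orthogonal (insert v B)"
      using B(1) ort by (auto simp: pairwise_insert orthogonal_def inner_commute)
    ultimately show ?thesis
      using B(2) v by (intro exI[of _ "insert v B"]) auto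
  qed
qed

text \<open>The eigenspace of \<kappa> is spanned by the members of \<open>B\<close> with eigenvalue
  \<kappa>, so its dimension counts them, and regrouping \<open>B\<close> by eigenvalue turns the
  weighted sum of dimensions into the trace.\<close>

lemma eigenspace_dim_sum:
  fixes f :: "'a::euclidean_space \<Rightarrow> 'a"
  assumes f: "linear f" and B: "pairwise orthogonal B" "\<And>b. b \<in> B \<Longrightarrow> norm b = 1"
    and eig: "\<And>b. b \<in> B \<Longrightarrow> \<exists>c. f b = c *\<^sub>R b"
  defines "E \<equiv> \<lambda>\<kappa>. {v \<in> span B. f v = \<kappa> *\<^sub>R v}"
  shows "finite {\<kappa>. E \<kappa> \<noteq> {0}}" and "(\<Sum>\<kappa> | E \<kappa> \<noteq> {0}. real (dim (E \<kappa>)) * \<kappa>) = (\<Sum>b\<in>B. f b \<bullet> b)"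
proof -
  interpret linear f by (rule f)
  have fin: "finite B" using pairwise_orthogonal_imp_finite[OF B(1)] .
  define l where "l b = f b \<bullet> b" for b
  have bb: "b \<bullet> b = 1" if "b \<in> B" for b using B(2)[OF that] by (simp add: dot_square_norm)
  have fb: "f b = l b *\<^sub>R b" if "b \<in> B" for b
    using eig[OF that] bb[OF that] by (auto simp: l_def)
  have B0: "0 \<notin> B" using B(2) by force
  have ind: "independent B" by (rule pairwise_orthogonal_independent[OF B(1) B0])
  have orth: "a \<bullet> b = (if a = b then 1 else 0)" if "a \<in> B" "b \<in> B" for a b
    using B(1) bb that by (auto simp: pairwise_def orthogonal_def)
  have exp: "x = (\<Sum>b\<in>B. (b \<bullet> x) *\<^sub>R b)" if "x \<in> span B" for x
    using orthonormal_basis_expand[OF B(1) B(2) that fin] by (simp add: inner_commute)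
  have E: "E \<kappa> = span {b \<in> B. l b = \<kappa>}" for \<kappa>
  proof
    have "subspace (E \<kappa>)"
      unfolding E_def by (auto simp: subspace_def span_add span_scale span_zero add scale zero scaleR_right_distrib)
    moreover have "{b \<in> B. l b = \<kappa>} \<subseteq> E \<kappa>"
      using fb span_base by (auto simp: E_def)
    ultimately show "span {b \<in> B. l b = \<kappa>} \<subseteq> E \<kappa>" by (rule span_minimal[rotated])
    show "E \<kappa> \<subseteq> span {b \<in> B. l b = \<kappa>}"
    proof
      fix v assume v: "v \<in> E \<kappa>"
      then have vB: "v \<in> span B" and fv: "f v = \<kappa> *\<^sub>R v" by (auto simp: E_def)
      \<comment> \<open>Pairing \<open>f v = \<kappa> v\<close> with \<open>b\<close> gives
        \<open>\<kappa> (b \<bullet> v) = l b (b \<bullet> v)\<close>, so the coefficients belonging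
        to other eigenvalues vanish.\<close>
      have z: "b \<bullet> v = 0" if b: "b \<in> B" "l b \<noteq> \<kappa>" for b
      proof -
        have "f v = (\<Sum>a\<in>B. (a \<bullet> v) *\<^sub>R f a)"
          by (subst exp[OF vB]) (simp add: sum scale)
        then have "f v = (\<Sum>a\<in>B. (a \<bullet> v) *\<^sub>R (l a *\<^sub>R a))"
          using fb by simp
        then have "b \<bullet> f v = (\<Sum>a\<in>B. (a \<bullet> v) * l a * (b \<bullet> a))"
          by (simp add: inner_sum_right mult.assoc)
        also have "\<dots> = (\<Sum>a\<in>B. if b = a then (a \<bullet> v) * l a else 0)"
          using orth b by (intro sum.cong) auto
        also have "\<dots> = (b \<bullet> v) * l b" using fin b by simp
        finally have "\<kappa> * (b \<bullet> v) = (b \<bullet> v) * l b" using fv by simp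
        then show ?thesis using b(2) by simp
      qed
      have "v = (\<Sum>b\<in>B. (b \<bullet> v) *\<^sub>R b)" by (rule exp[OF vB])
      also have "\<dots> = (\<Sum>b\<in>{b \<in> B. l b = \<kappa>}. (b \<bullet> v) *\<^sub>R b)"
        using z fin by (intro sum.mono_neutral_right) auto
      also have "\<dots> \<in> span {b \<in> B. l b = \<kappa>}"
        by (intro span_sum span_scale span_base)
      finally show "v \<in> span {b \<in> B. l b = \<kappa>}" .
    qed
  qed
  have ne: "{\<kappa>. E \<kappa> \<noteq> {0}} = l ` B"
  proof -
    have "E \<kappa> \<noteq> {0} \<longleftrightarrow> {b \<in> B. l b = \<kappa>} \<noteq> {}" for \<kappa>
    proof
      show "{b \<in> B. l b = \<kappa>} \<noteq> {}" if "E \<kappa> \<noteq> {0}"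
        using that unfolding E by (metis span_empty)
      show "E \<kappa> \<noteq> {0}" if "{b \<in> B. l b = \<kappa>} \<noteq> {}"
        using that B0 span_base unfolding E by (metis (no_types, lifting) all_not_in_conv mem_Collect_eq singletonD)
    qed
    then show ?thesis by auto
  qed
  \<comment> \<open>Finiteness carries content here: a sum over an infinite index set is 0 by
    convention, and the multiset of curvatures would be empty.\<close>
  then show "finite {\<kappa>. E \<kappa> \<noteq> {0}}" using fin by simp
  have dimE: "dim (E \<kappa>) = card {b \<in> B. l b = \<kappa>}" for \<kappa>
    unfolding E by (rule dim_span_eq_card_independent, rule independent_mono[OF ind]) auto
  have "(\<Sum>\<kappa> | E \<kappa> \<noteq> {0}. real (dim (E \<kappa>)) * \<kappa>) = (\<Sum>\<kappa>\<in>l ` B. real (card {b \<in> B. l b = \<kappa>}) * \<kappa>)"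
    unfolding ne dimE ..
  also have "\<dots> = (\<Sum>\<kappa>\<in>l ` B. \<Sum>b | b \<in> B \<and> l b = \<kappa>. l b)"
  proof (rule sum.cong[OF refl])
    fix \<kappa>
    have "(\<Sum>b | b \<in> B \<and> l b = \<kappa>. l b) = (\<Sum>b | b \<in> B \<and> l b = \<kappa>. \<kappa>)"
      by (rule sum.cong) auto
    then show "real (card {b \<in> B. l b = \<kappa>}) * \<kappa> = (\<Sum>b | b \<in> B \<and> l b = \<kappa>. l b)" by simp
  qed
  also have "\<dots> = (\<Sum>b\<in>B. l b)" by (rule sum.image_gen[OF fin, symmetric])
  finally show "(\<Sum>\<kappa> | E \<kappa> \<noteq> {0}. real (dim (E \<kappa>)) * \<kappa>) = (\<Sum>b\<in>B. f b \<bullet> b)" by (simp add: l_def)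
qed

text \<open>Expanding \<open>b\<close> in the standard basis on one side and \<open>i\<close> in
  \<open>B\<close> on the other yields the same double sum of
  \<open>(b \<bullet> i) * (f i \<bullet> b)\<close>.\<close>

lemma trace_orthonormal_basis:
  fixes f :: "'a::euclidean_space \<Rightarrow> 'a"
  assumes f: "linear f" and B: "pairwise orthogonal B" "\<And>b. b \<in> B \<Longrightarrow> norm b = 1" "span B = UNIV"
  shows "(\<Sum>b\<in>B. f b \<bullet> b) = (\<Sum>i\<in>Basis. f i \<bullet> i)"
proof -
  interpret linear f by (rule f)
  have fin: "finite B" using pairwise_orthogonal_imp_finite[OF B(1)] .
  have "f b \<bullet> b = (\<Sum>i\<in>Basis. (b \<bullet> i) * (f i \<bullet> b))" for b
  proof -
    have "f b = f (\<Sum>i\<in>Basis. (b \<bullet> i) *\<^sub>R i)" by (simp add: euclidean_representation)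
    then have "f b = (\<Sum>i\<in>Basis. (b \<bullet> i) *\<^sub>R f i)" by (simp add: sum scale)
    then show ?thesis by (metis (no_types, lifting) inner_scaleR_left inner_sum_left sum.cong)
  qed
  moreover have "f i \<bullet> i = (\<Sum>b\<in>B. (b \<bullet> i) * (f i \<bullet> b))" for i
  proof -
    have "i = (\<Sum>b\<in>B. (b \<bullet> i) *\<^sub>R b)"
      using orthonormal_basis_expand[OF B(1) B(2) _ fin, of i] B(3) by (simp add: inner_commute)
    then show ?thesis by (metis (no_types, lifting) inner_scaleR_right inner_sum_right sum.cong)
  qed
  ultimately show ?thesis
    using sum.swap[of "\<lambda>b i. (b \<bullet> i) * (f i \<bullet> b)" Basis B] by simp
qed

lemma sum_mset_sum:
  "\<Sum>\<^sub># (\<Sum>x\<in>A. f x) = (\<Sum>x\<in>A. \<Sum>\<^sub># (f x))" if "finite A"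
  using that by induction auto

text \<open>Differentiating the factor \<open>inverse (norm (gradient \<rho> x))\<close> contributes
  only a multiple of \<nu>, which disappears against tangent vectors. There the shape operator is
  minus the Hessian divided by the length of the gradient. An eigenbasis of the tangent space
  becomes an orthonormal basis of the whole space once \<nu> is added, so the tangential trace is
  the full trace minus the normal entry.\<close>

lemma sum_principal_curvatures_wrt:
  fixes \<rho> :: "'a::euclidean_space \<Rightarrow> real"
  assumes \<rho>: "Ck_on 2 U \<rho>" and U: "open U" "y \<in> U" and G: "gradient \<rho> y \<noteq> 0"
  defines "\<nu> \<equiv> inner_normal \<rho> y"
  shows "(\<Sum>\<^sub># (principal_curvatures_wrt \<rho> y)) =
    - ((\<Sum>i\<in>Basis. hess \<rho> y i \<bullet> i) - hess \<rho> y \<nu> \<bullet> \<nu>) / norm (gradient \<rho> y)"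
proof -
  let ?A = "hess \<rho> y" and ?g = "norm (gradient \<rho> y)"
  interpret A: bounded_linear ?A by (rule hess_linear[OF \<rho> U(2)])
  have g: "?g > 0" using G by simp
  have \<nu>: "norm \<nu> = 1" "\<nu> = gradient \<rho> y /\<^sub>R ?g" using G by (simp_all add: \<nu>_def inner_normal_def)
  have \<nu>\<nu>: "\<nu> \<bullet> \<nu> = 1" using \<nu>(1) by (simp add: dot_square_norm)
  define f where "f = shape_operator \<rho> y"
  have f: "f v = - ((?A v - (?A v \<bullet> \<nu>) *\<^sub>R \<nu>) /\<^sub>R ?g)" for v
  proof -
    have D: "(gradient \<rho> has_derivative ?A) (at y)"
      by (rule gradient_has_derivative_hess[OF Ck_on_2D(2)[OF \<rho> U(2)]])
    have "((\<lambda>x. norm (gradient \<rho> x)) has_derivative (\<lambda>v. ?A v \<bullet> sgn (gradient \<rho> y))) (at y)"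
      by (rule has_derivative_compose[OF D has_derivative_norm[OF G], unfolded o_def])
    then have "((\<lambda>x. inverse (norm (gradient \<rho> x))) has_derivative
        (\<lambda>v. - (inverse ?g * (?A v \<bullet> sgn (gradient \<rho> y)) * inverse ?g))) (at y)"
      using Deriv.has_derivative_inverse[where f="\<lambda>x. norm (gradient \<rho> x)"] G by simp
    from has_derivative_scaleR[OF this D]
    have "(inner_normal \<rho> has_derivative (\<lambda>v. inverse ?g *\<^sub>R ?A v +
        (- (inverse ?g * (?A v \<bullet> sgn (gradient \<rho> y)) * inverse ?g)) *\<^sub>R gradient \<rho> y)) (at y)"
      unfolding inner_normal_def[abs_def] .
    then have "frechet_derivative (inner_normal \<rho>) (at y) = (\<lambda>v. inverse ?g *\<^sub>R ?A v +
        (- (inverse ?g * (?A v \<bullet> sgn (gradient \<rho> y)) * inverse ?g)) *\<^sub>R gradient \<rho> y)"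
      by (rule frechet_derivative_at[symmetric])
    moreover have "sgn (gradient \<rho> y) = \<nu>" by (simp add: \<nu>(2) sgn_div_norm)
    ultimately have "f v = - (inverse ?g *\<^sub>R ?A v - (inverse ?g * (?A v \<bullet> \<nu>) * inverse ?g) *\<^sub>R gradient \<rho> y)"
      by (simp add: f_def shape_operator_def)
    also have "(inverse ?g * (?A v \<bullet> \<nu>) * inverse ?g) *\<^sub>R gradient \<rho> y = inverse ?g *\<^sub>R (?A v \<bullet> \<nu>) *\<^sub>R \<nu>"
      unfolding \<nu>(2) by simp
    finally show ?thesis by (simp add: scaleR_diff_right)
  qed
  define S where "S = {v. v \<bullet> \<nu> = 0}"
  have ts: "tangent_space \<rho> y = S" by (simp add: S_def tangent_space_def \<nu>_def)
  have S: "subspace S" by (auto simp: S_def subspace_def inner_add_left)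
  have lin: "linear f"
    by (rule linearI) (simp_all add: f A.add A.scaleR inner_add_left scaleR_diff_right scaleR_add_left scaleR_add_right algebra_simps)
  have fS: "f x \<in> S" for x
    using \<nu>\<nu> by (simp add: S_def f inner_diff_left)
  have fin: "f x \<bullet> w = - (?A x \<bullet> w) / ?g" if "w \<in> S" for x w
    using that by (simp add: f S_def inner_diff_left inner_commute[of \<nu> w] divide_inverse)
  have adj: "f x \<bullet> w = x \<bullet> f w" if "x \<in> S" "w \<in> S" for x w
    using fin that hess_symmetric[OF \<rho> U, of x w] by (simp add: inner_commute[of x "f w"])
  obtain B where B: "pairwise orthogonal B" "\<forall>b\<in>B. norm b = 1 \<and> (\<exists>c. f b = c *\<^sub>R b)" "span B = S"
    using self_adjoint_eigenbasis[OF S lin fS adj] by blast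
  have BS: "B \<subseteq> S" using B(3) span_superset by blast
  have finB: "finite B" using pairwise_orthogonal_imp_finite[OF B(1)] .
  have E: "curvature_eigenspace \<rho> y \<kappa> = {v \<in> span B. f v = \<kappa> *\<^sub>R v}" for \<kappa>
    by (simp add: curvature_eigenspace_def ts B(3) f_def)
  note dims = eigenspace_dim_sum[OF lin B(1), folded E]
  have "(\<Sum>\<^sub># (principal_curvatures_wrt \<rho> y)) = (\<Sum>\<kappa> | curvature_eigenspace \<rho> y \<kappa> \<noteq> {0}.
      real (dim (curvature_eigenspace \<rho> y \<kappa>)) * \<kappa>)"
    unfolding principal_curvatures_wrt_def by (subst sum_mset_sum) (use dims(1) B(2) in simp_all)
  also have "\<dots> = (\<Sum>b\<in>B. f b \<bullet> b)"
    by (rule dims(2)) (use B(2) in auto)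
  also have "\<dots> = - (\<Sum>b\<in>B. ?A b \<bullet> b) / ?g"
    using BS fin by (simp add: subset_iff sum_negf sum_divide_distrib)
  also have "(\<Sum>b\<in>B. ?A b \<bullet> b) = (\<Sum>i\<in>Basis. ?A i \<bullet> i) - ?A \<nu> \<bullet> \<nu>"
  proof -
    have "\<nu> \<notin> B" using BS \<nu>\<nu> by (auto simp: S_def)
    then have "(\<Sum>b\<in>insert \<nu> B. ?A b \<bullet> b) = ?A \<nu> \<bullet> \<nu> + (\<Sum>b\<in>B. ?A b \<bullet> b)"
      using finB by simp
    moreover have "(\<Sum>b\<in>insert \<nu> B. ?A b \<bullet> b) = (\<Sum>i\<in>Basis. ?A i \<bullet> i)"
    proof (rule trace_orthonormal_basis)
      show "linear ?A" by (rule A.linear)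
      show "pairwise orthogonal (insert \<nu> B)"
        using B(1) BS by (auto simp: pairwise_insert orthogonal_def S_def inner_commute)
      have "x \<in> span (insert \<nu> B)" for x
      proof -
        have "x - (x \<bullet> \<nu>) *\<^sub>R \<nu> \<in> span B"
          using \<nu>\<nu> by (simp add: B(3) S_def inner_diff_left)
        then show ?thesis using span_breakdown_eq by blast
      qed
      then show "span (insert \<nu> B) = UNIV" by blast
    qed (use \<nu>(1) B(2) in auto)
    ultimately show ?thesis by simp
  qed
  finally show ?thesis .
qed

section \<open>Bump functions\<close>

lemma poly_times_exp_tendsto_0: "((\<lambda>u::real. poly p u * exp (- u)) \<longlongrightarrow> 0) at_top"
proof -
  have "((\<lambda>u. \<Sum>i\<le>degree p. coeff p i * (u ^ i / exp u)) \<longlongrightarrow> (\<Sum>i\<le>degree p. coeff p i * 0)) at_top"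
    by (intro tendsto_sum tendsto_mult tendsto_const tendsto_power_div_exp_0)
  moreover have "(\<Sum>i\<le>degree p. coeff p i * (u ^ i / exp u)) = poly p u * exp (- u)" for u
    by (simp add: poly_altdef sum_distrib_right exp_minus divide_inverse mult.assoc)
  ultimately show ?thesis by simp
qed

text \<open>The polynomials \<open>p\<^sub>j\<close> with \<open>p\<^sub>j(1/t) exp(-1/t)\<close> the \<open>j\<close>-th derivative of \<open>exp(-1/t)\<close>.\<close>
primrec flat_poly :: "nat \<Rightarrow> real poly" where
  "flat_poly 0 = 1"
| "flat_poly (Suc j) = [:0, 0, 1:] * (flat_poly j - pderiv (flat_poly j))"

definition flat :: "nat \<Rightarrow> real \<Rightarrow> real" where
  "flat j t = (if t > 0 then poly (flat_poly j) (1 / t) * exp (- (1 / t)) else 0)"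

text \<open>With u = 1/t one has du/dt = -u^2, so p(u) exp(-u) has derivative u^2 (p - p')(u)
  exp(-u), which is the recursion for \<open>flat_poly\<close>. At 0 the decay of the exponential
  beats every polynomial in u.\<close>

lemma DERIV_flat: "DERIV (flat j) t :> flat (Suc j) t"
proof -
  consider "t < 0" | "t > 0" | "t = 0" by linarith
  then show ?thesis
  proof cases
    case 1
    have "((\<lambda>_. 0) has_real_derivative 0) (at t)" by simp
    then have "(flat j has_real_derivative 0) (at t)"
      by (rule has_field_derivative_transform_within_open[where S="{..<0}"]) (use 1 in \<open>auto simp: flat_def\<close>)
    then show ?thesis using 1 by (simp add: flat_def)
  next
    case 2
    have "((\<lambda>t. poly (flat_poly j) (1 / t) * exp (- (1 / t))) has_real_derivative
        poly (flat_poly (Suc j)) (1 / t) * exp (- (1 / t))) (at t)"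
      using 2 by (auto intro!: derivative_eq_intros DERIV_chain2[OF poly_DERIV] simp: field_simps power2_eq_square)
    then have "(flat j has_real_derivative poly (flat_poly (Suc j)) (1 / t) * exp (- (1 / t))) (at t)"
      by (rule has_field_derivative_transform_within_open[where S="{0<..}"]) (use 2 in \<open>auto simp: flat_def\<close>)
    then show ?thesis using 2 by (simp add: flat_def)
  next
    case 3
    have "((\<lambda>t. flat j t / t) \<longlongrightarrow> 0) (at_left 0)"
    proof (rule tendsto_eventually)
      show "\<forall>\<^sub>F t in at_left 0. flat j t / t = 0"
        unfolding eventually_at_left_field by (rule exI[of _ "-1"]) (simp add: flat_def)
    qed
    moreover have "((\<lambda>t. flat j t / t) \<longlongrightarrow> 0) (at_right 0)"
    proof -
      \<comment> \<open>Dividing by \<open>t\<close> multiplies by u = 1/t, so the difference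
        quotient at 0 is again a polynomial in u times exp(-u).\<close>
      have "((\<lambda>t. poly ([:0, 1:] * flat_poly j) (inverse t) * exp (- inverse t)) \<longlongrightarrow> 0) (at_right 0)"
        by (rule filterlim_compose[OF poly_times_exp_tendsto_0 filterlim_inverse_at_top_right])
      then show ?thesis
      proof (rule Lim_transform_eventually)
        show "\<forall>\<^sub>F t in at_right 0. poly ([:0, 1:] * flat_poly j) (inverse t) * exp (- inverse t) = flat j t / t"
          unfolding eventually_at_right_field by (rule exI[of _ 1]) (simp add: flat_def field_simps)
      qed
    qed
    ultimately have "((\<lambda>t. flat j t / t) \<longlongrightarrow> 0) (at 0)"
      by (simp add: filterlim_split_at)
    then have "(flat j has_real_derivative 0) (at 0)"
      by (simp add: has_field_derivative_iff flat_def)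
    then show ?thesis using 3 by (simp add: flat_def)
  qed
qed

section \<open>Stability of the classes C^k under sums and products\<close>

lemma partial_deriv_eq:
  "(f has_derivative D) (at x) \<Longrightarrow> partial_deriv b f x = D b"
  unfolding partial_deriv_def using frechet_derivative_at by metis

text \<open>Continuity is written into \<open>Ck_on\<close> at level 0 only; the base case recovers
  it from differentiability.\<close>

lemma Ck_on_mono: "Ck_on (Suc k) UNIV f \<Longrightarrow> Ck_on k UNIV f"
proof (induction k arbitrary: f)
  case 0
  then show ?case
    by (simp add: continuous_at_imp_continuous_on differentiable_imp_continuous_within)
next
  case (Suc k)
  then show ?case by (metis Ck_on.simps(2))
qed

lemma Ck_on_const: "Ck_on k UNIV (\<lambda>_. c)"
proof (induction k arbitrary: c)
  case (Suc k)
  have "partial_deriv b (\<lambda>_. c) = (\<lambda>_::'a. 0)" for b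
    by (intro ext partial_deriv_eq[where D="\<lambda>_. 0"]) simp
  then show ?case using Suc by simp
qed simp

lemma Ck_on_affine: "Ck_on k UNIV (\<lambda>x. c * ((x - a) \<bullet> b))"
proof (cases k)
  case (Suc m)
  have D: "((\<lambda>x. c * ((x - a) \<bullet> b)) has_derivative (\<lambda>h. c * (h \<bullet> b))) (at x)" for x
    by (auto intro!: derivative_eq_intros)
  have "partial_deriv i (\<lambda>x. c * ((x - a) \<bullet> b)) = (\<lambda>_. c * (i \<bullet> b))" for i
    by (intro ext partial_deriv_eq D)
  then show ?thesis using Suc D Ck_on_const by (auto simp: differentiable_def)
qed (auto intro!: continuous_intros)

lemma Ck_on_add: "Ck_on k UNIV f \<Longrightarrow> Ck_on k UNIV g \<Longrightarrow> Ck_on k UNIV (\<lambda>x. f x + g x)"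
proof (induction k arbitrary: f g)
  case (Suc k)
  have "partial_deriv b (\<lambda>x. f x + g x) = (\<lambda>x. partial_deriv b f x + partial_deriv b g x)" for b
    using Suc.prems unfolding partial_deriv_def
    by (intro ext partial_deriv_eq[unfolded partial_deriv_def] has_derivative_add) (auto simp: frechet_derivative_works)
  with Suc show ?case by (auto intro!: differentiable_add)
qed (auto intro: continuous_intros)

lemma Ck_on_mult: "Ck_on k UNIV f \<Longrightarrow> Ck_on k UNIV g \<Longrightarrow> Ck_on k UNIV (\<lambda>x. f x * g x)"
proof (induction k arbitrary: f g)
  case (Suc k)
  have "partial_deriv b (\<lambda>x. f x * g x) = (\<lambda>x. f x * partial_deriv b g x + partial_deriv b f x * g x)" for b
    using Suc.prems unfolding partial_deriv_def
    by (intro ext partial_deriv_eq[unfolded partial_deriv_def] has_derivative_mult) (auto simp: frechet_derivative_works)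
  moreover have "Ck_on k UNIV (\<lambda>x. f x * partial_deriv b g x + partial_deriv b f x * g x)" if "b \<in> Basis" for b
    using Suc.prems that by (intro Ck_on_add Suc.IH) (auto intro: Ck_on_mono)
  ultimately show ?case using Suc.prems by (auto intro!: differentiable_mult)
qed (auto intro: continuous_intros)

text \<open>A partial derivative turns index \<open>j\<close> into \<open>Suc j\<close> and creates
  an affine factor, so the induction has to run over all \<open>j\<close> at once. The squared
  distance is used because it is smooth at the centre as well.\<close>

lemma Ck_on_flat_radial: "Ck_on k UNIV (\<lambda>x. flat j (r\<^sup>2 - (x - a) \<bullet> (x - a)))"
proof (induction k arbitrary: j)
  case 0
  have "continuous_on UNIV (flat j)"
    using DERIV_flat DERIV_isCont continuous_at_imp_continuous_on by blast
  then show ?case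
    by (auto intro!: continuous_intros intro: continuous_on_compose2)
next
  case (Suc k)
  have "((\<lambda>x. r\<^sup>2 - (x - a) \<bullet> (x - a)) has_derivative (\<lambda>h. (-2) * ((x - a) \<bullet> h))) (at x)" for x
    by (auto intro!: derivative_eq_intros simp: inner_commute algebra_simps)
  then have D: "((\<lambda>x. flat j (r\<^sup>2 - (x - a) \<bullet> (x - a))) has_derivative
      (\<lambda>h. flat (Suc j) (r\<^sup>2 - (x - a) \<bullet> (x - a)) * ((-2) * ((x - a) \<bullet> h)))) (at x)" for x
    by (rule has_derivative_compose) (use DERIV_flat in \<open>simp add: has_field_derivative_def\<close>)
  have part: "partial_deriv b (\<lambda>x. flat j (r\<^sup>2 - (x - a) \<bullet> (x - a))) =
      (\<lambda>x. flat (Suc j) (r\<^sup>2 - (x - a) \<bullet> (x - a)) * ((-2) * ((x - a) \<bullet> b)))" for b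
    by (intro ext partial_deriv_eq D)
  have "Ck_on k UNIV (partial_deriv b (\<lambda>x. flat j (r\<^sup>2 - (x - a) \<bullet> (x - a))))" for b
    unfolding part by (rule Ck_on_mult[OF Suc.IH Ck_on_affine])
  then show ?case using D unfolding Ck_on.simps differentiable_def by blast
qed

lemma bump_exists:
  fixes a :: "'a::euclidean_space"
  assumes r: "r > 0" "cball a r \<subseteq> \<Omega>"
  obtains \<phi> where "test_function \<Omega> \<phi>" "\<And>x. \<phi> x \<ge> 0" "\<And>x. x \<in> ball a r \<Longrightarrow> \<phi> x > 0" "\<And>x. x \<notin> ball a r \<Longrightarrow> \<phi> x = 0"
proof
  let ?\<phi> = "\<lambda>x. flat 0 (r\<^sup>2 - (x - a) \<bullet> (x - a))"
  have "norm (x - a) < r \<longleftrightarrow> (norm (x - a))\<^sup>2 < r\<^sup>2" for x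
    using r(1) by (meson norm_ge_zero order_less_imp_le pos2 power2_less_imp_less power_strict_mono)
  moreover have "x \<in> ball a r \<longleftrightarrow> norm (x - a) < r" for x
    by (simp add: dist_norm norm_minus_commute)
  ultimately have pos: "r\<^sup>2 - (x - a) \<bullet> (x - a) > 0 \<longleftrightarrow> x \<in> ball a r" for x
    by (simp add: dot_square_norm)
  show "?\<phi> x \<ge> 0" for x by (simp add: flat_def)
  show "?\<phi> x > 0" if "x \<in> ball a r" for x using that unfolding flat_def pos by simp
  show z: "?\<phi> x = 0" if "x \<notin> ball a r" for x using that unfolding flat_def pos by simp
  have "{x. ?\<phi> x \<noteq> 0} \<subseteq> cball a r" using z ball_subset_cball by blast
  then have "closure {x. ?\<phi> x \<noteq> 0} \<subseteq> cball a r" by (intro closure_minimal) auto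
  moreover from this have "compact (closure {x. ?\<phi> x \<noteq> 0})"
    by (meson bounded_cball bounded_subset closed_closure compact_eq_bounded_closed)
  ultimately show "test_function \<Omega> ?\<phi>"
    unfolding test_function_def using Ck_on_flat_radial r(2) by blast
qed

section \<open>Nearest boundary points\<close>

lemma nearest_boundary_point:
  fixes \<Omega> :: "'a::euclidean_space set"
  assumes "open \<Omega>" "\<Omega> \<noteq> UNIV" "x \<in> \<Omega>"
  obtains y where "y \<in> frontier \<Omega>" "y \<notin> \<Omega>" "bdist \<Omega> x = dist x y" "dist x y > 0" "ball x (dist x y) \<subseteq> \<Omega>"
proof -
  obtain y where y: "y \<in> - \<Omega>" "infdist x (- \<Omega>) = dist x y"
    using infdist_attains_inf[of "- \<Omega>" x] assms by auto
  have pos: "dist x y > 0" using y assms(3) by auto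
  have sub: "ball x (dist x y) \<subseteq> \<Omega>"
    using y(2) infdist_le[of _ "- \<Omega>" x] by (force simp: not_less[symmetric])
  then have "y \<in> closure \<Omega>"
    using closure_mono[OF sub] pos by auto
  then have "y \<in> frontier \<Omega>"
    using y(1) assms(1) by (simp add: frontier_def interior_open)
  then show ?thesis using that y pos sub by (simp add: bdist_def)
qed

text \<open>A point outside the domain has \<rho> at most 0. A negative value would persist in a
  neighbourhood, which would then miss the domain, although \<open>y\<close> is in its
  closure.\<close>

lemma defining_function_zero:
  fixes \<Omega> :: "'a::euclidean_space set" and \<rho> :: "'a \<Rightarrow> real"
  assumes U: "open U" "y \<in> U" and \<rho>: "isCont \<rho> y" and eq: "\<Omega> \<inter> U = {x \<in> U. \<rho> x > 0}"
    and y: "y \<in> closure \<Omega>" "y \<notin> \<Omega>"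
  shows "\<rho> y = 0"
proof (rule ccontr)
  assume "\<rho> y \<noteq> 0"
  moreover have "y \<notin> {x \<in> U. \<rho> x > 0}" using eq y(2) by blast
  then have "\<rho> y \<le> 0" using U(2) by auto
  ultimately have "\<rho> y < 0" by simp
  then have "\<forall>\<^sub>F x in nhds y. \<rho> x < 0"
    using \<rho> order_tendstoD(2)[of \<rho> "\<rho> y" "nhds y" 0] by (simp add: continuous_at tendsto_at_iff_tendsto_nhds)
  moreover have "\<forall>\<^sub>F x in nhds y. x \<in> U" using U by (rule eventually_nhds_in_open)
  ultimately have "\<forall>\<^sub>F x in nhds y. \<rho> x < 0 \<and> x \<in> U" by (rule eventually_conj)
  then obtain V where V: "open V" "y \<in> V" "\<And>x. x \<in> V \<Longrightarrow> \<rho> x < 0 \<and> x \<in> U"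
    unfolding eventually_nhds by blast
  then obtain x where "x \<in> \<Omega>" "x \<in> V"
    using y(1) by (meson IntE all_not_in_conv closure_iff_nhds_not_empty order_refl)
  moreover from this have "x \<in> {x \<in> U. \<rho> x > 0}" using V(3)[of x] eq by blast
  ultimately show False using V(3)[of x] by auto
qed

text \<open>Every direction with positive component along \<open>x - y\<close> enters the ball,
  where \<rho> is positive, so the derivative of \<rho> in that direction is nonnegative. A linear
  functional that is nonnegative on an open half-space is a nonnegative multiple of its normal. The
  inner normal at a nearest point is thereby the direction towards \<open>x\<close>.\<close>

lemma gradient_at_nearest_point:
  fixes \<Omega> :: "'a::euclidean_space set" and \<rho> :: "'a \<Rightarrow> real"
  assumes U: "open U" "y \<in> U" and \<rho>: "\<rho> differentiable (at y)" and eq: "\<Omega> \<inter> U = {x \<in> U. \<rho> x > 0}"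
    and y: "\<rho> y = 0" and ball: "ball x (dist x y) \<subseteq> \<Omega>" "x \<noteq> y"
  shows "gradient \<rho> y = norm (gradient \<rho> y) *\<^sub>R ((x - y) /\<^sub>R dist x y)"
proof -
  define \<nu> where "\<nu> = (x - y) /\<^sub>R dist x y"
  define t where "t = dist x y"
  have t: "t > 0" using ball(2) by (simp add: t_def)
  have xy: "x - y = t *\<^sub>R \<nu>" using t by (simp add: \<nu>_def t_def)
  have n\<nu>: "norm \<nu> = 1" using ball(2) by (simp add: \<nu>_def dist_norm)
  have \<nu>\<nu>: "\<nu> \<bullet> \<nu> = 1" using n\<nu> by (simp add: dot_square_norm)
  let ?G = "gradient \<rho> y"
  have nonneg: "?G \<bullet> e \<ge> 0" if e: "e \<bullet> \<nu> > 0" for e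
  proof -
    have "(\<rho> has_derivative (\<lambda>h. ?G \<bullet> h)) (at (y + 0 *\<^sub>R e))"
      using has_derivative_gradient[OF \<rho>] by simp
    then have "((\<lambda>s. \<rho> (y + s *\<^sub>R e)) has_derivative (\<lambda>r. ?G \<bullet> (r *\<^sub>R e))) (at 0)"
      by (rule has_derivative_compose[where f="\<lambda>s. y + s *\<^sub>R e", rotated])
        (auto intro!: derivative_eq_intros)
    then have "((\<lambda>s. \<rho> (y + s *\<^sub>R e)) has_real_derivative (?G \<bullet> e)) (at 0)"
      unfolding has_field_derivative_def by (auto elim!: has_derivative_eq_rhs)
    then have "((\<lambda>s. (\<rho> (y + s *\<^sub>R e)) / s) \<longlongrightarrow> ?G \<bullet> e) (at 0)"
      using y by (simp add: has_field_derivative_iff)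
    then have lim: "((\<lambda>s. (\<rho> (y + s *\<^sub>R e)) / s) \<longlongrightarrow> ?G \<bullet> e) (at_right 0)"
      by (simp add: filterlim_at_split)
    define N where "N = e \<bullet> e"
    have N: "N > 0" using e by (auto simp: N_def)
    have "\<forall>\<^sub>F s in at_right 0. 0 \<le> \<rho> (y + s *\<^sub>R e) / s"
    proof -
      have "((\<lambda>s. y + s *\<^sub>R e) \<longlongrightarrow> y + 0 *\<^sub>R e) (at_right 0)" by (intro tendsto_intros)
      then have "\<forall>\<^sub>F s in at_right 0. y + s *\<^sub>R e \<in> U"
        using U by (intro topological_tendstoD) auto
      \<comment> \<open>The threshold comes from \<open>norm (t \<nu> - s e) < t\<close>: after
        squaring, this reads \<open>s\<^sup>2 N < 2 s t (e \<bullet> \<nu>)\<close>.\<close>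
      moreover have "\<forall>\<^sub>F s in at_right 0. s < 2 * t * (e \<bullet> \<nu>) / N"
        using t e N by (intro eventually_at_rightI[of 0 "2 * t * (e \<bullet> \<nu>) / N"]) auto
      moreover have "\<forall>\<^sub>F s in at_right 0. s > (0::real)" by (rule eventually_at_right_less)
      ultimately show ?thesis
      proof eventually_elim
        case (elim s)
        then have "s * N < 2 * t * (e \<bullet> \<nu>)" using N by (simp add: field_simps)
        then have "s * (s * N) < s * (2 * t * (e \<bullet> \<nu>))" using elim(3) by simp
        moreover have "(norm (t *\<^sub>R \<nu> - s *\<^sub>R e))\<^sup>2 = t\<^sup>2 - s * (2 * t * (e \<bullet> \<nu>)) + s * (s * N)"
          unfolding power2_norm_eq_inner
          by (simp add: inner_diff_left inner_diff_right \<nu>\<nu> N_def inner_commute[of \<nu> e] power2_eq_square algebra_simps)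
        ultimately have "(norm (t *\<^sub>R \<nu> - s *\<^sub>R e))\<^sup>2 < t\<^sup>2" by linarith
        then have "norm (t *\<^sub>R \<nu> - s *\<^sub>R e) < t" using t by (simp add: power2_less_imp_less)
        moreover have "x - (y + s *\<^sub>R e) = t *\<^sub>R \<nu> - s *\<^sub>R e" using xy by (simp add: algebra_simps)
        ultimately have "y + s *\<^sub>R e \<in> ball x t" by (simp only: mem_ball dist_norm)
        then have "y + s *\<^sub>R e \<in> {x \<in> U. \<rho> x > 0}" using ball(1) eq elim(1) unfolding t_def by blast
        then have "\<rho> (y + s *\<^sub>R e) > 0" by simp
        then show ?case using elim(3) by simp
      qed
    qed
    then show ?thesis by (rule tendsto_lowerbound[OF lim]) simp
  qed
  define c where "c = ?G \<bullet> \<nu>"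
  define w where "w = ?G - c *\<^sub>R \<nu>"
  have w\<nu>: "w \<bullet> \<nu> = 0" by (simp add: w_def inner_diff_left \<nu>\<nu> c_def)
  have c0: "c \<ge> 0" unfolding c_def by (rule nonneg) (simp add: \<nu>\<nu>)
  have Gw: "?G \<bullet> w = w \<bullet> w"
  proof -
    have "?G = w + c *\<^sub>R \<nu>" by (simp add: w_def)
    then have "?G \<bullet> w = (w + c *\<^sub>R \<nu>) \<bullet> w" by simp
    then show ?thesis using w\<nu> by (simp add: inner_add_left inner_commute[of \<nu> w])
  qed
  have "w \<bullet> w \<le> 0 + e" if "e > 0" for e
  proof -
    \<comment> \<open>The test direction is \<open>- w\<close> with a small inward push that places
      it in the open half-space. The push contributes \<open>c e / (c + 1)\<close>, at most
      \<open>e\<close>; the denominator \<open>c + 1\<close> also covers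
      \<open>c = 0\<close>.\<close>
    have "?G \<bullet> ((e / (c + 1)) *\<^sub>R \<nu> - w) \<ge> 0"
      by (rule nonneg) (use that c0 in \<open>simp add: inner_diff_left w\<nu> \<nu>\<nu>\<close>)
    then have "w \<bullet> w \<le> e / (c + 1) * c" by (simp add: inner_diff_right Gw c_def)
    also have "\<dots> \<le> e" using that c0 by (simp add: field_simps)
    finally show ?thesis by simp
  qed
  then have "w \<bullet> w \<le> 0" by (rule field_le_epsilon)
  then have "w = 0" by (metis inner_ge_zero inner_eq_zero_iff order_antisym)
  then have G: "?G = c *\<^sub>R \<nu>" by (simp add: w_def)
  then have "norm ?G = c" using c0 n\<nu> by simp
  with G show ?thesis by (simp add: \<nu>_def)
qed

text \<open>The left side is the trace of P A P with P the tangential projection. It is written in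
  the standard basis because the second differences are taken along coordinate directions.\<close>

lemma tangential_trace:
  fixes A :: "'a::euclidean_space \<Rightarrow> 'a"
  assumes A: "linear A" and \<nu>: "norm \<nu> = 1"
  shows "(\<Sum>b\<in>Basis. A (b - (\<nu> \<bullet> b) *\<^sub>R \<nu>) \<bullet> (b - (\<nu> \<bullet> b) *\<^sub>R \<nu>)) = (\<Sum>b\<in>Basis. A b \<bullet> b) - A \<nu> \<bullet> \<nu>"
proof -
  interpret linear A by (rule A)
  have rep: "(\<Sum>b\<in>Basis. (\<nu> \<bullet> b) *\<^sub>R b) = \<nu>" by (simp add: euclidean_representation)
  have "(\<Sum>b\<in>Basis. (\<nu> \<bullet> b) * (A b \<bullet> \<nu>)) = A (\<Sum>b\<in>Basis. (\<nu> \<bullet> b) *\<^sub>R b) \<bullet> \<nu>"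
    by (simp only: sum scale inner_sum_left inner_scaleR_left)
  then have 1: "(\<Sum>b\<in>Basis. (\<nu> \<bullet> b) * (A b \<bullet> \<nu>)) = A \<nu> \<bullet> \<nu>" by (simp only: rep)
  have "(\<Sum>b\<in>Basis. (\<nu> \<bullet> b) * (A \<nu> \<bullet> b)) = A \<nu> \<bullet> (\<Sum>b\<in>Basis. (\<nu> \<bullet> b) *\<^sub>R b)"
    by (simp only: inner_sum_right inner_scaleR_right)
  then have 2: "(\<Sum>b\<in>Basis. (\<nu> \<bullet> b) * (A \<nu> \<bullet> b)) = A \<nu> \<bullet> \<nu>" by (simp only: rep)
  have "(\<Sum>b\<in>Basis. (\<nu> \<bullet> b) * (\<nu> \<bullet> b)) = 1"
    using \<nu> euclidean_inner[of \<nu> \<nu>] by (simp add: dot_square_norm)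
  then have 3: "(\<Sum>b\<in>Basis. (\<nu> \<bullet> b) * (\<nu> \<bullet> b) * (A \<nu> \<bullet> \<nu>)) = A \<nu> \<bullet> \<nu>"
    by (simp flip: sum_distrib_right)
  have "A (b - (\<nu> \<bullet> b) *\<^sub>R \<nu>) \<bullet> (b - (\<nu> \<bullet> b) *\<^sub>R \<nu>) =
     A b \<bullet> b - (\<nu> \<bullet> b) * (A b \<bullet> \<nu>) - (\<nu> \<bullet> b) * (A \<nu> \<bullet> b) + (\<nu> \<bullet> b) * (\<nu> \<bullet> b) * (A \<nu> \<bullet> \<nu>)" for b
    by (simp add: diff scale inner_diff_left inner_diff_right algebra_simps)
  then show ?thesis using 1 2 3 by (simp add: sum_subtractf sum.distrib)
qed

section \<open>Barriers\<close>

lemma tangential_part: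
  fixes h \<nu> :: "'a::euclidean_space"
  assumes "norm \<nu> = 1"
  shows "\<nu> \<bullet> (h - (\<nu> \<bullet> h) *\<^sub>R \<nu>) = 0" "norm (h - (\<nu> \<bullet> h) *\<^sub>R \<nu>) \<le> norm h"
proof -
  have 1: "\<nu> \<bullet> \<nu> = 1" using assms by (simp add: dot_square_norm)
  then show "\<nu> \<bullet> (h - (\<nu> \<bullet> h) *\<^sub>R \<nu>) = 0" by (simp add: inner_diff_right)
  have "(norm (h - (\<nu> \<bullet> h) *\<^sub>R \<nu>))\<^sup>2 = (norm h)\<^sup>2 - (\<nu> \<bullet> h)\<^sup>2"
    unfolding power2_norm_eq_inner
    by (simp add: inner_diff_left inner_diff_right 1 inner_commute[of h \<nu>] power2_eq_square)
  then have "(norm (h - (\<nu> \<bullet> h) *\<^sub>R \<nu>))\<^sup>2 \<le> (norm h)\<^sup>2" by simp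
  then show "norm (h - (\<nu> \<bullet> h) *\<^sub>R \<nu>) \<le> norm h" by (rule power2_le_imp_le) simp
qed

lemma norm_add_normal:
  fixes k \<nu> :: "'a::euclidean_space"
  assumes "norm \<nu> = 1" "\<nu> \<bullet> k = 0"
  shows "(norm (k + a *\<^sub>R \<nu>))\<^sup>2 = (norm k)\<^sup>2 + a\<^sup>2"
proof -
  have "\<nu> \<bullet> \<nu> = 1" using assms(1) by (simp add: dot_square_norm)
  then show ?thesis
    using assms(2) unfolding power2_norm_eq_inner
    by (simp add: inner_add_left inner_add_right inner_commute[of k \<nu>] power2_eq_square)
qed

lemma quadratic_form_add_normal:
  fixes A :: "'a::euclidean_space \<Rightarrow> 'a"
  assumes A: "linear A" "\<And>u v. A u \<bullet> v = A v \<bullet> u"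
  shows "A (k + a *\<^sub>R \<nu>) \<bullet> (k + a *\<^sub>R \<nu>) = A k \<bullet> k + 2 * a * (A \<nu> \<bullet> k) + a\<^sup>2 * (A \<nu> \<bullet> \<nu>)"
proof -
  interpret linear A by (rule A)
  show ?thesis
    using A(2)[of k \<nu>] by (simp add: add scale inner_add_left inner_add_right power2_eq_square algebra_simps)
qed

lemma inner_bound:
  fixes A :: "'a::euclidean_space \<Rightarrow> 'a"
  assumes "\<And>v. norm (A v) \<le> M * norm v"
  shows "\<bar>A u \<bullet> v\<bar> \<le> M * norm u * norm v"
  using Cauchy_Schwarz_ineq2[of "A u" v] assms[of u] by (meson mult_right_mono norm_ge_zero order_trans)

text \<open>With \<open>\<nu>\<close> the inner normal, \<open>\<nu> \<bullet> k + (A k \<bullet> k) / 2\<close> is the Taylor polynomial of the normalised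
  defining function. A tangential step \<open>h\<close> is corrected along \<open>\<nu>\<close> so that \<open>k\<close> stays outside the domain.\<close>
lemma upper_barrier:
  fixes A :: "'a::euclidean_space \<Rightarrow> 'a" and \<nu> :: 'a
  assumes A: "linear A" "\<And>u v. A u \<bullet> v = A v \<bullet> u" "\<And>v. norm (A v) \<le> M * norm v" and M: "M \<ge> 0"
    and \<nu>: "norm \<nu> = 1" and e: "\<epsilon> > 0"
  obtains \<delta> where "\<delta> > 0"
    "\<And>h. norm h < \<delta> \<Longrightarrow> \<nu> \<bullet> h = 0 \<Longrightarrow>
       (let a = - (A h \<bullet> h) / 2 - 2 * \<epsilon> * (norm h)\<^sup>2; k = h + a *\<^sub>R \<nu> in
         norm k \<le> 2 * norm h \<and> \<bar>a\<bar> \<le> norm h \<and> \<nu> \<bullet> k + (A k \<bullet> k) / 2 + \<epsilon> * (norm k)\<^sup>2 \<le> 0)"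
proof -
  \<comment> \<open>\<open>C\<close> bounds the correction by
    \<open>\<bar>a\<bar> \<le> C (norm h)\<^sup>2\<close>, and \<open>D\<close> is the coefficient
    of the cubic errors: \<open>C * M\<close> from the mixed term, the rest from the terms in
    \<open>a\<^sup>2\<close>. The summand with \<open>2 * \<epsilon>\<close> in \<open>a\<close>
    leaves a surplus \<open>- \<epsilon> (norm h)\<^sup>2\<close> to pay for them.\<close>
  define C where "C = M / 2 + 2 * \<epsilon>"
  define D where "D = C * M + C\<^sup>2 * (M / 2 + \<epsilon>)"
  have C: "C > 0" using M e by (simp add: C_def)
  have D: "D \<ge> 0" using M e C by (simp add: D_def)
  \<comment> \<open>The bound \<open>1 / C\<close> yields \<open>\<bar>a\<bar> \<le> norm h\<close>;
    the last entry makes the cubic errors at most the surplus.\<close>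
  define \<delta> where "\<delta> = min 1 (min (1 / C) (\<epsilon> / (D + 1)))"
  have \<delta>: "\<delta> > 0" using C D e by (simp add: \<delta>_def)
  have main: "norm k \<le> 2 * norm h \<and> \<bar>a\<bar> \<le> norm h \<and> \<nu> \<bullet> k + (A k \<bullet> k) / 2 + \<epsilon> * (norm k)\<^sup>2 \<le> 0"
    if h: "norm h < \<delta>" "\<nu> \<bullet> h = 0" and a: "a = - (A h \<bullet> h) / 2 - 2 * \<epsilon> * (norm h)\<^sup>2" and k: "k = h + a *\<^sub>R \<nu>" for h a k
  proof -
    define n where "n = norm h"
    have n: "n \<ge> 0" "n \<le> 1" "n * C \<le> 1" "n * D \<le> \<epsilon>"
    proof -
      have "n < 1" "n < 1 / C" "n < \<epsilon> / (D + 1)" using h by (simp_all add: n_def \<delta>_def)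
      then show "n \<le> 1" "n * C \<le> 1" using C by (simp_all add: field_simps)
      have "n * (D + 1) < \<epsilon>" using \<open>n < \<epsilon> / (D + 1)\<close> D by (simp add: field_simps)
      moreover have "n \<ge> 0" by (simp add: n_def)
      ultimately show "n * D \<le> \<epsilon>" "n \<ge> 0" by (simp_all add: algebra_simps)
    qed
    have "\<bar>A h \<bullet> h\<bar> \<le> M * n\<^sup>2"
      using inner_bound[OF A(3), of h h] by (simp add: n_def power2_eq_square mult.assoc)
    moreover have "\<bar>a\<bar> \<le> \<bar>A h \<bullet> h\<bar> / 2 + 2 * \<epsilon> * n\<^sup>2"
      unfolding a n_def using e by (intro order_trans[OF abs_triangle_ineq4]) simp
    ultimately have aC: "\<bar>a\<bar> \<le> C * n\<^sup>2" by (simp add: C_def algebra_simps)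
    also have "C * n\<^sup>2 = n * C * n" by (simp add: power2_eq_square)
    also have "\<dots> \<le> 1 * n" using n by (intro mult_right_mono) auto
    finally have an: "\<bar>a\<bar> \<le> n" by simp
    have "norm k \<le> norm h + \<bar>a\<bar> * norm \<nu>" unfolding k using norm_triangle_ineq[of h "a *\<^sub>R \<nu>"] by simp
    then have kn: "norm k \<le> 2 * n" using an \<nu> by (simp add: n_def)
    have \<nu>k: "\<nu> \<bullet> k = a" using h(2) \<nu> by (simp add: k inner_add_right dot_square_norm)
    have Ak: "A k \<bullet> k = A h \<bullet> h + 2 * a * (A \<nu> \<bullet> h) + a\<^sup>2 * (A \<nu> \<bullet> \<nu>)"
      unfolding k by (rule quadratic_form_add_normal[OF A(1,2)])
    have nk: "(norm k)\<^sup>2 = n\<^sup>2 + a\<^sup>2" unfolding k n_def by (rule norm_add_normal[OF \<nu> h(2)])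
    have b1: "a * (A \<nu> \<bullet> h) \<le> n\<^sup>2 * (n * (C * M))"
    proof -
      have "a * (A \<nu> \<bullet> h) \<le> \<bar>a\<bar> * \<bar>A \<nu> \<bullet> h\<bar>" by (metis abs_ge_self abs_mult)
      also have "\<dots> \<le> (C * n\<^sup>2) * (M * n)"
        using aC inner_bound[OF A(3), of \<nu> h] \<nu> C by (intro mult_mono) (auto simp: n_def)
      finally show ?thesis by (simp add: mult_ac)
    qed
    have a2: "a\<^sup>2 \<le> n\<^sup>2 * (n * C\<^sup>2)"
    proof -
      have "a\<^sup>2 \<le> (C * n\<^sup>2)\<^sup>2" using aC by (metis abs_ge_zero power2_abs power_mono)
      also have "\<dots> = n\<^sup>2 * (n * C\<^sup>2) * n" by (simp add: power2_eq_square)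
      also have "\<dots> \<le> n\<^sup>2 * (n * C\<^sup>2) * 1" using n C by (intro mult_left_mono) auto
      finally show ?thesis by simp
    qed
    have b2: "a\<^sup>2 * (A \<nu> \<bullet> \<nu>) \<le> n\<^sup>2 * (n * C\<^sup>2) * M"
    proof -
      have "a\<^sup>2 * (A \<nu> \<bullet> \<nu>) \<le> a\<^sup>2 * M"
        using inner_bound[OF A(3), of \<nu> \<nu>] \<nu> by (intro mult_left_mono) auto
      also have "\<dots> \<le> n\<^sup>2 * (n * C\<^sup>2) * M" using a2 M by (rule mult_right_mono)
      finally show ?thesis .
    qed
    have b3: "\<epsilon> * a\<^sup>2 \<le> \<epsilon> * (n\<^sup>2 * (n * C\<^sup>2))" using a2 e by (intro mult_left_mono) auto
    have "\<nu> \<bullet> k + (A k \<bullet> k) / 2 + \<epsilon> * (norm k)\<^sup>2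
       = - (\<epsilon> * n\<^sup>2) + a * (A \<nu> \<bullet> h) + a\<^sup>2 * (A \<nu> \<bullet> \<nu>) / 2 + \<epsilon> * a\<^sup>2"
    proof -
      have Ah: "A h \<bullet> h = - 2 * a - 4 * \<epsilon> * n\<^sup>2" using a by (simp add: n_def)
      show ?thesis unfolding \<nu>k Ak nk Ah by (simp add: field_simps)
    qed
    also have "\<dots> \<le> - (\<epsilon> * n\<^sup>2) + n\<^sup>2 * (n * (C * M)) + n\<^sup>2 * (n * C\<^sup>2) * M / 2 + \<epsilon> * (n\<^sup>2 * (n * C\<^sup>2))"
      using b1 b2 b3 by linarith
    also have "\<dots> = n\<^sup>2 * (n * D - \<epsilon>)" by (simp add: D_def algebra_simps)
    also have "\<dots> \<le> 0" using n(4) by (simp add: mult_nonneg_nonpos)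
    finally show ?thesis using kn an by (simp add: n_def)
  qed
  show ?thesis
    by (rule that[OF \<delta>]) (use main in \<open>simp add: Let_def\<close>)
qed

text \<open>Turns the implicit condition on an exterior point into a graph-type bound on its normal
  component. The condition reads \<open>a (1 + x) \<le> R\<close> with \<open>R\<close> quadratic in
  the tangential part and \<open>x\<close> of the order of \<open>norm k\<close>. Dividing by
  \<open>1 + x\<close>, which is at least 1/2, costs \<open>\<bar>R\<bar> * \<bar>x\<bar>\<close>;
  the second smallness condition on \<open>k\<close> is tailored to this product and keeps the cost
  below one further \<open>\<epsilon> (norm k')\<^sup>2\<close>.\<close>

lemma normal_component_bound:
  fixes A :: "'a::euclidean_space \<Rightarrow> 'a" and \<nu> :: 'a
  assumes A: "linear A" "\<And>u v. A u \<bullet> v = A v \<bullet> u" "\<And>v. norm (A v) \<le> M * norm v" and M: "M \<ge> 0"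
    and \<nu>: "norm \<nu> = 1" and e: "\<epsilon> > 0"
    and k: "norm k * (4 * (M + \<epsilon>)) \<le> 1" "norm k * (4 * (M + \<epsilon>) * (M + 2 * \<epsilon>)) \<le> \<epsilon>"
    and le: "\<nu> \<bullet> k + (A k \<bullet> k) / 2 - \<epsilon> * (norm k)\<^sup>2 \<le> 0"
  defines "k' \<equiv> k - (\<nu> \<bullet> k) *\<^sub>R \<nu>"
  shows "\<nu> \<bullet> k \<le> - (A k' \<bullet> k') / 2 + 2 * \<epsilon> * (norm k')\<^sup>2"
proof -
  define a where "a = \<nu> \<bullet> k"
  define R where "R = - (A k' \<bullet> k') / 2 + \<epsilon> * (norm k')\<^sup>2"
  define x where "x = A \<nu> \<bullet> k' + a * (A \<nu> \<bullet> \<nu>) / 2 - \<epsilon> * a"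
  have kk: "k = k' + a *\<^sub>R \<nu>" by (simp add: k'_def a_def)
  have k': "\<nu> \<bullet> k' = 0" "norm k' \<le> norm k" unfolding k'_def by (rule tangential_part[OF \<nu>])+
  have ak: "\<bar>a\<bar> \<le> norm k" using Cauchy_Schwarz_ineq2[of \<nu> k] \<nu> by (simp add: a_def)
  have "(A k \<bullet> k) = A k' \<bullet> k' + 2 * a * (A \<nu> \<bullet> k') + a\<^sup>2 * (A \<nu> \<bullet> \<nu>)"
    using quadratic_form_add_normal[OF A(1,2), of k' a \<nu>] unfolding kk[symmetric] .
  moreover have "(norm k)\<^sup>2 = (norm k')\<^sup>2 + a\<^sup>2"
    using norm_add_normal[OF \<nu> k'(1), of a] unfolding kk[symmetric] .
  ultimately have aR: "a * (1 + x) \<le> R"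
    using le by (simp add: a_def[symmetric] R_def x_def power2_eq_square algebra_simps add_divide_distrib)
  have xb: "\<bar>x\<bar> \<le> norm k * (2 * (M + \<epsilon>))"
  proof -
    have "\<bar>A \<nu> \<bullet> k'\<bar> \<le> M * norm k"
      using order_trans[OF inner_bound[OF A(3), of \<nu> k'] mult_left_mono[OF k'(2), of "M * norm \<nu>"]] \<nu> M by simp
    moreover have "\<bar>a * (A \<nu> \<bullet> \<nu>)\<bar> \<le> norm k * M"
      unfolding abs_mult using ak inner_bound[OF A(3), of \<nu> \<nu>] \<nu> by (intro mult_mono) auto
    moreover have "\<bar>\<epsilon> * a\<bar> \<le> \<epsilon> * norm k" unfolding abs_mult using ak e by (intro mult_mono) auto
    moreover have "norm k * M \<ge> 0" "\<epsilon> * norm k \<ge> 0" using M e by auto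
    moreover have "norm k * (2 * (M + \<epsilon>)) = 2 * (M * norm k) + 2 * (\<epsilon> * norm k)" by (simp add: algebra_simps)
    ultimately show ?thesis unfolding x_def by (simp add: mult.commute abs_le_iff)
  qed
  then have x: "\<bar>x\<bar> \<le> 1 / 2" using k(1) by (simp add: algebra_simps)
  have "\<bar>A k' \<bullet> k'\<bar> \<le> M * (norm k')\<^sup>2"
    using inner_bound[OF A(3), of k' k'] by (simp add: power2_eq_square mult.assoc)
  moreover have "(norm k')\<^sup>2 * (M / 2 + \<epsilon>) = M * (norm k')\<^sup>2 / 2 + \<epsilon> * (norm k')\<^sup>2" by (simp add: algebra_simps)
  moreover have "\<epsilon> * (norm k')\<^sup>2 \<ge> 0" using e by simp
  ultimately have Rb: "\<bar>R\<bar> \<le> (norm k')\<^sup>2 * (M / 2 + \<epsilon>)"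
    unfolding R_def by (simp add: abs_le_iff)
  have "a - R \<le> \<epsilon> * (norm k')\<^sup>2"
  proof -
    have "(a - R) * (1 + x) \<le> \<bar>R\<bar> * \<bar>x\<bar>"
    proof -
      have "(a - R) * (1 + x) = a * (1 + x) - R - R * x" by (simp add: algebra_simps)
      also have "\<dots> \<le> - (R * x)" using aR by simp
      also have "\<dots> \<le> \<bar>R\<bar> * \<bar>x\<bar>" by (metis abs_ge_minus_self abs_mult)
      finally show ?thesis .
    qed
    also have "\<dots> \<le> ((norm k')\<^sup>2 * (M / 2 + \<epsilon>)) * (norm k * (2 * (M + \<epsilon>)))"
      using Rb xb M e by (intro mult_mono) auto
    also have "\<dots> = (norm k')\<^sup>2 * (norm k * (4 * (M + \<epsilon>) * (M + 2 * \<epsilon>))) / 4"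
      by (simp add: algebra_simps)
    also have "\<dots> \<le> (norm k')\<^sup>2 * \<epsilon> / 4"
      using k(2) by (intro divide_right_mono mult_left_mono) auto
    finally have *: "(a - R) * (1 + x) \<le> (norm k')\<^sup>2 * \<epsilon> / 4" .
    show ?thesis
    proof (cases "a - R \<le> 0")
      case True
      moreover have "\<epsilon> * (norm k')\<^sup>2 \<ge> 0" using e by simp
      ultimately show ?thesis by linarith
    next
      case False
      have "(a - R) * (1 / 2) \<le> (a - R) * (1 + x)"
        using False x by (intro mult_left_mono) auto
      moreover have "\<epsilon> * (norm k')\<^sup>2 \<ge> 0" using e by simp
      ultimately show ?thesis using * by (simp add: mult.commute)
    qed
  qed
  then show ?thesis by (simp add: R_def a_def algebra_simps)
qed


text \<open>For \<open>k\<close> outside the domain, the squared norm splits into a normal part and the square of the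
  tangential mismatch \<open>w\<close> of \<open>k\<close> and \<open>h\<close>. The mixed terms \<open>A h' \<bullet> w\<close> carry a factor \<open>t\<close>, so for
  small \<open>t\<close> they are absorbed by \<open>(norm w)\<^sup>2\<close>.\<close>
lemma lower_barrier:
  fixes A :: "'a::euclidean_space \<Rightarrow> 'a" and \<nu> :: 'a
  assumes A: "linear A" "\<And>u v. A u \<bullet> v = A v \<bullet> u" "\<And>v. norm (A v) \<le> M * norm v" and M: "M \<ge> 0"
    and \<nu>: "norm \<nu> = 1" and e: "\<epsilon> > 0"
    and t: "t * (16 * (M + \<epsilon>)) \<le> 1" "t * (16 * (M + \<epsilon>) * (M + 2 * \<epsilon>)) \<le> \<epsilon>" "t * (16 * (M + 4 * \<epsilon>)) \<le> 1"
      "t * (3 * (M / 2 + 4 * \<epsilon> + M\<^sup>2 / (4 * \<epsilon>))) \<le> 1"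
    and h: "norm h \<le> t / 2" "(M / 2 + 16 * \<epsilon>)\<^sup>2 * (norm h)\<^sup>2 \<le> 11 * \<epsilon> * t"
    and k: "norm k \<le> 4 * t" "\<nu> \<bullet> k + (A k \<bullet> k) / 2 - \<epsilon> * (norm k)\<^sup>2 \<le> 0"
  defines "h' \<equiv> h - (\<nu> \<bullet> h) *\<^sub>R \<nu>"
  shows "t + \<nu> \<bullet> h + (A h' \<bullet> h') / 2 - 16 * \<epsilon> * (norm h)\<^sup>2 \<le> norm (t *\<^sub>R \<nu> + h - k)"
proof -
  interpret linear A by (rule A)
  \<comment> \<open>With the names that follow,
    \<open>t \<nu> + h - k = - w + (\<tau> - a) \<nu>\<close>. The claim is that
    \<open>\<tau> + \<beta>\<close> is at most the length of this vector; \<alpha> is the bound on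
    \<open>a\<close> that exteriority of \<open>k\<close> provides.\<close>
  define a b where "a = \<nu> \<bullet> k" and "b = \<nu> \<bullet> h"
  define k' where "k' = k - a *\<^sub>R \<nu>"
  define w where "w = k' - h'"
  define \<tau> where "\<tau> = t + b"
  define \<alpha> where "\<alpha> = - (A k' \<bullet> k') / 2 + 2 * \<epsilon> * (norm k')\<^sup>2"
  define \<beta> where "\<beta> = (A h' \<bullet> h') / 2 - 16 * \<epsilon> * (norm h)\<^sup>2"
  have t0: "t \<ge> 0" using h(1) norm_ge_zero[of h] by linarith
  have bh: "\<bar>b\<bar> \<le> norm h" using Cauchy_Schwarz_ineq2[of \<nu> h] \<nu> by (simp add: b_def)
  have \<tau>: "t / 2 \<le> \<tau>" "\<tau> \<le> 3 * t / 2" "\<tau> \<ge> 0" using bh h(1) t0 by (auto simp: \<tau>_def)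
  have hp: "\<nu> \<bullet> h' = 0" "norm h' \<le> norm h" unfolding h'_def by (rule tangential_part[OF \<nu>])+
  have kp: "\<nu> \<bullet> k' = 0" "norm k' \<le> norm k" unfolding k'_def a_def by (rule tangential_part[OF \<nu>])+
  have quad: "\<bar>A v \<bullet> v\<bar> \<le> M * (norm v)\<^sup>2" for v
    using inner_bound[OF A(3), of v v] by (simp add: power2_eq_square mult.assoc)
  have scale4: "norm k * c \<le> d" if "t * (4 * c) \<le> d" "c \<ge> 0" for c d
  proof -
    have "norm k * c \<le> 4 * t * c" using k(1) that(2) by (rule mult_right_mono)
    then show ?thesis using that(1) by (simp add: mult_ac)
  qed
  have a\<alpha>: "a \<le> \<alpha>"
    unfolding a_def \<alpha>_def k'_def
  proof (rule normal_component_bound[OF A M \<nu> e _ _ k(2)])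
    show "norm k * (4 * (M + \<epsilon>)) \<le> 1" by (rule scale4) (use t(1) M e in auto)
    have eq: "4 * (4 * (M + \<epsilon>) * (M + 2 * \<epsilon>)) = 16 * (M + \<epsilon>) * (M + 2 * \<epsilon>)" by simp
    show "norm k * (4 * (M + \<epsilon>) * (M + 2 * \<epsilon>)) \<le> \<epsilon>"
    proof (rule scale4)
      show "t * (4 * (4 * (M + \<epsilon>) * (M + 2 * \<epsilon>))) \<le> \<epsilon>" unfolding eq by (rule t(2))
    qed (use M e in auto)
  qed
  \<comment> \<open>From \<open>a \<le> \<alpha> \<le> \<tau>\<close> one may replace
    \<open>(\<tau> - a)\<^sup>2\<close> by the smaller \<open>(\<tau> - \<alpha>)\<^sup>2\<close>;
    without the second inequality squaring would not be monotone.\<close>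
  have \<alpha>\<tau>: "\<alpha> \<le> \<tau>"
  proof -
    have "\<alpha> \<le> (M / 2 + 2 * \<epsilon>) * (norm k')\<^sup>2"
      using quad[of k'] by (simp add: \<alpha>_def algebra_simps abs_le_iff)
    also have "\<dots> \<le> (M / 2 + 2 * \<epsilon>) * (4 * t)\<^sup>2"
      using kp(2) k(1) M e by (intro mult_left_mono power_mono) auto
    also have "\<dots> = t * (16 * (M + 4 * \<epsilon>)) * (t / 2)" by (simp add: power2_eq_square algebra_simps)
    also have "\<dots> \<le> 1 * (t / 2)" using t(3) t0 by (intro mult_right_mono) auto
    finally show ?thesis using \<tau>(1) by simp
  qed
  \<comment> \<open>The forms in \<open>h'\<close> cancel. Of the 16 \<epsilon> built into \<beta>,
    one is spent on the mixed term by Young's inequality and four on \<open>norm k'\<close>, which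
    leaves 11.\<close>
  have key: "\<alpha> + \<beta> \<le> (M / 2 + 4 * \<epsilon> + M\<^sup>2 / (4 * \<epsilon>)) * (norm w)\<^sup>2 - 11 * \<epsilon> * (norm h)\<^sup>2"
  proof -
    have kw: "k' = h' + w" by (simp add: w_def)
    have "A k' \<bullet> k' = A h' \<bullet> h' + 2 * (A h' \<bullet> w) + A w \<bullet> w"
      unfolding kw using A(2)[of w h'] by (simp add: add inner_add_left inner_add_right)
    then have 1: "\<alpha> + \<beta> = - (A h' \<bullet> w) - (A w \<bullet> w) / 2 + 2 * \<epsilon> * (norm k')\<^sup>2 - 16 * \<epsilon> * (norm h)\<^sup>2"
      by (simp add: \<alpha>_def \<beta>_def field_simps)
    have 2: "- (A h' \<bullet> w) \<le> \<epsilon> * (norm h)\<^sup>2 + M\<^sup>2 / (4 * \<epsilon>) * (norm w)\<^sup>2"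
    proof -
      have "- (A h' \<bullet> w) \<le> M * norm h' * norm w" using inner_bound[OF A(3), of h' w] by linarith
      also have "\<dots> \<le> M * norm h * norm w" using hp(2) M by (intro mult_right_mono mult_left_mono) auto
      also have "\<dots> \<le> \<epsilon> * (norm h)\<^sup>2 + M\<^sup>2 / (4 * \<epsilon>) * (norm w)\<^sup>2"
      proof -
        have "0 \<le> (2 * \<epsilon> * norm h - M * norm w)\<^sup>2 / (4 * \<epsilon>)" using e by simp
        also have "\<dots> = \<epsilon> * (norm h)\<^sup>2 + M\<^sup>2 / (4 * \<epsilon>) * (norm w)\<^sup>2 - M * norm h * norm w"
          using e by (simp add: power2_eq_square field_simps)
        finally show ?thesis by simp
      qed
      finally show ?thesis .
    qed
    have 3: "- (A w \<bullet> w) \<le> M * (norm w)\<^sup>2" using quad[of w] by linarith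
    have 4: "\<epsilon> * (norm k')\<^sup>2 \<le> \<epsilon> * (2 * (norm h)\<^sup>2 + 2 * (norm w)\<^sup>2)"
    proof -
      have "(norm k')\<^sup>2 \<le> (norm h' + norm w)\<^sup>2"
        unfolding kw by (intro power_mono norm_triangle_ineq) auto
      also have "\<dots> \<le> 2 * (norm h')\<^sup>2 + 2 * (norm w)\<^sup>2"
        using zero_le_power2[of "norm h' - norm w"] by (simp add: power2_sum power2_diff)
      also have "(norm h')\<^sup>2 \<le> (norm h)\<^sup>2" using hp(2) by (simp add: power_mono)
      finally show ?thesis using e by simp
    qed
    show ?thesis unfolding 1 using 2 3 4 by (simp add: algebra_simps)
  qed
  have bb: "\<beta>\<^sup>2 \<le> 22 * \<epsilon> * \<tau> * (norm h)\<^sup>2"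
  proof -
    have "\<bar>\<beta>\<bar> \<le> (M / 2 + 16 * \<epsilon>) * (norm h)\<^sup>2"
    proof -
      have "\<bar>A h' \<bullet> h'\<bar> \<le> M * (norm h)\<^sup>2"
        using quad[of h'] power_mono[OF hp(2), of 2] M by (meson mult_left_mono norm_ge_zero order_trans)
      moreover have "\<bar>\<beta>\<bar> \<le> \<bar>A h' \<bullet> h'\<bar> / 2 + 16 * \<epsilon> * (norm h)\<^sup>2"
        unfolding \<beta>_def using e by (intro order_trans[OF abs_triangle_ineq4]) simp
      ultimately show ?thesis by (simp add: algebra_simps)
    qed
    then have "\<beta>\<^sup>2 \<le> ((M / 2 + 16 * \<epsilon>) * (norm h)\<^sup>2)\<^sup>2" by (metis abs_ge_zero power2_abs power_mono)
    also have "\<dots> = (M / 2 + 16 * \<epsilon>)\<^sup>2 * (norm h)\<^sup>2 * (norm h)\<^sup>2"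
      by (simp add: power_mult_distrib power2_eq_square)
    also have "\<dots> \<le> 11 * \<epsilon> * t * (norm h)\<^sup>2" using h(2) by (rule mult_right_mono) simp
    also have "\<dots> \<le> 22 * \<epsilon> * \<tau> * (norm h)\<^sup>2" using \<tau>(1) e by (intro mult_right_mono) auto
    finally show ?thesis .
  qed
  have "(\<tau> + \<beta>)\<^sup>2 \<le> (norm (t *\<^sub>R \<nu> + h - k))\<^sup>2"
  proof -
    have "t *\<^sub>R \<nu> + h - k = - w + (\<tau> - a) *\<^sub>R \<nu>"
      by (simp add: w_def k'_def h'_def \<tau>_def b_def[symmetric] algebra_simps)
    moreover have "\<nu> \<bullet> (- w) = 0" using hp(1) kp(1) by (simp add: w_def inner_diff_right)
    ultimately have N: "(norm (t *\<^sub>R \<nu> + h - k))\<^sup>2 = (norm w)\<^sup>2 + (\<tau> - a)\<^sup>2"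
      using norm_add_normal[OF \<nu>, of "- w" "\<tau> - a"] by simp
    have "(\<tau> - \<alpha>)\<^sup>2 \<le> (\<tau> - a)\<^sup>2" using a\<alpha> \<alpha>\<tau> by (intro power_mono) auto
    moreover have "(\<tau> - \<alpha>)\<^sup>2 = \<tau>\<^sup>2 - 2 * \<tau> * \<alpha> + \<alpha>\<^sup>2" by (simp add: power2_diff)
    moreover have "(\<tau> + \<beta>)\<^sup>2 = \<tau>\<^sup>2 + 2 * \<tau> * \<beta> + \<beta>\<^sup>2" by (simp add: power2_sum)
    \<comment> \<open>The remaining \<open>22 * \<epsilon> * \<tau> * (norm h)\<^sup>2\<close> pays
      for \<open>\<beta>\<^sup>2\<close>. As \<tau> is at most \<open>3 * t / 2\<close>, the
      condition \<open>t * (3 * C) \<le> 1\<close> handles the mismatch.\<close>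
    moreover have "2 * \<tau> * (\<alpha> + \<beta>) + \<beta>\<^sup>2 \<le> (norm w)\<^sup>2"
    proof -
      define C where "C = M / 2 + 4 * \<epsilon> + M\<^sup>2 / (4 * \<epsilon>)"
      have C: "C \<ge> 0" using M e by (simp add: C_def)
      have "2 * \<tau> * (\<alpha> + \<beta>) \<le> 2 * \<tau> * (C * (norm w)\<^sup>2 - 11 * \<epsilon> * (norm h)\<^sup>2)"
        using key \<tau>(3) unfolding C_def by (intro mult_left_mono) auto
      also have "\<dots> = 2 * \<tau> * C * (norm w)\<^sup>2 - 22 * \<epsilon> * \<tau> * (norm h)\<^sup>2" by (simp add: algebra_simps)
      also have "2 * \<tau> * C * (norm w)\<^sup>2 \<le> t * (3 * C) * (norm w)\<^sup>2"
        using mult_right_mono[OF \<tau>(2) C] by (intro mult_right_mono) auto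
      also have "\<dots> \<le> 1 * (norm w)\<^sup>2" using t(4) unfolding C_def by (intro mult_right_mono) auto
      finally show ?thesis using bb by simp
    qed
    moreover have "\<alpha>\<^sup>2 \<ge> 0" by simp
    ultimately show ?thesis unfolding N distrib_left by linarith
  qed
  then have "\<tau> + \<beta> \<le> norm (t *\<^sub>R \<nu> + h - k)" by (rule power2_le_imp_le) simp
  then show ?thesis by (simp add: \<tau>_def \<beta>_def b_def)
qed

section \<open>Second differences of the distance function\<close>

lemma bdist_le: "z \<notin> \<Omega> \<Longrightarrow> bdist \<Omega> x \<le> dist x z"
  unfolding bdist_def by (rule infdist_le) simp

lemma continuous_on_bdist: "continuous_on S (bdist \<Omega>)"
  unfolding bdist_def[abs_def] by (intro continuous_intros)

lemma tangential_quadratic_scale: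
  fixes A :: "'a::euclidean_space \<Rightarrow> 'a"
  assumes "linear A"
  shows "A (r *\<^sub>R b - (\<nu> \<bullet> (r *\<^sub>R b)) *\<^sub>R \<nu>) \<bullet> (r *\<^sub>R b - (\<nu> \<bullet> (r *\<^sub>R b)) *\<^sub>R \<nu>)
    = r\<^sup>2 * (A (b - (\<nu> \<bullet> b) *\<^sub>R \<nu>) \<bullet> (b - (\<nu> \<bullet> b) *\<^sub>R \<nu>))"
proof -
  have "r *\<^sub>R b - (\<nu> \<bullet> (r *\<^sub>R b)) *\<^sub>R \<nu> = r *\<^sub>R (b - (\<nu> \<bullet> b) *\<^sub>R \<nu>)" by (simp add: scaleR_diff_right)
  then show ?thesis using assms by (simp add: linear_scale power2_eq_square)
qed

text \<open>The linear term cancels between \<open>h\<close> and \<open>- h\<close>, and the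
  tangential forms along the coordinate directions add up to the tangential trace. The error
  \<open>c\<close> enters twice in each direction.\<close>

lemma second_diff_le_of_quadratic:
  fixes A :: "'a::euclidean_space \<Rightarrow> 'a"
  assumes A: "linear A" and \<nu>: "norm \<nu> = 1" and r: "r > 0"
    and u: "\<And>h. norm h = r \<Longrightarrow> u (x + h) \<le> u x + \<nu> \<bullet> h
       + (A (h - (\<nu> \<bullet> h) *\<^sub>R \<nu>) \<bullet> (h - (\<nu> \<bullet> h) *\<^sub>R \<nu>)) / 2 + c * (norm h)\<^sup>2"
  shows "second_diff u r x \<le> r\<^sup>2 * ((\<Sum>b\<in>Basis. A b \<bullet> b) - A \<nu> \<bullet> \<nu> + 2 * c * DIM('a))"
proof -
  have "u (x + r *\<^sub>R b) + u (x - r *\<^sub>R b) - 2 * u x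
      \<le> r\<^sup>2 * (A (b - (\<nu> \<bullet> b) *\<^sub>R \<nu>) \<bullet> (b - (\<nu> \<bullet> b) *\<^sub>R \<nu>) + 2 * c)" if b: "b \<in> Basis" for b
  proof -
    define q where "q = A (b - (\<nu> \<bullet> b) *\<^sub>R \<nu>) \<bullet> (b - (\<nu> \<bullet> b) *\<^sub>R \<nu>)"
    show ?thesis
      using u[of "r *\<^sub>R b"] u[of "(- r) *\<^sub>R b"] b r
      unfolding tangential_quadratic_scale[OF A] q_def[symmetric] by (simp add: algebra_simps)
  qed
  then have "second_diff u r x \<le> (\<Sum>b\<in>Basis. r\<^sup>2 * (A (b - (\<nu> \<bullet> b) *\<^sub>R \<nu>) \<bullet> (b - (\<nu> \<bullet> b) *\<^sub>R \<nu>) + 2 * c))"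
    unfolding second_diff_def by (rule sum_mono)
  also have "\<dots> = r\<^sup>2 * ((\<Sum>b\<in>Basis. A b \<bullet> b) - A \<nu> \<bullet> \<nu> + 2 * c * DIM('a))"
    unfolding sum_distrib_left[symmetric] sum.distrib tangential_trace[OF A \<nu>] by simp
  finally show ?thesis .
qed

lemma second_diff_ge_of_quadratic:
  fixes A :: "'a::euclidean_space \<Rightarrow> 'a"
  assumes A: "linear A" and \<nu>: "norm \<nu> = 1" and r: "r > 0"
    and u: "\<And>h. norm h = r \<Longrightarrow> u (x + h) \<ge> u x + \<nu> \<bullet> h
       + (A (h - (\<nu> \<bullet> h) *\<^sub>R \<nu>) \<bullet> (h - (\<nu> \<bullet> h) *\<^sub>R \<nu>)) / 2 - c * (norm h)\<^sup>2"
  shows "second_diff u r x \<ge> r\<^sup>2 * ((\<Sum>b\<in>Basis. A b \<bullet> b) - A \<nu> \<bullet> \<nu> - 2 * c * DIM('a))"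
proof -
  have "r\<^sup>2 * (A (b - (\<nu> \<bullet> b) *\<^sub>R \<nu>) \<bullet> (b - (\<nu> \<bullet> b) *\<^sub>R \<nu>) - 2 * c)
      \<le> u (x + r *\<^sub>R b) + u (x - r *\<^sub>R b) - 2 * u x" if b: "b \<in> Basis" for b
  proof -
    define q where "q = A (b - (\<nu> \<bullet> b) *\<^sub>R \<nu>) \<bullet> (b - (\<nu> \<bullet> b) *\<^sub>R \<nu>)"
    show ?thesis
      using u[of "r *\<^sub>R b"] u[of "(- r) *\<^sub>R b"] b r
      unfolding tangential_quadratic_scale[OF A] q_def[symmetric] by (simp add: algebra_simps)
  qed
  then have "(\<Sum>b\<in>Basis. r\<^sup>2 * (A (b - (\<nu> \<bullet> b) *\<^sub>R \<nu>) \<bullet> (b - (\<nu> \<bullet> b) *\<^sub>R \<nu>) - 2 * c)) \<le> second_diff u r x"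
    unfolding second_diff_def by (rule sum_mono)
  also have "(\<Sum>b\<in>Basis. r\<^sup>2 * (A (b - (\<nu> \<bullet> b) *\<^sub>R \<nu>) \<bullet> (b - (\<nu> \<bullet> b) *\<^sub>R \<nu>) - 2 * c))
     = r\<^sup>2 * ((\<Sum>b\<in>Basis. A b \<bullet> b) - A \<nu> \<bullet> \<nu> - 2 * c * DIM('a))"
    unfolding sum_distrib_left[symmetric] sum_subtractf tangential_trace[OF A \<nu>] by simp
  finally show ?thesis .
qed

text \<open>The arithmetic-geometric inequality linearises both norms around \<open>norm v\<close>,
  and the parallelogram identity evaluates the resulting squares.\<close>

lemma norm_second_diff_le:
  fixes v w :: "'a::euclidean_space"
  assumes "v \<noteq> 0"
  shows "norm (v + w) + norm (v - w) - 2 * norm v \<le> (norm w)\<^sup>2 / norm v"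
proof -
  have p: "norm v > 0" using assms by simp
  have "2 * norm v * norm u \<le> (norm u)\<^sup>2 + (norm v)\<^sup>2" for u :: 'a
    using zero_le_power2[of "norm u - norm v"] by (simp add: power2_diff algebra_simps)
  from this[of "v + w"] this[of "v - w"]
  have "2 * norm v * norm (v + w) + 2 * norm v * norm (v - w) \<le> (norm (v + w))\<^sup>2 + (norm (v - w))\<^sup>2 + 2 * (norm v)\<^sup>2"
    by linarith
  also have "\<dots> = 4 * (norm v)\<^sup>2 + 2 * (norm w)\<^sup>2"
    unfolding power2_norm_eq_inner
    by (simp add: inner_add_left inner_add_right inner_diff_left inner_diff_right)
  finally show ?thesis using p by (simp add: field_simps power2_eq_square)
qed

text \<open>The distance to a fixed nearest point \<open>y\<close> lies above \<open>bdist\<close>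
  everywhere and agrees with it at \<open>x\<close>, so its second differences dominate. The bound
  knows nothing of curvature, but it holds for every step and is uniform away from the
  boundary.\<close>

lemma second_diff_bdist_le:
  fixes \<Omega> :: "'a::euclidean_space set"
  assumes "open \<Omega>" "\<Omega> \<noteq> UNIV" "x \<in> \<Omega>"
  shows "second_diff (bdist \<Omega>) r x \<le> real DIM('a) / bdist \<Omega> x * r\<^sup>2"
proof -
  obtain y where y: "y \<notin> \<Omega>" "bdist \<Omega> x = dist x y" "dist x y > 0"
    using nearest_boundary_point[OF assms] by metis
  have "bdist \<Omega> (x + r *\<^sub>R b) + bdist \<Omega> (x - r *\<^sub>R b) - 2 * bdist \<Omega> x \<le> r\<^sup>2 / bdist \<Omega> x" if "b \<in> Basis" for b
  proof -
    have "bdist \<Omega> (x + r *\<^sub>R b) \<le> norm ((x - y) + r *\<^sub>R b)" "bdist \<Omega> (x - r *\<^sub>R b) \<le> norm ((x - y) - r *\<^sub>R b)"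
      using bdist_le[OF y(1), of "x + r *\<^sub>R b"] bdist_le[OF y(1), of "x - r *\<^sub>R b"]
      by (simp_all add: dist_norm algebra_simps)
    then show ?thesis
      using norm_second_diff_le[of "x - y" "r *\<^sub>R b"] y(2,3) that by (simp add: dist_norm)
  qed
  then have "second_diff (bdist \<Omega>) r x \<le> (\<Sum>b\<in>(Basis::'a set). r\<^sup>2 / bdist \<Omega> x)"
    unfolding second_diff_def by (rule sum_mono)
  then show ?thesis by simp
qed

text \<open>The competitor is \<open>y + k\<close>, with \<open>k\<close> the tangential part of
  \<open>h\<close> corrected along \<nu> to stay outside. Then \<open>x + h - (y + k)\<close> is a
  multiple of \<nu>, so its length is an explicit polynomial in \<open>h\<close>.\<close>

lemma second_diff_bdist_upper:
  fixes \<Omega> :: "'a::euclidean_space set"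
  assumes y: "y \<notin> \<Omega>" "y \<in> frontier \<Omega>" "bdist \<Omega> x = dist x y" "dist x y > 0" "ball x (dist x y) \<subseteq> \<Omega>"
    and U: "open U" "y \<in> U" and \<rho>: "Ck_on 2 U \<rho>" and G: "gradient \<rho> y \<noteq> 0"
    and eq: "\<Omega> \<inter> U = {x \<in> U. \<rho> x > 0}"
    and curv: "(\<Sum>i\<in>Basis. hess \<rho> y i \<bullet> i) - hess \<rho> y (inner_normal \<rho> y) \<bullet> inner_normal \<rho> y \<le> 0"
    and \<eta>: "\<eta> > 0"
  obtains \<delta> where "\<delta> > 0" "\<And>r. 0 < r \<Longrightarrow> r < \<delta> \<Longrightarrow> second_diff (bdist \<Omega>) r x \<le> \<eta> * r\<^sup>2"
proof -
  define g where "g = norm (gradient \<rho> y)"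
  define t where "t = dist x y"
  define \<nu> where "\<nu> = (x - y) /\<^sub>R t"
  define A where "A v = hess \<rho> y v /\<^sub>R g" for v
  define n where "n = real DIM('a)"
  \<comment> \<open>The barrier has error \<open>2 * \<epsilon>\<close>, which the second difference
    turns into \<open>2 * (2 * \<epsilon>) * n = \<eta>\<close>.\<close>
  define \<epsilon> where "\<epsilon> = \<eta> / (4 * n)"
  have n: "n > 0" by (simp add: n_def)
  have \<epsilon>: "\<epsilon> > 0" using \<eta> n by (simp add: \<epsilon>_def)
  have g: "g > 0" using G by (simp add: g_def)
  have t: "t > 0" using y(4) by (simp add: t_def)
  have \<nu>: "norm \<nu> = 1" using t by (simp add: \<nu>_def t_def dist_norm)
  have \<rho>y: "\<rho> y = 0"
  proof (rule defining_function_zero[OF U _ eq _ y(1)])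
    show "isCont \<rho> y" using Ck_on_2D(1)[OF \<rho> U(2)] by (rule differentiable_imp_continuous_within)
    show "y \<in> closure \<Omega>" using y(2) by (simp add: frontier_def)
  qed
  have G\<nu>: "gradient \<rho> y = g *\<^sub>R \<nu>"
    unfolding g_def \<nu>_def t_def
    by (rule gradient_at_nearest_point[OF U Ck_on_2D(1)[OF \<rho> U(2)] eq \<rho>y y(5)]) (use y(4) in auto)
  then have in\<nu>: "inner_normal \<rho> y = \<nu>" using g \<nu> by (simp add: inner_normal_def)
  interpret H: bounded_linear "hess \<rho> y" by (rule hess_linear[OF \<rho> U(2)])
  have linA: "linear A" unfolding A_def[abs_def] by (intro linear_compose_scale_right H.linear)
  have symA: "A u \<bullet> v = A v \<bullet> u" for u v using hess_symmetric[OF \<rho> U, of u v] by (simp add: A_def)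
  obtain M where M: "M > 0" "\<And>v. norm (A v) \<le> M * norm v"
    using linear_bounded_pos[OF linA] by blast
  obtain \<delta>0 where \<delta>0: "\<delta>0 > 0"
    "\<And>h. norm h < \<delta>0 \<Longrightarrow> \<nu> \<bullet> h = 0 \<Longrightarrow>
       (let a = - (A h \<bullet> h) / 2 - 2 * \<epsilon> * (norm h)\<^sup>2; k = h + a *\<^sub>R \<nu> in
         norm k \<le> 2 * norm h \<and> \<bar>a\<bar> \<le> norm h \<and> \<nu> \<bullet> k + (A k \<bullet> k) / 2 + \<epsilon> * (norm k)\<^sup>2 \<le> 0)"
    using upper_barrier[OF linA symA M(2) less_imp_le[OF M(1)] \<nu> \<epsilon>] by blast
  obtain d where d: "d > 0" "ball y d \<subseteq> U"
    and T: "\<And>x h. x \<in> ball y d \<Longrightarrow> x + h \<in> ball y d \<Longrightarrow>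
       \<bar>\<rho> (x + h) - \<rho> x - gradient \<rho> x \<bullet> h - (hess \<rho> y h \<bullet> h) / 2\<bar> \<le> \<epsilon> * g * (norm h)\<^sup>2"
    using taylor2_uniform[OF \<rho> U, of "\<epsilon> * g"] \<epsilon> g by (metis mult_pos_pos)
  \<comment> \<open>Since \<open>norm k \<le> 2 * norm h\<close>, the bound \<open>d / 2\<close>
    keeps \<open>y + k\<close> in the Taylor ball. The bound \<open>t / 2\<close> makes
    \<open>t + \<nu> \<bullet> h - a\<close> nonnegative, so that it equals the norm.\<close>
  define \<delta> where "\<delta> = min \<delta>0 (min (d / 2) (t / 2))"
  have \<delta>: "\<delta> > 0" using \<delta>0 d t by (simp add: \<delta>_def)
  have bound: "bdist \<Omega> (x + h) \<le> bdist \<Omega> x + \<nu> \<bullet> h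
       + (A (h - (\<nu> \<bullet> h) *\<^sub>R \<nu>) \<bullet> (h - (\<nu> \<bullet> h) *\<^sub>R \<nu>)) / 2 + 2 * \<epsilon> * (norm h)\<^sup>2" if h: "norm h < \<delta>" for h
  proof -
    define h' where "h' = h - (\<nu> \<bullet> h) *\<^sub>R \<nu>"
    have h': "\<nu> \<bullet> h' = 0" "norm h' \<le> norm h" unfolding h'_def by (rule tangential_part[OF \<nu>])+
    define a where "a = - (A h' \<bullet> h') / 2 - 2 * \<epsilon> * (norm h')\<^sup>2"
    define k where "k = h' + a *\<^sub>R \<nu>"
    have k: "norm k \<le> 2 * norm h'" "\<bar>a\<bar> \<le> norm h'" "\<nu> \<bullet> k + (A k \<bullet> k) / 2 + \<epsilon> * (norm k)\<^sup>2 \<le> 0"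
      using \<delta>0(2)[of h'] h' h unfolding Let_def a_def[symmetric] k_def[symmetric] by (auto simp: \<delta>_def)
    have "norm k < d" using k(1) h'(2) h by (simp add: \<delta>_def)
    then have kb: "y + k \<in> ball y d" by (simp add: dist_norm)
    have "\<rho> (y + k) \<le> gradient \<rho> y \<bullet> k + (hess \<rho> y k \<bullet> k) / 2 + \<epsilon> * g * (norm k)\<^sup>2"
      using T[OF _ kb] d(1) \<rho>y by (simp add: abs_le_iff)
    also have "\<dots> = g * (\<nu> \<bullet> k + (A k \<bullet> k) / 2 + \<epsilon> * (norm k)\<^sup>2)"
      using g by (simp add: G\<nu> A_def algebra_simps)
    also have "\<dots> \<le> 0" using k(3) g by (simp add: mult_nonneg_nonpos)
    finally have "y + k \<notin> {x \<in> U. \<rho> x > 0}" by simp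
    then have "y + k \<notin> \<Omega>" using eq kb d(2) by blast
    then have "bdist \<Omega> (x + h) \<le> norm (x + h - (y + k))" using bdist_le by (metis dist_norm)
    also have "x + h - (y + k) = (t + \<nu> \<bullet> h - a) *\<^sub>R \<nu>"
      using t by (simp add: k_def h'_def \<nu>_def algebra_simps)
    also have "norm \<dots> = t + \<nu> \<bullet> h - a"
    proof -
      have "\<bar>\<nu> \<bullet> h\<bar> \<le> norm h" using Cauchy_Schwarz_ineq2[of \<nu> h] \<nu> by simp
      then have "t + \<nu> \<bullet> h - a \<ge> 0" using k(2) h'(2) h by (simp add: \<delta>_def abs_le_iff)
      then show ?thesis using \<nu> by simp
    qed
    also have "\<dots> \<le> t + \<nu> \<bullet> h + (A h' \<bullet> h') / 2 + 2 * \<epsilon> * (norm h)\<^sup>2"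
    proof -
      have "2 * \<epsilon> * (norm h')\<^sup>2 \<le> 2 * \<epsilon> * (norm h)\<^sup>2"
        using h'(2) \<epsilon> by (intro mult_left_mono power_mono) auto
      then show ?thesis by (simp add: a_def)
    qed
    finally show ?thesis by (simp add: h'_def y(3) t_def)
  qed
  have "second_diff (bdist \<Omega>) r x \<le> \<eta> * r\<^sup>2" if r: "0 < r" "r < \<delta>" for r
  proof -
    have "second_diff (bdist \<Omega>) r x \<le> r\<^sup>2 * ((\<Sum>b\<in>Basis. A b \<bullet> b) - A \<nu> \<bullet> \<nu> + 2 * (2 * \<epsilon>) * DIM('a))"
    proof (rule second_diff_le_of_quadratic[OF linA \<nu> r(1)])
      fix h :: 'a assume "norm h = r"
      then show "bdist \<Omega> (x + h) \<le> bdist \<Omega> x + \<nu> \<bullet> h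
         + (A (h - (\<nu> \<bullet> h) *\<^sub>R \<nu>) \<bullet> (h - (\<nu> \<bullet> h) *\<^sub>R \<nu>)) / 2 + 2 * \<epsilon> * (norm h)\<^sup>2"
        using bound[of h] r(2) by simp
    qed
    also have "(\<Sum>b\<in>Basis. A b \<bullet> b) - A \<nu> \<bullet> \<nu> = ((\<Sum>i\<in>Basis. hess \<rho> y i \<bullet> i) - hess \<rho> y \<nu> \<bullet> \<nu>) / g"
      by (simp add: A_def divide_inverse algebra_simps sum_distrib_left)
    also have "r\<^sup>2 * (((\<Sum>i\<in>Basis. hess \<rho> y i \<bullet> i) - hess \<rho> y \<nu> \<bullet> \<nu>) / g + 2 * (2 * \<epsilon>) * DIM('a)) \<le> r\<^sup>2 * (0 + \<eta>)"
      using curv g n unfolding in\<nu> by (intro mult_left_mono add_mono) (auto simp: divide_nonpos_pos \<epsilon>_def n_def)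
    finally show ?thesis by (simp add: mult.commute)
  qed
  with \<delta> that show ?thesis by blast
qed


text \<open>For \<open>x\<close> near \<open>y0\<close> every nearest point \<open>y\<close> is also
  near \<open>y0\<close>. Hence the normal and the gradient length at \<open>y\<close> are close to
  those at \<open>y0\<close>, and the positive trace survives with half its size. This gives one
  constant for a whole ball of points \<open>x\<close>.\<close>

lemma second_diff_bdist_lower:
  fixes \<Omega> :: "'a::euclidean_space set"
  assumes \<Omega>: "open \<Omega>" "\<Omega> \<noteq> UNIV" and y0: "y0 \<in> frontier \<Omega>"
    and U: "open U" "y0 \<in> U" and \<rho>: "Ck_on 2 U \<rho>" and G: "gradient \<rho> y0 \<noteq> 0"
    and eq: "\<Omega> \<inter> U = {x \<in> U. \<rho> x > 0}"
    and curv: "(\<Sum>i\<in>Basis. hess \<rho> y0 i \<bullet> i) - hess \<rho> y0 (inner_normal \<rho> y0) \<bullet> inner_normal \<rho> y0 > 0"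
  obtains r0 x0 c \<delta> where "r0 > 0" "cball x0 r0 \<subseteq> \<Omega>" "c > 0" "\<delta> > 0"
    "\<And>x r. x \<in> cball x0 r0 \<Longrightarrow> 0 < r \<Longrightarrow> r < \<delta> \<Longrightarrow> second_diff (bdist \<Omega>) r x \<ge> c * r\<^sup>2"
proof -
  define A0 where "A0 = hess \<rho> y0"
  define g0 where "g0 = norm (gradient \<rho> y0)"
  define n where "n = real DIM('a)"
  define F where "F y = (\<Sum>i\<in>Basis. A0 i \<bullet> i) - A0 (inner_normal \<rho> y) \<bullet> inner_normal \<rho> y" for y
  have n: "n > 0" by (simp add: n_def)
  have g0: "g0 > 0" using G by (simp add: g0_def)
  interpret A0: bounded_linear A0 unfolding A0_def by (rule hess_linear[OF \<rho> U(2)])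
  have symA0: "A0 u \<bullet> v = A0 v \<bullet> u" for u v unfolding A0_def by (rule hess_symmetric[OF \<rho> U])
  obtain M0 where M0: "M0 > 0" "\<And>v. norm (A0 v) \<le> M0 * norm v"
    using linear_bounded_pos[OF A0.linear] by blast
  define H0 where "H0 = F y0"
  have H0: "H0 > 0" using curv by (simp add: H0_def F_def A0_def)
  \<comment> \<open>At the nearest points used, \<open>F y > H0 / 2\<close> and the gradient is
    shorter than \<open>2 * g0\<close>, so their quotient is at least \<open>c\<close>. The choice
    of \<epsilon> limits the barrier error \<open>2 * (16 * \<epsilon>) * n\<close> to
    \<open>c / 2\<close>, and \<open>M\<close> bounds the normalised Hessian for gradients longer
    than \<open>g0 / 2\<close>.\<close>
  define c where "c = H0 / (4 * g0)"
  define \<epsilon> where "\<epsilon> = c / (64 * n)"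
  define M where "M = 2 * M0 / g0"
  have c: "c > 0" using H0 g0 by (simp add: c_def)
  have \<epsilon>: "\<epsilon> > 0" using c n by (simp add: \<epsilon>_def)
  have M: "M > 0" using M0(1) g0 by (simp add: M_def)
  obtain d1 where d1: "d1 > 0"
    "\<And>y. dist y y0 < d1 \<Longrightarrow> F y > H0 / 2 \<and> norm (gradient \<rho> y) > g0 / 2 \<and> norm (gradient \<rho> y) < 2 * g0"
  proof -
    have cG: "isCont (gradient \<rho>) y0"
      using gradient_has_derivative_hess[OF Ck_on_2D(2)[OF \<rho> U(2)]] has_derivative_continuous by blast
    have cN: "isCont (inner_normal \<rho>) y0"
      unfolding inner_normal_def[abs_def] using G by (intro continuous_intros cG) auto
    have "isCont F y0"
      unfolding F_def[abs_def] by (intro continuous_intros A0.isCont cN)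
    then have 1: "\<forall>\<^sub>F y in nhds y0. F y > H0 / 2"
      using H0 by (intro order_tendstoD(1)) (auto simp: continuous_at tendsto_at_iff_tendsto_nhds H0_def)
    have cn: "((\<lambda>y. norm (gradient \<rho> y)) \<longlongrightarrow> g0) (nhds y0)"
      using cG by (auto simp: continuous_at tendsto_at_iff_tendsto_nhds g0_def intro!: tendsto_intros)
    have 2: "\<forall>\<^sub>F y in nhds y0. norm (gradient \<rho> y) > g0 / 2" "\<forall>\<^sub>F y in nhds y0. norm (gradient \<rho> y) < 2 * g0"
      by (rule order_tendstoD[OF cn], use g0 in simp)+
    from 1 2 have "\<forall>\<^sub>F y in nhds y0. F y > H0 / 2 \<and> norm (gradient \<rho> y) > g0 / 2 \<and> norm (gradient \<rho> y) < 2 * g0"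
      by eventually_elim simp
    then show ?thesis using that unfolding eventually_nhds_metric by blast
  qed
  \<comment> \<open>The tolerance contains \<open>g0 / 2\<close>, a lower bound for the gradient at
    all relevant \<open>y\<close>, so that after normalisation the error is at most
    \<open>\<epsilon> (norm k)\<^sup>2\<close>.\<close>
  obtain d2 where d2: "d2 > 0" "ball y0 d2 \<subseteq> U"
    and T: "\<And>x h. x \<in> ball y0 d2 \<Longrightarrow> x + h \<in> ball y0 d2 \<Longrightarrow>
       \<bar>\<rho> (x + h) - \<rho> x - gradient \<rho> x \<bullet> h - (hess \<rho> y0 h \<bullet> h) / 2\<bar> \<le> \<epsilon> * (g0 / 2) * (norm h)\<^sup>2"
    using taylor2_uniform[OF \<rho> U, of "\<epsilon> * (g0 / 2)"] \<epsilon> g0 by (metis mult_pos_pos half_gt_zero)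
  define c1 c2 c3 c4 where "c1 = 16 * (M + \<epsilon>)" and "c2 = 16 * (M + \<epsilon>) * (M + 2 * \<epsilon>)"
    and "c3 = 16 * (M + 4 * \<epsilon>)" and "c4 = 3 * (M / 2 + 4 * \<epsilon> + M\<^sup>2 / (4 * \<epsilon>))"
  have cs: "c1 > 0" "c2 > 0" "c3 > 0" "c4 > 0"
    unfolding c1_def c2_def c3_def c4_def using M \<epsilon> by (auto intro!: mult_pos_pos add_pos_pos)
  \<comment> \<open>The first four entries are the smallness conditions on \<open>t\<close> in
    \<open>lower_barrier\<close>. As \<open>dist y y0 < 2 * \<sigma>\<close> and
    \<open>norm k \<le> 4 * t\<close>, the last two keep \<open>y\<close> where \<open>F\<close> is
    controlled and \<open>y + k\<close> in the Taylor ball.\<close>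
  define \<sigma> where "\<sigma> = Min {1 / c1, \<epsilon> / c2, 1 / c3, 1 / c4, d1 / 2, d2 / 8}"
  have "\<sigma> > 0" unfolding \<sigma>_def using cs \<epsilon> d1(1) d2(1) by simp
  moreover have "\<sigma> \<le> 1 / c1" "\<sigma> \<le> \<epsilon> / c2" "\<sigma> \<le> 1 / c3" "\<sigma> \<le> 1 / c4" "\<sigma> \<le> d1 / 2" "\<sigma> \<le> d2 / 8"
    unfolding \<sigma>_def by (rule Min_le; simp)+
  ultimately have \<sigma>: "\<sigma> > 0" "\<sigma> \<le> 1 / c1" "\<sigma> \<le> \<epsilon> / c2" "\<sigma> \<le> 1 / c3" "\<sigma> \<le> 1 / c4" "\<sigma> \<le> d1 / 2" "\<sigma> \<le> d2 / 8"
    by this+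
  have "y0 \<in> closure \<Omega>" using y0 by (simp add: frontier_def)
  then obtain x0 where x0: "x0 \<in> \<Omega>" "dist x0 y0 < \<sigma>"
    using \<sigma>(1) by (meson closure_approachable)
  have "open (\<Omega> \<inter> ball y0 \<sigma>)" using \<Omega> by auto
  moreover have "x0 \<in> \<Omega> \<inter> ball y0 \<sigma>" using x0 by (simp add: dist_commute)
  ultimately obtain s where s: "s > 0" "cball x0 s \<subseteq> \<Omega> \<inter> ball y0 \<sigma>"
    unfolding open_contains_cball by blast
  \<comment> \<open>Half of \<open>s\<close> keeps the points of \<open>cball x0 r0\<close> at
    distance at least \<open>r0\<close> from the complement. This lower bound on \<open>t\<close> is
    what makes \<delta> uniform.\<close>
  define r0 where "r0 = s / 2"
  have r0: "r0 > 0" using s(1) by (simp add: r0_def)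
  have y0\<Omega>: "y0 \<notin> \<Omega>" using y0 \<Omega>(1) by (simp add: frontier_def interior_open)
  define Q where "Q = (M / 2 + 16 * \<epsilon>)\<^sup>2"
  \<comment> \<open>By \<open>r0 \<le> t\<close> the first entry gives
    \<open>norm h \<le> t / 2\<close>. The other two give
    \<open>Q (norm h)\<^sup>2 \<le> 11 * \<epsilon> * t\<close>, the bound used for
    \<open>\<beta>\<^sup>2\<close> in \<open>lower_barrier\<close>.\<close>
  define \<delta> where "\<delta> = min (r0 / 2) (min 1 (11 * \<epsilon> * r0 / (Q + 1)))"
  have Q: "Q \<ge> 0" by (simp add: Q_def)
  have \<delta>: "\<delta> > 0" using r0 \<epsilon> Q by (simp add: \<delta>_def)
  have main: "second_diff (bdist \<Omega>) r x \<ge> c / 2 * r\<^sup>2" if x: "x \<in> cball x0 r0" and r: "0 < r" "r < \<delta>" for x r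
  proof -
    have xs: "x \<in> \<Omega>" "dist x y0 < \<sigma>"
      using x s r0 by (auto simp: r0_def dist_commute subset_iff)
    obtain y where y: "y \<in> frontier \<Omega>" "y \<notin> \<Omega>" "bdist \<Omega> x = dist x y" "dist x y > 0" "ball x (dist x y) \<subseteq> \<Omega>"
      using nearest_boundary_point[OF \<Omega> xs(1)] by blast
    define t where "t = dist x y"
    have t0: "t > 0" using y(4) by (simp add: t_def)
    have "t \<le> dist x y0" using bdist_le[OF y0\<Omega>, of x] y(3) by (simp add: t_def)
    then have t\<sigma>: "t < \<sigma>" using xs(2) by simp
    have tr0: "r0 \<le> t"
    proof -
      have "y \<notin> cball x0 s" using y(2) s(2) by blast
      then have "dist x0 y > 2 * r0" by (simp add: r0_def)
      then show ?thesis using x dist_triangle[of x0 y x] by (simp add: t_def)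
    qed
    have yy0: "dist y y0 < 2 * \<sigma>"
      using dist_triangle[of y y0 x] t\<sigma> xs(2) by (simp add: t_def dist_commute)
    then have yd: "dist y y0 < d1" "dist y y0 < d2" using \<sigma>(1,6,7) by linarith+
    then have yU: "y \<in> U" using d2(2) by (auto simp: dist_commute)
    define g where "g = norm (gradient \<rho> y)"
    have Fg: "F y > H0 / 2" "g > g0 / 2" "g < 2 * g0" using d1(2)[OF yd(1)] by (auto simp: g_def)
    have g: "g > 0" using Fg(2) g0 by simp
    define \<nu> where "\<nu> = (x - y) /\<^sub>R t"
    have \<nu>: "norm \<nu> = 1" using t0 by (simp add: \<nu>_def t_def dist_norm)
    have xy: "x - y = t *\<^sub>R \<nu>" using t0 by (simp add: \<nu>_def)
    have \<rho>y: "\<rho> y = 0"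
    proof (rule defining_function_zero[OF U(1) yU _ eq _ y(2)])
      show "isCont \<rho> y" using Ck_on_2D(1)[OF \<rho> yU] by (rule differentiable_imp_continuous_within)
      show "y \<in> closure \<Omega>" using y(1) by (simp add: frontier_def)
    qed
    have G\<nu>: "gradient \<rho> y = g *\<^sub>R \<nu>"
      unfolding g_def \<nu>_def t_def
      by (rule gradient_at_nearest_point[OF U(1) yU Ck_on_2D(1)[OF \<rho> yU] eq \<rho>y y(5)]) (use y(4) in auto)
    then have in\<nu>: "inner_normal \<rho> y = \<nu>" using g \<nu> by (simp add: inner_normal_def)
    define A where "A v = A0 v /\<^sub>R g" for v
    have linA: "linear A" unfolding A_def[abs_def] by (intro linear_compose_scale_right A0.linear)
    have symA: "A u \<bullet> v = A v \<bullet> u" for u v using symA0[of u v] by (simp add: A_def)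
    have bA: "norm (A v) \<le> M * norm v" for v
    proof -
      have "norm (A v) = norm (A0 v) / g" using g by (simp add: A_def divide_inverse)
      also have "\<dots> \<le> (M0 * norm v) / (g0 / 2)"
        using M0 Fg(2) g0 by (intro frac_le) auto
      finally show ?thesis by (simp add: M_def mult_ac)
    qed
    have tc: "t * k \<le> d" if "\<sigma> \<le> d / k" "k > 0" for k d
    proof -
      have "t * k \<le> \<sigma> * k" using t\<sigma> that(2) by (intro mult_right_mono) auto
      also have "\<dots> \<le> d" using that by (simp add: field_simps)
      finally show ?thesis .
    qed
    have low: "bdist \<Omega> (x + h) \<ge> bdist \<Omega> x + \<nu> \<bullet> h
       + (A (h - (\<nu> \<bullet> h) *\<^sub>R \<nu>) \<bullet> (h - (\<nu> \<bullet> h) *\<^sub>R \<nu>)) / 2 - 16 * \<epsilon> * (norm h)\<^sup>2" if h: "norm h < \<delta>" for h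
    proof -
      obtain z where z: "z \<in> - \<Omega>" "bdist \<Omega> (x + h) = dist (x + h) z"
        using infdist_attains_inf[of "- \<Omega>" "x + h"] \<Omega> by (auto simp: bdist_def)
      define k where "k = z - y"
      have ht: "norm h \<le> t / 2" using h tr0 by (simp add: \<delta>_def)
      \<comment> \<open>The point \<open>z\<close> is no farther from \<open>x + h\<close> than
        \<open>y\<close> is, hence within \<open>t + norm h\<close>; the triangle inequality then
        bounds \<open>norm k\<close> by \<open>2 * t + 2 * norm h\<close>.\<close>
      have "norm k \<le> 4 * t"
      proof -
        have "dist (x + h) z \<le> dist (x + h) y" using bdist_le[OF y(2), of "x + h"] z(2) by simp
        also have "\<dots> \<le> t + norm h" using norm_triangle_ineq[of "x - y" h] by (simp add: dist_norm t_def algebra_simps)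
        finally have "dist (x + h) z \<le> t + norm h" .
        moreover have "norm k \<le> norm h + t + dist (x + h) z"
        proof -
          have "k = (h + t *\<^sub>R \<nu>) - (x + h - z)" by (simp add: k_def xy[symmetric])
          then have "norm k \<le> norm (h + t *\<^sub>R \<nu>) + norm (x + h - z)" by (simp only: norm_triangle_ineq4)
          moreover have "norm (h + t *\<^sub>R \<nu>) \<le> norm h + t" using norm_triangle_ineq[of h "t *\<^sub>R \<nu>"] \<nu> t0 by simp
          ultimately show ?thesis by (simp add: dist_norm)
        qed
        ultimately show ?thesis using ht t0 by linarith
      qed
      moreover have "\<nu> \<bullet> k + (A k \<bullet> k) / 2 - \<epsilon> * (norm k)\<^sup>2 \<le> 0"
      proof -
        have "dist (y + k) y0 \<le> norm k + dist y y0"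
          using norm_triangle_ineq[of k "y - y0"] by (simp add: dist_norm algebra_simps)
        also have "\<dots> < d2" using \<open>norm k \<le> 4 * t\<close> t\<sigma> yy0 \<sigma>(1,7) by linarith
        finally have kb: "y + k \<in> ball y0 d2" by (simp add: dist_commute)
        have "z \<in> U" using kb d2(2) by (auto simp: k_def)
        then have "z \<notin> {x \<in> U. \<rho> x > 0}" using z(1) eq by blast
        then have le0: "\<rho> (y + k) \<le> 0" using \<open>z \<in> U\<close> by (simp add: k_def)
        have yb: "y \<in> ball y0 d2" using yd(2) by (simp add: dist_commute)
        have "\<bar>\<rho> (y + k) - \<rho> y - gradient \<rho> y \<bullet> k - (A0 k \<bullet> k) / 2\<bar> \<le> \<epsilon> * (g0 / 2) * (norm k)\<^sup>2"
          unfolding A0_def by (rule T[OF yb kb])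
        then have "gradient \<rho> y \<bullet> k + (A0 k \<bullet> k) / 2 - \<epsilon> * (g0 / 2) * (norm k)\<^sup>2 \<le> 0"
          using \<rho>y le0 by linarith
        moreover have "\<epsilon> * (g0 / 2) * (norm k)\<^sup>2 \<le> \<epsilon> * g * (norm k)\<^sup>2"
          using Fg(2) \<epsilon> by (intro mult_right_mono mult_left_mono) auto
        moreover have "g * (\<nu> \<bullet> k + (A k \<bullet> k) / 2 - \<epsilon> * (norm k)\<^sup>2)
            = gradient \<rho> y \<bullet> k + (A0 k \<bullet> k) / 2 - \<epsilon> * g * (norm k)\<^sup>2"
          using g by (simp add: G\<nu> A_def algebra_simps)
        ultimately have "g * (\<nu> \<bullet> k + (A k \<bullet> k) / 2 - \<epsilon> * (norm k)\<^sup>2) \<le> 0" by linarith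
        then show ?thesis using g by (simp add: mult_le_0_iff)
      qed
      moreover have "(M / 2 + 16 * \<epsilon>)\<^sup>2 * (norm h)\<^sup>2 \<le> 11 * \<epsilon> * t"
      proof -
        have h1: "norm h \<le> 1" "norm h * (Q + 1) \<le> 11 * \<epsilon> * r0"
          using h Q by (auto simp: \<delta>_def field_simps)
        have "Q * (norm h)\<^sup>2 = (norm h * Q) * norm h" by (simp add: power2_eq_square)
        also have "\<dots> \<le> (norm h * Q) * 1" using h1(1) Q by (intro mult_left_mono) auto
        also have "\<dots> \<le> norm h * (Q + 1)" by (simp add: algebra_simps)
        also have "\<dots> \<le> 11 * \<epsilon> * r0" by (rule h1(2))
        also have "\<dots> \<le> 11 * \<epsilon> * t" using tr0 \<epsilon> by (intro mult_left_mono) auto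
        finally show ?thesis by (simp add: Q_def)
      qed
      ultimately have "t + \<nu> \<bullet> h + (A (h - (\<nu> \<bullet> h) *\<^sub>R \<nu>) \<bullet> (h - (\<nu> \<bullet> h) *\<^sub>R \<nu>)) / 2 - 16 * \<epsilon> * (norm h)\<^sup>2
          \<le> norm (t *\<^sub>R \<nu> + h - k)"
        using tc[OF \<sigma>(2) cs(1)] tc[OF \<sigma>(3) cs(2)] tc[OF \<sigma>(4) cs(3)] tc[OF \<sigma>(5) cs(4)]
        unfolding c1_def c2_def c3_def c4_def
        by (intro lower_barrier[OF linA symA bA less_imp_le[OF M] \<nu> \<epsilon> _ _ _ _ ht])
      moreover have "t *\<^sub>R \<nu> + h - k = x + h - z" by (simp add: k_def xy[symmetric])
      ultimately show ?thesis unfolding z(2) dist_norm[of "x + h"] y(3) t_def[symmetric] by (simp only:)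
    qed
    have sd: "second_diff (bdist \<Omega>) r x \<ge> r\<^sup>2 * ((\<Sum>b\<in>Basis. A b \<bullet> b) - A \<nu> \<bullet> \<nu> - 2 * (16 * \<epsilon>) * DIM('a))"
    proof (rule second_diff_ge_of_quadratic[OF linA \<nu> r(1)])
      fix h :: 'a assume "norm h = r"
      then show "bdist \<Omega> (x + h) \<ge> bdist \<Omega> x + \<nu> \<bullet> h
         + (A (h - (\<nu> \<bullet> h) *\<^sub>R \<nu>) \<bullet> (h - (\<nu> \<bullet> h) *\<^sub>R \<nu>)) / 2 - 16 * \<epsilon> * (norm h)\<^sup>2"
        using low[of h] r(2) by simp
    qed
    have tr: "(\<Sum>b\<in>Basis. A b \<bullet> b) - A \<nu> \<bullet> \<nu> = F y / g"
      by (simp add: A_def F_def in\<nu> divide_inverse algebra_simps sum_distrib_left)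
    have "(H0 / 2) / (2 * g0) \<le> F y / g" using Fg H0 g by (intro frac_le) auto
    then have Fc: "c / 2 \<le> F y / g - c / 2" by (simp add: c_def)
    have ec: "2 * (16 * \<epsilon>) * DIM('a) = c / 2" using n by (simp add: \<epsilon>_def n_def)
    have "r\<^sup>2 * (c / 2) \<le> r\<^sup>2 * (F y / g - c / 2)"
      using Fc by (rule mult_left_mono) simp
    also have "\<dots> \<le> second_diff (bdist \<Omega>) r x" using sd unfolding tr ec .
    finally show ?thesis by (simp add: mult.commute)
  qed
  show ?thesis
    by (rule that[of r0 x0 "c / 2" \<delta>]) (use r0 c \<delta> main s in \<open>auto simp: r0_def subset_iff\<close>)
qed

section \<open>The distributional inequality\<close>

text \<open>\<open>bdist\<close> vanishes off the domain, so the integral extends to the whole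
  space, where translation invariance applies.\<close>

lemma set_integral_bdist:
  "(LINT x:\<Omega>|lborel. bdist \<Omega> x * f x) = (\<integral>x. bdist \<Omega> x * f x \<partial>lborel)"
  unfolding set_lebesgue_integral_def
  by (rule Bochner_Integration.integral_cong) (auto simp: indicator_def bdist_def infdist_zero)

lemma test_functionD:
  assumes "test_function \<Omega> \<phi>"
  obtains R where "Ck_on 2 UNIV \<phi>" "\<And>x. x \<notin> cball 0 R \<Longrightarrow> \<phi> x = 0"
proof -
  have "bounded (closure {x. \<phi> x \<noteq> 0})"
    using assms unfolding test_function_def by (blast intro: compact_imp_bounded)
  then obtain R where "\<forall>x\<in>closure {x. \<phi> x \<noteq> 0}. norm x \<le> R"
    unfolding bounded_iff by blast
  then have "closure {x. \<phi> x \<noteq> 0} \<subseteq> cball 0 R" by auto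
  then have "\<phi> x = 0" if "x \<notin> cball 0 R" for x
    using that closure_subset[of "{x. \<phi> x \<noteq> 0}"] by blast
  with assms that show ?thesis unfolding test_function_def by blast
qed

lemma continuous_on_second_diff:
  assumes "continuous_on UNIV u"
  shows "continuous_on UNIV (second_diff u r)"
  unfolding second_diff_def[abs_def]
  by (intro continuous_intros continuous_on_compose2[OF assms]) auto

text \<open>Pointwise the second differences are only bounded by \<open>o(r\<^sup>2)\<close>, but \<open>second_diff_bdist_le\<close> is uniform on
  the support of \<open>\<phi>\<close>, so the positive part of the difference quotients converges to zero dominatedly.\<close>
lemma integral_bdist_laplacian_nonpos:
  fixes \<Omega> :: "'a::euclidean_space set"
  assumes \<Omega>: "open \<Omega>" "\<Omega> \<noteq> UNIV" and \<phi>: "test_function \<Omega> \<phi>" "\<And>x. 0 \<le> \<phi> x"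
    and lim: "\<And>x \<eta>. x \<in> \<Omega> \<Longrightarrow> \<eta> > 0 \<Longrightarrow> \<exists>\<delta>>0. \<forall>r. 0 < r \<longrightarrow> r < \<delta> \<longrightarrow> second_diff (bdist \<Omega>) r x \<le> \<eta> * r\<^sup>2"
  shows "(\<integral>x. bdist \<Omega> x * laplacian \<phi> x \<partial>lborel) \<le> 0"
proof -
  obtain R where R: "Ck_on 2 UNIV \<phi>" "\<And>x. x \<notin> cball 0 R \<Longrightarrow> \<phi> x = 0"
    using test_functionD[OF \<phi>(1)] by blast
  define K where "K = closure {x. \<phi> x \<noteq> 0}"
  have K: "compact K" "K \<subseteq> \<Omega>" using \<phi>(1) unfolding K_def test_function_def by blast+
  have supp: "x \<in> K" if "\<phi> x \<noteq> 0" for x using that closure_subset[of "{x. \<phi> x \<noteq> 0}"] unfolding K_def by blast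
  \<comment> \<open>The support is compact inside the domain, so \<open>bdist\<close> has a positive
    minimum there and \<open>second_diff_bdist_le\<close> becomes uniform. An empty support gets the
    value 1.\<close>
  obtain m where m: "m > 0" "\<And>x. x \<in> K \<Longrightarrow> m \<le> bdist \<Omega> x"
  proof (cases "K = {}")
    case False
    obtain x0 where x0: "x0 \<in> K" "\<And>x. x \<in> K \<Longrightarrow> bdist \<Omega> x0 \<le> bdist \<Omega> x"
      using continuous_attains_inf[OF K(1) False continuous_on_bdist] by blast
    have "bdist \<Omega> x0 > 0"
      using nearest_boundary_point[OF \<Omega>, of x0] x0(1) K(2) by (metis subsetD)
    with x0(2) that show ?thesis by blast
  qed (use that[of 1] in auto)
  define r where "r k = 1 / real (Suc k)" for k
  have r: "r \<longlonglongrightarrow> 0" "\<And>k. 0 < r k" "\<And>k. r k \<le> 1"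
    unfolding r_def using LIMSEQ_inverse_real_of_nat by (auto simp: inverse_eq_divide)
  \<comment> \<open>Second differences of \<open>bdist\<close> are controlled from above only.
    Truncating at 0 supplies the missing lower bound for the majorant and can only enlarge the
    integral, as \<phi> is nonnegative.\<close>
  define P where "P k x = max 0 (second_diff (bdist \<Omega>) (r k) x / (r k)\<^sup>2) * \<phi> x" for k x
  have cd: "continuous_on UNIV (\<lambda>x. second_diff (bdist \<Omega>) (r k) x / (r k)\<^sup>2 * \<phi> x)" for k
    using r(2)[of k] by (intro continuous_intros continuous_on_second_diff continuous_on_bdist Ck_on_2_continuous[OF R(1)]) auto
  have cP: "continuous_on UNIV (P k)" for k
    unfolding P_def[abs_def] using r(2)[of k]
    by (intro continuous_intros continuous_on_max continuous_on_second_diff continuous_on_bdist Ck_on_2_continuous[OF R(1)]) auto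
  have iP: "integrable lborel (P k)" for k
    by (rule integrable_bounded_support[OF cP, where R=R]) (simp add: P_def R(2))
  have bound: "P k x \<le> real DIM('a) / m * \<phi> x" for k x
  proof (cases "\<phi> x = 0")
    case False
    then have x: "x \<in> K" using supp by blast
    have "second_diff (bdist \<Omega>) (r k) x \<le> real DIM('a) / bdist \<Omega> x * (r k)\<^sup>2"
      using x K(2) by (intro second_diff_bdist_le \<Omega>) auto
    then have "second_diff (bdist \<Omega>) (r k) x / (r k)\<^sup>2 \<le> real DIM('a) / bdist \<Omega> x"
      using r(2)[of k] by (simp add: divide_le_eq)
    also have "\<dots> \<le> real DIM('a) / m" using m(1) m(2)[OF x] by (intro divide_left_mono) auto
    finally show ?thesis unfolding P_def using m(1) \<phi>(2) by (intro mult_right_mono) auto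
  qed (simp add: P_def)
  have lim0: "(\<lambda>k. P k x) \<longlonglongrightarrow> 0" for x
  proof (cases "\<phi> x = 0")
    case False
    then have x: "x \<in> \<Omega>" and p: "\<phi> x > 0" using supp K(2) \<phi>(2)[of x] by (auto simp: less_le)
    show ?thesis
    proof (rule LIMSEQ_I)
      fix e :: real assume e: "e > 0"
      define \<eta> where "\<eta> = e / (2 * \<phi> x)"
      have \<eta>: "\<eta> > 0" using e p by (simp add: \<eta>_def)
      obtain \<delta> where \<delta>: "\<delta> > 0" "\<And>r. 0 < r \<Longrightarrow> r < \<delta> \<Longrightarrow> second_diff (bdist \<Omega>) r x \<le> \<eta> * r\<^sup>2"
        using lim[OF x \<eta>] by blast
      obtain N where N: "\<And>k. k \<ge> N \<Longrightarrow> r k < \<delta>"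
        using LIMSEQ_D[OF r(1) \<delta>(1)] r(2) by (metis abs_of_pos diff_zero real_norm_def)
      have "norm (P k x - 0) < e" if "k \<ge> N" for k
      proof -
        have "second_diff (bdist \<Omega>) (r k) x / (r k)\<^sup>2 \<le> \<eta>"
          using \<delta>(2)[OF r(2) N[OF that]] r(2)[of k] by (simp add: divide_le_eq)
        then have "P k x \<le> \<eta> * \<phi> x" unfolding P_def using \<eta> p by (intro mult_right_mono) auto
        also have "\<dots> < e" using e p by (simp add: \<eta>_def)
        finally show ?thesis using p by (simp add: P_def)
      qed
      then show "\<exists>N. \<forall>k\<ge>N. norm (P k x - 0) < e" by blast
    qed
  qed (simp add: P_def)
  have limP: "(\<lambda>k. \<integral>x. P k x \<partial>lborel) \<longlonglongrightarrow> (\<integral>x. 0 \<partial>(lborel :: 'a measure))"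
  proof (rule integral_dominated_convergence)
    have "continuous_on UNIV (\<lambda>x. real DIM('a) / m * \<phi> x)"
      using m(1) by (intro continuous_intros Ck_on_2_continuous[OF R(1)]) auto
    then show "integrable lborel (\<lambda>x. real DIM('a) / m * \<phi> x)"
      by (rule integrable_bounded_support[where R=R]) (simp add: R(2))
    show "P k \<in> borel_measurable lborel" for k using iP borel_measurable_integrable by blast
    show "AE x in lborel. norm (P k x) \<le> real DIM('a) / m * \<phi> x" for k
      using bound[of k] \<phi>(2) by (intro AE_I2) (simp add: P_def abs_mult)
  qed (use lim0 in auto)
  have limD: "(\<lambda>k. \<integral>x. second_diff (bdist \<Omega>) (r k) x / (r k)\<^sup>2 * \<phi> x \<partial>lborel)
      \<longlonglongrightarrow> (\<integral>x. bdist \<Omega> x * laplacian \<phi> x \<partial>lborel)"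
    by (rule integral_second_diff_tendsto[OF continuous_on_bdist R r])
  have le: "(\<integral>x. second_diff (bdist \<Omega>) (r k) x / (r k)\<^sup>2 * \<phi> x \<partial>lborel) \<le> (\<integral>x. P k x \<partial>lborel)" for k
  proof (rule integral_mono)
    show "integrable lborel (\<lambda>x. second_diff (bdist \<Omega>) (r k) x / (r k)\<^sup>2 * \<phi> x)"
      by (rule integrable_bounded_support[OF cd, where R=R]) (simp add: R(2))
    show "second_diff (bdist \<Omega>) (r k) x / (r k)\<^sup>2 * \<phi> x \<le> P k x" for x
      unfolding P_def using \<phi>(2) by (intro mult_right_mono) auto
  qed (rule iP)
  have "(\<integral>x. bdist \<Omega> x * laplacian \<phi> x \<partial>lborel) \<le> (\<integral>x. 0 \<partial>(lborel :: 'a measure))"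
    by (rule LIMSEQ_le[OF limD limP]) (use le in blast)
  then show ?thesis by simp
qed

text \<open>Weighting the uniform lower bound with a bump supported in the ball gives
  \<open>c\<close> times the integral of \<phi>, the same for every step, so it survives the limit.
  The integral of \<phi> is positive because \<phi> is positive on a ball of positive
  measure.\<close>

lemma integral_bdist_laplacian_pos:
  fixes \<Omega> :: "'a::euclidean_space set"
  assumes r0: "r0 > 0" "cball x0 r0 \<subseteq> \<Omega>" and c: "c > 0" and \<delta>: "\<delta> > 0"
    and low: "\<And>x r. x \<in> cball x0 r0 \<Longrightarrow> 0 < r \<Longrightarrow> r < \<delta> \<Longrightarrow> second_diff (bdist \<Omega>) r x \<ge> c * r\<^sup>2"
  obtains \<phi> where "test_function \<Omega> \<phi>" "\<And>x. 0 \<le> \<phi> x" "(\<integral>x. bdist \<Omega> x * laplacian \<phi> x \<partial>lborel) > 0"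
proof -
  obtain \<phi> where \<phi>: "test_function \<Omega> \<phi>" "\<And>x. \<phi> x \<ge> 0" "\<And>x. x \<in> ball x0 r0 \<Longrightarrow> \<phi> x > 0" "\<And>x. x \<notin> ball x0 r0 \<Longrightarrow> \<phi> x = 0"
    using bump_exists[OF r0] by metis
  obtain R where R: "Ck_on 2 UNIV \<phi>" "\<And>x. x \<notin> cball 0 R \<Longrightarrow> \<phi> x = 0"
    using test_functionD[OF \<phi>(1)] by blast
  note c\<phi> = Ck_on_2_continuous[OF R(1)]
  \<comment> \<open>The factor \<open>min 1 (\<delta> / 2)\<close> makes every step at most 1, for
    the convergence of the integrals, and below \<delta>, for the lower bound.\<close>
  define r where "r k = min 1 (\<delta> / 2) / real (Suc k)" for k
  have r: "r \<longlonglongrightarrow> 0" "\<And>k. 0 < r k" "\<And>k. r k \<le> 1" "\<And>k. r k < \<delta>"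
  proof -
    have "(\<lambda>k. min 1 (\<delta> / 2) * inverse (real (Suc k))) \<longlonglongrightarrow> min 1 (\<delta> / 2) * 0"
      by (rule tendsto_mult_left[OF LIMSEQ_inverse_real_of_nat])
    then show "r \<longlonglongrightarrow> 0" unfolding r_def[abs_def] by (simp only: divide_inverse mult_zero_right)
    show "0 < r k" for k using \<delta> by (simp add: r_def)
    have "r k \<le> min 1 (\<delta> / 2) / 1" for k
      unfolding r_def using \<delta> by (intro divide_left_mono) auto
    then have "r k \<le> 1" "r k \<le> \<delta> / 2" for k by simp_all
    then show "r k \<le> 1" "r k < \<delta>" for k using \<delta> le_less_trans[of "r k" "\<delta> / 2" \<delta>] by simp_all
  qed
  have i\<phi>: "integrable lborel \<phi>" by (rule integrable_bounded_support[OF c\<phi> R(2)])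
  have pos: "(\<integral>x. \<phi> x \<partial>lborel) > 0"
  proof (rule ccontr)
    assume "\<not> ?thesis"
    moreover have "(\<integral>x. \<phi> x \<partial>lborel) \<ge> 0" using \<phi>(2) by (rule Bochner_Integration.integral_nonneg)
    ultimately have "(\<integral>x. \<phi> x \<partial>lborel) = 0" by simp
    then have "AE x in lborel. \<phi> x = 0"
      using integral_nonneg_eq_0_iff_AE[OF i\<phi>] \<phi>(2) by auto
    then have "AE x in lborel. x \<notin> ball x0 r0" by (rule eventually_mono) (use \<phi>(3) in force)
    moreover have "{x \<in> space lborel. \<not> x \<notin> ball x0 r0} = ball x0 r0" by auto
    ultimately have "emeasure lborel (ball x0 r0) = 0"
      by (intro iffD1[OF AE_iff_measurable]) auto
    then show False using r0(1) unit_ball_vol_pos[of "real DIM('a)"] by (simp add: emeasure_ball)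
  qed
  have "(\<lambda>k. \<integral>x. second_diff (bdist \<Omega>) (r k) x / (r k)\<^sup>2 * \<phi> x \<partial>lborel)
      \<longlonglongrightarrow> (\<integral>x. bdist \<Omega> x * laplacian \<phi> x \<partial>lborel)"
    by (rule integral_second_diff_tendsto[OF continuous_on_bdist R r(1-3)])
  moreover have "c * (\<integral>x. \<phi> x \<partial>lborel) \<le> (\<integral>x. second_diff (bdist \<Omega>) (r k) x / (r k)\<^sup>2 * \<phi> x \<partial>lborel)" for k
  proof -
    have "(\<integral>x. c * \<phi> x \<partial>lborel) \<le> (\<integral>x. second_diff (bdist \<Omega>) (r k) x / (r k)\<^sup>2 * \<phi> x \<partial>lborel)"
    proof (rule integral_mono)
      show "integrable lborel (\<lambda>x. c * \<phi> x)" using i\<phi> by simp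
      have "continuous_on UNIV (\<lambda>x. second_diff (bdist \<Omega>) (r k) x / (r k)\<^sup>2 * \<phi> x)"
        using r(2)[of k] by (intro continuous_intros continuous_on_second_diff continuous_on_bdist c\<phi>) auto
      then show "integrable lborel (\<lambda>x. second_diff (bdist \<Omega>) (r k) x / (r k)\<^sup>2 * \<phi> x)"
        by (rule integrable_bounded_support[where R=R]) (simp add: R(2))
      show "c * \<phi> x \<le> second_diff (bdist \<Omega>) (r k) x / (r k)\<^sup>2 * \<phi> x" for x
      proof (cases "x \<in> ball x0 r0")
        case True
        then have "c \<le> second_diff (bdist \<Omega>) (r k) x / (r k)\<^sup>2"
          using low[of x "r k"] r(2,4)[of k] by (simp add: le_divide_eq)
        then show ?thesis using \<phi>(2) by (rule mult_right_mono)
      qed (simp add: \<phi>(4))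
    qed
    then show ?thesis by simp
  qed
  ultimately have "c * (\<integral>x. \<phi> x \<partial>lborel) \<le> (\<integral>x. bdist \<Omega> x * laplacian \<phi> x \<partial>lborel)"
    by (intro LIMSEQ_le_const) auto
  then show ?thesis using that[OF \<phi>(1,2)] mult_pos_pos[OF c pos] by linarith
qed

text \<open>The argument runs with the very defining function that
  \<open>principal_curvatures\<close> selects, so the curvature formula and the barriers speak of
  the same \<rho>. Both directions are phrased through the sign of its tangential Hessian trace
  \<open>T\<close>.\<close>

lemma mean_convex_iff:
  fixes \<Omega> :: "'a::euclidean_space set"
  assumes dim: "DIM('a) \<ge> 2" and \<Omega>: "open \<Omega>" "\<Omega> \<noteq> UNIV" and C2: "C2_boundary \<Omega>"
  shows "mean_convex \<Omega> \<longleftrightarrow> neg_laplacian_nonneg_distr \<Omega> (bdist \<Omega>)"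
proof -
  define \<rho> where "\<rho> y = (SOME \<rho>. local_defining_function \<Omega> y \<rho>)" for y
  have \<rho>: "\<exists>U. open U \<and> y \<in> U \<and> Ck_on 2 U (\<rho> y) \<and> (\<forall>x\<in>U. gradient (\<rho> y) x \<noteq> 0) \<and> \<Omega> \<inter> U = {x\<in>U. \<rho> y x > 0}"
    if "y \<in> frontier \<Omega>" for y
  proof -
    have "local_defining_function \<Omega> y (\<rho> y)"
      unfolding \<rho>_def using C2 that by (metis C2_boundary_def someI_ex)
    then show ?thesis unfolding local_defining_function_def .
  qed
  define T where "T y = (\<Sum>i\<in>Basis. hess (\<rho> y) y i \<bullet> i) - hess (\<rho> y) y (inner_normal (\<rho> y) y) \<bullet> inner_normal (\<rho> y) y" for y
  have mc: "mean_curvature \<Omega> y \<ge> 0 \<longleftrightarrow> T y \<le> 0" if y: "y \<in> frontier \<Omega>" for y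
  proof -
    obtain U where U: "open U" "y \<in> U" "Ck_on 2 U (\<rho> y)" "gradient (\<rho> y) y \<noteq> 0"
      using \<rho>[OF y] by blast
    have "(\<Sum>\<^sub># (principal_curvatures \<Omega> y)) = - T y / norm (gradient (\<rho> y) y)"
      unfolding principal_curvatures_def \<rho>_def[symmetric] T_def
      by (rule sum_principal_curvatures_wrt[OF U(3,1,2,4)])
    then have "mean_curvature \<Omega> y = - T y / ((real DIM('a) - 1) * norm (gradient (\<rho> y) y))"
      by (simp add: mean_curvature_def)
    \<comment> \<open>Here dimension at least 2 enters: the normalising factor is positive, so the
      signs of the mean curvature and of \<open>- T y\<close> agree.\<close>
    moreover have "(real DIM('a) - 1) * norm (gradient (\<rho> y) y) > 0" using dim U(4) by simp
    ultimately show ?thesis by (simp only: zero_le_divide_iff) auto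
  qed
  show ?thesis
  proof
    assume "mean_convex \<Omega>"
    then have T: "T y \<le> 0" if "y \<in> frontier \<Omega>" for y using mc that by (auto simp: mean_convex_def)
    have "\<exists>\<delta>>0. \<forall>r. 0 < r \<longrightarrow> r < \<delta> \<longrightarrow> second_diff (bdist \<Omega>) r x \<le> \<eta> * r\<^sup>2" if x: "x \<in> \<Omega>" and \<eta>: "\<eta> > 0" for x \<eta>
    proof -
      obtain y where y: "y \<in> frontier \<Omega>" "y \<notin> \<Omega>" "bdist \<Omega> x = dist x y" "dist x y > 0" "ball x (dist x y) \<subseteq> \<Omega>"
        using nearest_boundary_point[OF \<Omega> x] by blast
      obtain U where U: "open U" "y \<in> U" "Ck_on 2 U (\<rho> y)" "gradient (\<rho> y) y \<noteq> 0" "\<Omega> \<inter> U = {x\<in>U. \<rho> y x > 0}"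
        using \<rho>[OF y(1)] by blast
      show ?thesis
        using second_diff_bdist_upper[OF y(2,1,3-5) U T[OF y(1), unfolded T_def] \<eta>] by metis
    qed
    then show "neg_laplacian_nonneg_distr \<Omega> (bdist \<Omega>)"
      unfolding neg_laplacian_nonneg_distr_def set_integral_bdist
      using integral_bdist_laplacian_nonpos[OF \<Omega>] by simp
  next
    assume distr: "neg_laplacian_nonneg_distr \<Omega> (bdist \<Omega>)"
    have "T y \<le> 0" if y: "y \<in> frontier \<Omega>" for y
    proof (rule ccontr)
      assume "\<not> T y \<le> 0"
      then have T: "T y > 0" by simp
      obtain U where U: "open U" "y \<in> U" "Ck_on 2 U (\<rho> y)" "gradient (\<rho> y) y \<noteq> 0" "\<Omega> \<inter> U = {x\<in>U. \<rho> y x > 0}"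
        using \<rho>[OF y(1)] by blast
      show False
      proof (rule second_diff_bdist_lower[OF \<Omega> y U T[unfolded T_def]])
        fix r0 x0 c \<delta>
        assume low: "r0 > 0" "cball x0 r0 \<subseteq> \<Omega>" "c > 0" "\<delta> > 0"
          "\<And>x r. x \<in> cball x0 r0 \<Longrightarrow> 0 < r \<Longrightarrow> r < \<delta> \<Longrightarrow> second_diff (bdist \<Omega>) r x \<ge> c * r\<^sup>2"
        show False
        proof (rule integral_bdist_laplacian_pos[OF low])
          fix \<phi> assume "test_function \<Omega> \<phi>" "\<And>x. 0 \<le> \<phi> x" "(\<integral>x. bdist \<Omega> x * laplacian \<phi> x \<partial>lborel) > 0"
          then show False
            using distr unfolding neg_laplacian_nonneg_distr_def set_integral_bdist by force
        qed
      qed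
    qed
    then show "mean_convex \<Omega>" using mc by (auto simp: mean_convex_def)
  qed
qed

theorem mainTheorem3:
  fixes \<Omega> :: "(real ^ 'n) set"
  assumes "CARD('n) \<ge> 2"
    and "open \<Omega>" and "connected \<Omega>" and "\<Omega> \<subset> UNIV"
    and "C2_boundary \<Omega>"
    and "uniform_interior_sphere \<Omega>"
  shows "mean_convex \<Omega> \<longleftrightarrow> neg_laplacian_nonneg_distr \<Omega> (bdist \<Omega>)"
  using assms by (intro mean_convex_iff) auto

end
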